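(* Let $n=2$, let $\gamma>0$, and let $\Omega\subset\mathbb{R}^2$ be open. Let $u$ be a weak solution of problem $(P_\gamma)$ in $\Omega$ such that for every point $(x,0)\in\Omega$ there exist a neighborhood $K\subset\subset\Omega$ of $(x,0)$ and a constant $C<\infty$ (possibly depending on $K$) with $$|\nabla u(x_1,x_2)|\le C|x_2|^{\gamma}\qquad\text{for all }(x_1,x_2)\in K.$$ Then $\Sigma_{\text{cusps}}=\emptyset$.
   Context: Problem $(P_\gamma)$ in $\Omega\subset\mathbb{R}^2$ is the free-boundary problem: $\Delta u=0$ in $\{u>0\}\cap\Omega$, and $|\nabla u(x_1,x_2)|=|x_2|^{\gamma}$ on $\partial\{u>0\}\cap\Omega$. Weak solution: a function $u\in W^{1,2}_{\mathrm{loc}}(\Omega)$ is a weak solution of $(P_\gamma)$ if (1) $u\in C^0(\Omega)$ and $u\ge 0$ in $\Omega$; (2) $u$ is harmonic in $\{u>0\}\cap\Omega$; (3) for every $\tau>0$, the topological free boundary $\partial\{u>0\}\cap\Omega\cap\{|x_2|>\tau\}$ can be decomposed into a $1$-dimensional $C^{2,\alpha}$-surface, denoted $\partial_{red}\{u>0\}$, which is relatively open in $\partial\{u>0\}$, and a singular set of $\mathcal{H}^{1}$-measure zero; (4) for any open neighborhood $V$ containing a point $x_0\in\Omega\cap\{|x_2|>\tau\}\cap\partial_{red}\{u>0\}$, the function $u$ belongs to $C^1(V\cap\overline{\{u>0\}})$ and satisfies $|\nabla u|^2=|x_2|^{2\gamma}$ on $V\cap\partial_{red}\{u>0\}$. It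 is not assumed that $u\equiv 0$ in $\Omega\cap\{x_2\le 0\}$. Here $\nabla u$ is the (weak) gradient of $u\in W^{1,2}_{\mathrm{loc}}(\Omega)$, so the pointwise bound on $|\nabla u|$ is understood up to Lebesgue-null sets. Set $\Sigma:=\partial\{u>0\}\cap\{x_2=0\}\cap\Omega$. The density of $\{u>0\}$ at a point $p$ is $\theta^2_{\{u>0\}}(p)=\lim_{r\to0^+}\frac{\mathcal{H}^2(B_r(p)\cap\{u>0\})}{\pi r^2}$, and $\Sigma_{\text{cusps}}:=\{p\in\Sigma:\theta^2_{\{u>0\}}(p)=0\}$, i.e. the set of $p\in\Sigma$ at which this limit exists and equals $0$. *)

theory Defs
  imports "HOL-Analysis.Analysis"
begin

section \<open>Classical derivatives in the plane\<close>

definition partial_deriv :: "2 \<Rightarrow> (real^2 \<Rightarrow> real) \<Rightarrow> real^2 \<Rightarrow> real" where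
  "partial_deriv i f x = frechet_derivative f (at x) (axis i 1)"

definition grad :: "(real^2 \<Rightarrow> real) \<Rightarrow> real^2 \<Rightarrow> real^2" where
  "grad f x = (\<chi> i. partial_deriv i f x)"

definition laplacian :: "(real^2 \<Rightarrow> real) \<Rightarrow> real^2 \<Rightarrow> real" where
  "laplacian f x = (\<Sum>i\<in>UNIV. partial_deriv i (partial_deriv i f) x)"

text \<open>Derivatives are taken at \<open>x\<close> in the full space, so this is meant for open \<open>S\<close> only.\<close>

primrec Ck_on :: "nat \<Rightarrow> (real^2) set \<Rightarrow> (real^2 \<Rightarrow> real) \<Rightarrow> bool" where
  "Ck_on 0 S f \<longleftrightarrow> continuous_on S f"
| "Ck_on (Suc k) S f \<longleftrightarrow>
     (\<forall>x\<in>S. f differentiable (at x)) \<and> (\<forall>i. Ck_on k S (partial_deriv i f))"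

definition harmonic_on :: "(real^2) set \<Rightarrow> (real^2 \<Rightarrow> real) \<Rightarrow> bool" where
  "harmonic_on S f \<longleftrightarrow> Ck_on 2 S f \<and> (\<forall>x\<in>S. laplacian f x = 0)"

section \<open>The local Sobolev space of square-integrable weak gradients\<close>

definition test_function :: "(real^2) set \<Rightarrow> (real^2 \<Rightarrow> real) \<Rightarrow> bool" where
  "test_function \<Omega> \<phi> \<longleftrightarrow> (\<forall>k. Ck_on k UNIV \<phi>) \<and>
     compact (closure {x. \<phi> x \<noteq> 0}) \<and> closure {x. \<phi> x \<noteq> 0} \<subseteq> \<Omega>"

definition Lp_loc :: "real \<Rightarrow> (real^2) set \<Rightarrow> (real^2 \<Rightarrow> 'b::euclidean_space) \<Rightarrow> bool" where
  "Lp_loc p \<Omega> f \<longleftrightarrow> (\<forall>K. compact K \<and> K \<subseteq> \<Omega> \<longrightarrow>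
     set_borel_measurable lebesgue K f \<and> set_integrable lebesgue K (\<lambda>x. norm (f x) powr p))"

definition weak_gradient :: "(real^2) set \<Rightarrow> (real^2 \<Rightarrow> real) \<Rightarrow> (real^2 \<Rightarrow> real^2) \<Rightarrow> bool" where
  "weak_gradient \<Omega> u Du \<longleftrightarrow> Lp_loc 1 \<Omega> u \<and> Lp_loc 1 \<Omega> Du \<and>
     (\<forall>\<phi>. test_function \<Omega> \<phi> \<longrightarrow>
        (LINT x:\<Omega>|lebesgue. u x *\<^sub>R grad \<phi> x) = - (LINT x:\<Omega>|lebesgue. \<phi> x *\<^sub>R Du x))"

definition W12_loc :: "(real^2) set \<Rightarrow> (real^2 \<Rightarrow> real) \<Rightarrow> bool" where
  "W12_loc \<Omega> u \<longleftrightarrow> Lp_loc 2 \<Omega> u \<and> (\<exists>Du. weak_gradient \<Omega> u Du \<and> Lp_loc 2 \<Omega> Du)"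

section \<open>Hausdorff measure\<close>

text \<open>
  Normalised so that in dimension \<open>n\<close> the measure of exponent \<open>n\<close> is Lebesgue measure.
  Because \<open>0 powr 0 = 0\<close>, only exponents \<open>s > 0\<close> are meaningful.
\<close>

definition hausdorff_premeasure :: "real \<Rightarrow> real \<Rightarrow> 'a::metric_space set \<Rightarrow> ennreal" where
  "hausdorff_premeasure s \<delta> A =
     (INF U \<in> {U :: nat \<Rightarrow> 'a set. A \<subseteq> (\<Union>i. U i) \<and> (\<forall>i. bounded (U i) \<and> diameter (U i) \<le> \<delta>)}.
        (\<Sum>i. ennreal (unit_ball_vol s * (diameter (U i) / 2) powr s)))"

definition hausdorff_measure :: "real \<Rightarrow> 'a::metric_space set \<Rightarrow> ennreal" where
  "hausdorff_measure s A = (SUP \<delta>\<in>{0<..}. hausdorff_premeasure s \<delta> A)"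

section \<open>Hoelder-regular curves\<close>

definition C2_holder_on :: "real \<Rightarrow> real set \<Rightarrow> (real \<Rightarrow> real) \<Rightarrow> bool" where
  "C2_holder_on \<alpha> I g \<longleftrightarrow> (\<exists>g' g'' C.
     (\<forall>s\<in>I. (g has_real_derivative g' s) (at s) \<and> (g' has_real_derivative g'' s) (at s)) \<and>
     (\<forall>s\<in>I. \<forall>t\<in>I. \<bar>g'' s - g'' t\<bar> \<le> C * \<bar>s - t\<bar> powr \<alpha>))"

text \<open>
  Embedded one-dimensional surfaces: near each of its points, the set is the graph of a function
  with Hoelder continuous second derivative in a suitable orthonormal frame \<open>e\<close>, \<open>f\<close>.
\<close>

definition C2_holder_curve :: "real \<Rightarrow> (real^2) set \<Rightarrow> bool" where
  "C2_holder_curve \<alpha> R \<longleftrightarrow> (\<forall>p\<in>R. \<exists>e f a b c d g.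
     norm e = 1 \<and> norm f = 1 \<and> e \<bullet> f = 0 \<and>
     p \<bullet> e \<in> {a<..<b} \<and> p \<bullet> f \<in> {c<..<d} \<and>
     C2_holder_on \<alpha> {a<..<b} g \<and> g ` {a<..<b} \<subseteq> {c<..<d} \<and>
     R \<inter> {s *\<^sub>R e + t *\<^sub>R f |s t. s \<in> {a<..<b} \<and> t \<in> {c<..<d}}
       = {s *\<^sub>R e + g s *\<^sub>R f |s. s \<in> {a<..<b}})"

section \<open>Weak solutions\<close>

definition pos_set :: "(real^2) set \<Rightarrow> (real^2 \<Rightarrow> real) \<Rightarrow> (real^2) set" where
  "pos_set \<Omega> u = {x\<in>\<Omega>. u x > 0}"

text \<open>
  \<open>u\<close> is continuously differentiable on \<open>V \<inter> closure P\<close> (for open \<open>V\<close>, \<open>P\<close>): its gradient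
  exists in \<open>V \<inter> P\<close> and extends continuously up to the boundary. The extension \<open>G\<close> is
  uniquely determined on \<open>V \<inter> closure P\<close>.
\<close>

definition C1_up_to_boundary ::
  "(real^2) set \<Rightarrow> (real^2) set \<Rightarrow> (real^2 \<Rightarrow> real) \<Rightarrow> (real^2 \<Rightarrow> real^2) \<Rightarrow> bool" where
  "C1_up_to_boundary V P u G \<longleftrightarrow>
     continuous_on (V \<inter> closure P) u \<and> continuous_on (V \<inter> closure P) G \<and>
     (\<forall>x \<in> V \<inter> P. GDERIV u x :> G x)"

text \<open>
  \<open>R\<close> is the reduced free boundary in \<open>{\<bar>x\<^sub>2\<bar> > \<tau>}\<close> and the singular set is its complement there.
  The one-sided differentiability and the gradient condition are required in some
  neighbourhood of each point of \<open>R\<close>.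
\<close>

definition weak_solution :: "real \<Rightarrow> (real^2) set \<Rightarrow> (real^2 \<Rightarrow> real) \<Rightarrow> bool" where
  "weak_solution \<gamma> \<Omega> u \<longleftrightarrow>
     W12_loc \<Omega> u \<and>
     continuous_on \<Omega> u \<and> (\<forall>x\<in>\<Omega>. u x \<ge> 0) \<and>
     harmonic_on (pos_set \<Omega> u) u \<and>
     (\<forall>\<tau>>0. \<exists>R \<alpha>.
        R \<subseteq> frontier (pos_set \<Omega> u) \<inter> \<Omega> \<inter> {x. \<bar>x$2\<bar> > \<tau>} \<and>
        0 < \<alpha> \<and> \<alpha> < 1 \<and> C2_holder_curve \<alpha> R \<and>
        openin (top_of_set (frontier (pos_set \<Omega> u))) R \<and>
        hausdorff_measure 1 (frontier (pos_set \<Omega> u) \<inter> \<Omega> \<inter> {x. \<bar>x$2\<bar> > \<tau>} - R) = 0 \<and>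
        (\<forall>x0\<in>R. \<exists>V G. open V \<and> x0 \<in> V \<and> V \<subseteq> \<Omega> \<and>
           C1_up_to_boundary V (pos_set \<Omega> u) u G \<and>
           (\<forall>x \<in> V \<inter> R. (norm (G x))\<^sup>2 = \<bar>x$2\<bar> powr (2 * \<gamma>))))"

section \<open>Cusps\<close>

definition degenerate_set :: "(real^2) set \<Rightarrow> (real^2 \<Rightarrow> real) \<Rightarrow> (real^2) set" where
  "degenerate_set \<Omega> u = frontier (pos_set \<Omega> u) \<inter> {x. x$2 = 0} \<inter> \<Omega>"

definition has_density :: "(real^2) set \<Rightarrow> real^2 \<Rightarrow> ennreal \<Rightarrow> bool" where
  "has_density A p \<theta> \<longleftrightarrow>
     ((\<lambda>r. hausdorff_measure 2 (ball p r \<inter> A) / ennreal (pi * r\<^sup>2)) \<longlongrightarrow> \<theta>) (at_right 0)"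

definition cusps :: "(real^2) set \<Rightarrow> (real^2 \<Rightarrow> real) \<Rightarrow> (real^2) set" where
  "cusps \<Omega> u = {p \<in> degenerate_set \<Omega> u. has_density (pos_set \<Omega> u) p 0}"

end

theory Submission
  imports Defs
begin

text \<open>
  Write \<open>E\<close> for the positivity set \<open>{u > 0}\<close> and \<open>w x = \<bar>x\<^sub>2\<bar> powr \<gamma>\<close>. The theorem is a density estimate:
  if the weighted volume \<open>V r\<close>, the integral of \<open>w\<close> over \<open>E \<inter> ball p r\<close>, is a small multiple of
  \<open>r powr (2 + \<gamma>)\<close> for one small \<open>r\<close>, then \<open>E\<close> is empty in half of that ball. At a point of
  density zero \<open>V r\<close> is \<open>o(r powr (2 + \<gamma>))\<close>, so such a point cannot lie on the free boundary.

  The estimate combines two inequalities. The first comes from the free boundary condition. Let \<open>q\<close> be a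
  nonnegative cutoff and let \<open>Y\<close> be a vector field with \<open>\<bar>Y\<bar> \<le> w q\<close>. On the free boundary \<open>\<nabla>u\<close> has
  length \<open>w\<close> and points into \<open>E\<close>, so the outward flux of \<open>Y + 2 q \<nabla>u\<close> through it is not positive;
  since \<open>u\<close> is harmonic in \<open>E\<close>, the divergence theorem says that the integral of
  \<open>div Y + 2 \<nabla>q \<bullet> \<nabla>u\<close> over \<open>E\<close> is not positive. The proof avoids boundary integrals: the
  divergence of \<open>\<psi>(u) (Y + q' \<nabla>u)\<close> integrates to zero when \<open>\<psi>\<close> vanishes near \<open>0\<close>, and the term
  with \<open>\<psi>'(u)\<close> has a sign as soon as \<open>\<bar>Y\<bar> \<le> q' \<bar>\<nabla>u\<bar>\<close> where \<open>u\<close> is small (\<open>flux_inequality\<close>). The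
  factor \<open>2\<close> in \<open>q' = 2 q\<close> leaves room for \<open>w \<le> 2 \<bar>\<nabla>u\<bar>\<close>, which holds near the regular part of the free
  boundary by continuity of the gradient up to that part
  (\<open>gradient_lower_bound_near_free_boundary\<close>). The singular set and the axis are cut out: the former is
  covered by balls with small total radius, and near the axis \<open>w\<close> is small enough to pay for the gradient
  of a cutoff (\<open>degenerate_cutoff\<close>).

  The second inequality is a weighted isoperimetric inequality in dual form (\<open>exists_calibration\<close>). Let
  \<open>f\<close> be a continuous function with compact support, between \<open>0\<close> and \<open>1\<close>, with
  \<open>\<integral>f w \<le> l powr (2 + \<gamma>)\<close>; the functions used approximate the indicator function of
  \<open>E \<inter> ball p r\<close>. There is a field \<open>N\<close> with \<open>\<bar>N\<bar> \<le> 3 l\<close> and \<open>div (w N) \<ge> f w\<close>: at heights where the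
  horizontal slice of \<open>f\<close> has small mass compared with \<open>l\<close> mainly a horizontal field does it, and the other
  heights are so few that a vertical field pointing away from the axis, for which the derivative of
  \<open>w\<close> has the good sign, does it there.

  Inserting \<open>Y = q w N / (3 l)\<close> with \<open>q = 1\<close> on \<open>ball p s\<close> and \<open>q = 0\<close> off \<open>ball p r\<close>, and estimating
  \<open>\<bar>\<nabla>u\<bar> \<le> C w\<close>, gives \<open>V s \<le> c l / (r - s) V r\<close> (\<open>weighted_volume_decay\<close>). With
  \<open>l = V r powr (1 / (2 + \<gamma>))\<close> this is superlinear in \<open>V\<close>, and an iteration over shrinking radii
  forces \<open>V\<close> to vanish on half of a ball where it was small (\<open>de_giorgi_iteration\<close>). The hypothesis on the
  weak gradient enters only as a pointwise bound for the classical gradient in \<open>E\<close>, obtained by testing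
  with bump functions (\<open>norm_grad_le_of_weak_gradient_bound\<close>).
\<close>

section \<open>Cutoffs and the divergence theorem without boundary terms\<close>

text \<open>
  A continuously differentiable quadratic spline that equals \<open>0\<close> on \<open>t \<le> 1\<close> and \<open>1\<close> on \<open>t \<ge> 2\<close>. One such
  function serves for the truncation in the values of \<open>u\<close> and for all spatial cutoffs.
\<close>

definition step :: "real \<Rightarrow> real" where
  "step t = 2 * (max 0 (t - 1))\<^sup>2 - 4 * (max 0 (t - 3/2))\<^sup>2 + 2 * (max 0 (t - 2))\<^sup>2"

definition step' :: "real \<Rightarrow> real" where
  "step' t = 4 * max 0 (t - 1) - 8 * max 0 (t - 3/2) + 4 * max 0 (t - 2)"

lemma max_0_square_deriv:
  "((\<lambda>t::real. (max 0 (t - a))\<^sup>2) has_real_derivative 2 * max 0 (t - a)) (at t)"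
proof -
  have 0: "((\<lambda>s. (max 0 (s - a))\<^sup>2 / (s - a)) \<longlongrightarrow> 0) (at a)"
  proof (rule Lim_null_comparison)
    show "\<forall>\<^sub>F s in at a. norm ((max 0 (s - a))\<^sup>2 / (s - a)) \<le> \<bar>s - a\<bar>"
      by (rule always_eventually) (auto simp: power2_eq_square max_def)
    show "((\<lambda>s. \<bar>s - a\<bar>) \<longlongrightarrow> 0) (at a)"
      by (auto intro!: tendsto_eq_intros)
  qed
  consider "t < a" | "t = a" | "t > a" by linarith
  then show ?thesis
  proof cases
    case 1
    have "((\<lambda>t::real. 0) has_real_derivative 2 * max 0 (t - a)) (at t)"
      using 1 by simp
    moreover have ev: "\<forall>\<^sub>F s in nhds t. 0 = (max 0 (s - a))\<^sup>2"
      using eventually_nhds_in_open[of "{..<a}" t] 1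
      by (auto elim!: eventually_mono)
    ultimately show ?thesis
      by (simp only: DERIV_cong_ev[OF refl ev refl])
  next
    case 2
    then show ?thesis using 0 by (simp add: has_field_derivative_iff)
  next
    case 3
    have "((\<lambda>t::real. (t - a)\<^sup>2) has_real_derivative 2 * max 0 (t - a)) (at t)"
      using 3 by (auto intro!: derivative_eq_intros)
    moreover have ev: "\<forall>\<^sub>F s in nhds t. (s - a)\<^sup>2 = (max 0 (s - a))\<^sup>2"
      using eventually_nhds_in_open[of "{a<..}" t] 3
      by (auto elim!: eventually_mono)
    ultimately show ?thesis
      by (simp only: DERIV_cong_ev[OF refl ev refl])
  qed
qed

lemma step_deriv: "(step has_real_derivative step' t) (at t)"
proof -
  have "((\<lambda>t. 2 * (max 0 (t - 1))\<^sup>2 - 4 * (max 0 (t - 3/2))\<^sup>2 + 2 * (max 0 (t - 2))\<^sup>2)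
      has_real_derivative 2 * (2 * max 0 (t - 1)) - 4 * (2 * max 0 (t - 3/2)) + 2 * (2 * max 0 (t - 2))) (at t)"
    by (intro DERIV_add DERIV_diff DERIV_cmult max_0_square_deriv)
  then show ?thesis by (simp add: step_def[abs_def] step'_def)
qed

lemma step_deriv_compose [derivative_intros]:
  "(f has_real_derivative f') (at x within A) \<Longrightarrow>
   ((\<lambda>x. step (f x)) has_real_derivative (step' (f x) * f')) (at x within A)"
  using DERIV_chain2[OF step_deriv] by auto

lemma step'_bounds: "0 \<le> step' t" "step' t \<le> 2"
  unfolding step'_def max_def by auto

lemma step_0 [simp]: "t \<le> 1 \<Longrightarrow> step t = 0" "t \<le> 1 \<Longrightarrow> step' t = 0"
  by (auto simp: step_def step'_def)

lemma step_1 [simp]: "2 \<le> t \<Longrightarrow> step t = 1" "2 \<le> t \<Longrightarrow> step' t = 0"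
  by (auto simp: step_def step'_def max_def power2_eq_square algebra_simps)

lemma step_mono: "s \<le> t \<Longrightarrow> step s \<le> step t"
  by (rule DERIV_nonneg_imp_nondecreasing[of s t step]) (use step_deriv step'_bounds in blast)+

lemma step_bounds: "0 \<le> step t" "step t \<le> 1"
  using step_mono[of "min t 1" t] step_mono[of t "max t 2"] by auto

lemma continuous_step [continuous_intros]:
  "continuous_on S f \<Longrightarrow> continuous_on S (\<lambda>x. step (f x))"
  "continuous_on S f \<Longrightarrow> continuous_on S (\<lambda>x. step' (f x))"
  unfolding step_def step'_def by (auto intro!: continuous_intros)

lemma integrable_continuous_compact_support:
  fixes W :: "'a::euclidean_space \<Rightarrow> 'b::euclidean_space"
  assumes "continuous_on UNIV W" "compact K" "\<And>x. x \<notin> K \<Longrightarrow> W x = 0"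
  shows "integrable lborel W"
proof -
  have "integrable lborel (\<lambda>x. indicator K x *\<^sub>R W x)"
    by (rule borel_integrable_compact)
      (use assms continuous_on_subset in blast)+
  moreover have "(\<lambda>x. indicator K x *\<^sub>R W x) = W"
    using assms(3) by (auto simp: indicator_def)
  ultimately show ?thesis by simp
qed

text \<open>
  The difference quotients of \<open>W\<close> in direction \<open>e\<close> integrate to zero because Lebesgue measure is
  invariant under translations; dominated convergence passes this to the derivative. This replaces Fubini
  and works in any direction.
\<close>

lemma integral_directional_derivative_eq_0:
  fixes W W' :: "'a::euclidean_space \<Rightarrow> real"
  assumes cont: "continuous_on UNIV W" "continuous_on UNIV W'"
    and K: "compact K" "\<And>x. x \<notin> K \<Longrightarrow> W x = 0" "\<And>x. x \<notin> K \<Longrightarrow> W' x = 0"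
    and der: "\<And>x. ((\<lambda>t. W (x + t *\<^sub>R e)) has_real_derivative W' x) (at 0)"
  shows "(LINT x|lborel. W' x) = 0"
proof -
  have int: "integrable lborel W" "integrable lborel W'"
    using integrable_continuous_compact_support cont K by blast+
  have der': "((\<lambda>t. W (x + t *\<^sub>R e)) has_real_derivative W' (x + s *\<^sub>R e)) (at s)" for x s
    using DERIV_shift[of "\<lambda>t. W (x + t *\<^sub>R e)" "W' (x + s *\<^sub>R e)" 0 s] der[of "x + s *\<^sub>R e"]
    by (simp add: algebra_simps)
  have "bounded (W' ` K)"
    using compact_continuous_image[OF continuous_on_subset[OF cont(2)] K(1)] compact_imp_bounded
    by blast
  then obtain M0 where "\<And>x. x \<in> K \<Longrightarrow> \<bar>W' x\<bar> \<le> M0" by (auto simp: bounded_iff)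
  then have M: "\<bar>W' x\<bar> \<le> max M0 0" for x using K(3)[of x] by (cases "x \<in> K") fastforce+
  define M where "M = max M0 0"
  obtain B where B: "\<And>x. x \<in> K \<Longrightarrow> norm x \<le> B"
    using compact_imp_bounded[OF K(1)] by (auto simp: bounded_iff)
  define h :: "nat \<Rightarrow> real" where "h n = 1 / (real n + 1)" for n
  have h: "0 < h n" "h n \<le> 1" for n by (auto simp: h_def)
  have h0: "h \<longlonglongrightarrow> 0"
    unfolding h_def using LIMSEQ_inverse_real_of_nat by (simp add: inverse_eq_divide add.commute)
  define Q where "Q n x = (W (x + h n *\<^sub>R e) - W x) / h n" for n x
  have intW: "integrable lborel (\<lambda>x. W (x + c))" "(LINT x|lborel. W (x + c)) = (LINT x|lborel. W x)" for c
    using integrable_distr_eq[of "(+) c" lborel borel W] integral_distr[of "(+) c" lborel borel W]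
      int(1) lborel_distr_plus[of c] by (auto simp: add.commute)
  have Q0: "(LINT x|lborel. Q n x) = 0" for n
    unfolding Q_def using intW[of "h n *\<^sub>R e"] int by simp
  have "(\<lambda>n. LINT x|lborel. Q n x) \<longlonglongrightarrow> (LINT x|lborel. W' x)"
  proof (rule integral_dominated_convergence)
    show "integrable lborel (\<lambda>x. indicator (cball 0 (B + norm e)) x *\<^sub>R M :: real)"
      by (rule borel_integrable_compact) auto
    show "Q n \<in> borel_measurable lborel" for n
      unfolding Q_def using intW(1) int(1) by simp
    show "W' \<in> borel_measurable lborel" using int by simp
    show "AE x in lborel. (\<lambda>n. Q n x) \<longlonglongrightarrow> W' x"
    proof (rule AE_I2)
      fix x
      have "((\<lambda>t. (W (x + t *\<^sub>R e) - W x) / t) \<longlongrightarrow> W' x) (at 0)"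
        using der[of x] by (simp add: has_field_derivative_iff)
      then show "(\<lambda>n. Q n x) \<longlonglongrightarrow> W' x"
        unfolding Q_def by (rule filterlim_compose) (use h(1) h0 in \<open>auto simp: filterlim_at less_imp_neq[symmetric]\<close>)
    qed
    show "AE x in lborel. norm (Q n x) \<le> indicator (cball 0 (B + norm e)) x *\<^sub>R M" for n
    proof (rule AE_I2)
      fix x
      obtain z where "0 < z" "z < h n" "W (x + h n *\<^sub>R e) - W (x + 0 *\<^sub>R e) = (h n - 0) * W' (x + z *\<^sub>R e)"
        using MVT2[OF h(1)[of n], of "\<lambda>t. W (x + t *\<^sub>R e)" "\<lambda>s. W' (x + s *\<^sub>R e)", OF der'] by blast
      then have Q: "Q n x = W' (x + z *\<^sub>R e)" using h(1)[of n] by (simp add: Q_def)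
      show "norm (Q n x) \<le> indicator (cball 0 (B + norm e)) x *\<^sub>R M"
      proof (cases "x \<in> cball 0 (B + norm e)")
        case True then show ?thesis using M Q by (simp add: M_def)
      next
        case False
        have "norm (z *\<^sub>R e) \<le> norm e" using \<open>0 < z\<close> \<open>z < h n\<close> h[of n]
          by (simp add: mult_left_le_one_le)
        then have "x + z *\<^sub>R e \<notin> K"
          using False B[of "x + z *\<^sub>R e"] norm_diff_ineq[of x "z *\<^sub>R e"] by auto
        then show ?thesis using Q K(3) M[of x] by (simp add: M_def)
      qed
    qed
  qed
  then show ?thesis unfolding Q0 by (simp add: LIMSEQ_const_iff)
qed

lemma continuous_extend_by_0:
  fixes f :: "'a::euclidean_space \<Rightarrow> 'b::euclidean_space"
  assumes "open E" "compact K" "K \<subseteq> E" "continuous_on E f" "\<And>x. x \<in> E - K \<Longrightarrow> f x = 0"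
  shows "continuous_on UNIV (\<lambda>x. indicator E x *\<^sub>R f x)"
proof -
  have "continuous_on (E \<union> - K) (\<lambda>x. indicator E x *\<^sub>R f x)"
  proof (rule continuous_on_open_Un)
    show "open (- K)" using assms(2) by (simp add: compact_imp_closed open_Compl)
    show "continuous_on E (\<lambda>x. indicator E x *\<^sub>R f x)"
      by (rule continuous_on_eq[OF assms(4)]) auto
    show "continuous_on (- K) (\<lambda>x. indicator E x *\<^sub>R f x)"
      by (rule continuous_on_eq[of _ "\<lambda>x. 0"]) (use assms(5) in \<open>auto simp: indicator_def\<close>)
  qed (fact assms)
  moreover have "E \<union> - K = UNIV" using assms(3) by auto
  ultimately show ?thesis by simp
qed

lemma integrable_extend_by_0:
  fixes f :: "'a::euclidean_space \<Rightarrow> 'b::euclidean_space"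
  assumes "open E" "compact K" "K \<subseteq> E" "continuous_on E f" "\<And>x. x \<in> E - K \<Longrightarrow> f x = 0"
  shows "integrable lborel (\<lambda>x. indicator E x *\<^sub>R f x)"
  by (rule integrable_continuous_compact_support[OF continuous_extend_by_0[OF assms] assms(2)])
    (use assms(5) in \<open>auto simp: indicator_def\<close>)

text \<open>
  The divergence theorem in the form used below: the fields are only differentiable on an open set,
  but they are supported in a compact subset of it, so their extensions by zero remain differentiable.
\<close>

lemma integral_directional_derivative_open_eq_0:
  fixes Z D :: "'a::euclidean_space \<Rightarrow> real"
  assumes E: "open E" and K: "compact K" "K \<subseteq> E" and cont: "continuous_on E Z" "continuous_on E D"
    and der: "\<And>x. x \<in> E \<Longrightarrow> ((\<lambda>t. Z (x + t *\<^sub>R e)) has_real_derivative D x) (at 0)"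
    and Z0: "\<And>x. x \<in> E - K \<Longrightarrow> Z x = 0"
  shows "integrable lborel (\<lambda>x. indicator E x *\<^sub>R D x)"
    and "(LINT x|lborel. indicator E x *\<^sub>R D x) = 0"
proof -
  have line: "\<forall>\<^sub>F t in nhds 0. x + t *\<^sub>R e \<in> A" if "open A" "x \<in> A" for x A
  proof -
    have "((\<lambda>t. x + t *\<^sub>R e) \<longlongrightarrow> x + 0 *\<^sub>R e) (nhds (0::real))"
      by (intro tendsto_intros) (rule filterlim_ident)
    then show ?thesis using topological_tendstoD[of _ _ _ A] that by fastforce
  qed
  have oK: "open (- K)" using K(1) by (simp add: compact_imp_closed open_Compl)
  have D0: "D x = 0" if x: "x \<in> E - K" for x
  proof -
    have "\<forall>\<^sub>F t in nhds 0. Z (x + t *\<^sub>R e) = 0"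
      using line[of "E - K" x] x open_Int[OF E oK] Z0 by (auto elim!: eventually_mono simp: Diff_eq)
    then have "((\<lambda>t. 0) has_real_derivative D x) (at 0)"
      using der[of x] x DERIV_cong_ev[OF refl _ refl, of "\<lambda>t. Z (x + t *\<^sub>R e)" "\<lambda>t. 0" 0 "D x"] by simp
    then show ?thesis using DERIV_unique DERIV_const by blast
  qed
  show "integrable lborel (\<lambda>x. indicator E x *\<^sub>R D x)"
    using integrable_extend_by_0[OF E K cont(2) D0] by auto
  show "(LINT x|lborel. indicator E x *\<^sub>R D x) = 0"
  proof (rule integral_directional_derivative_eq_0[of "\<lambda>x. indicator E x *\<^sub>R Z x" _ K])
    show "continuous_on UNIV (\<lambda>x. indicator E x *\<^sub>R Z x)" "continuous_on UNIV (\<lambda>x. indicator E x *\<^sub>R D x)"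
      using continuous_extend_by_0[OF E K cont(1) Z0] continuous_extend_by_0[OF E K cont(2) D0] by auto
    show "((\<lambda>t. indicator E (x + t *\<^sub>R e) *\<^sub>R Z (x + t *\<^sub>R e)) has_real_derivative indicator E x *\<^sub>R D x) (at 0)" for x
    proof (cases "x \<in> E")
      case True
      have ev: "\<forall>\<^sub>F t in nhds 0. indicator E (x + t *\<^sub>R e) *\<^sub>R Z (x + t *\<^sub>R e) = Z (x + t *\<^sub>R e)"
        using line[OF E True] by eventually_elim auto
      show ?thesis using True der[OF True] by (subst DERIV_cong_ev[OF refl ev refl]) simp
    next
      case False
      have ev: "\<forall>\<^sub>F t in nhds 0. indicator E (x + t *\<^sub>R e) *\<^sub>R Z (x + t *\<^sub>R e) = 0"
      proof -
        have "x \<in> - K" using False K(2) by auto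
        from line[OF oK this] show ?thesis
          by (rule eventually_mono) (use Z0 in \<open>auto simp: indicator_def\<close>)
      qed
      show ?thesis using False by (subst DERIV_cong_ev[OF refl ev refl]) simp
    qed
  qed (use K D0 Z0 in \<open>auto simp: indicator_def\<close>)
qed

lemma has_real_derivative_along_axis:
  assumes "f differentiable (at x)"
  shows "((\<lambda>t. f (x + t *\<^sub>R axis i 1)) has_real_derivative partial_deriv i f x) (at 0)"
proof -
  have f: "(f has_derivative frechet_derivative f (at x)) (at x)"
    using assms frechet_derivative_works by blast
  have g: "((\<lambda>t::real. x + t *\<^sub>R axis i 1) has_derivative (\<lambda>t. t *\<^sub>R axis i 1)) (at 0)"
    by (auto intro!: derivative_eq_intros)
  have "((\<lambda>t. f (x + t *\<^sub>R axis i 1)) has_derivative (\<lambda>t. frechet_derivative f (at x) (t *\<^sub>R axis i 1))) (at 0)"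
    by (rule has_derivative_compose[OF g, unfolded scaleR_zero_left add_0_right, OF f])
  moreover have "linear (frechet_derivative f (at x))"
    using f has_derivative_linear by blast
  ultimately show ?thesis
    by (simp add: has_field_derivative_def partial_deriv_def linear_cmul mult.commute[of _ "frechet_derivative f (at x) (axis i 1)"] cong: if_cong)
qed

lemma harmonic_onD:
  assumes "harmonic_on S f"
  shows "x \<in> S \<Longrightarrow> f differentiable (at x)"
    "x \<in> S \<Longrightarrow> partial_deriv i f differentiable (at x)"
    "continuous_on S (partial_deriv i (partial_deriv i f))"
    "x \<in> S \<Longrightarrow> (\<Sum>i\<in>UNIV. partial_deriv i (partial_deriv i f) x) = 0"
  using assms by (auto simp: harmonic_on_def numeral_2_eq_2 laplacian_def)

lemma harmonic_on_continuous:
  assumes "harmonic_on S f"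
  shows "continuous_on S f" "continuous_on S (partial_deriv i f)" "continuous_on S (grad f)"
proof -
  show "continuous_on S f" "continuous_on S (partial_deriv i f)" for i
    using harmonic_onD(1)[OF assms] harmonic_onD(2)[OF assms, of _ i]
    by (auto intro!: continuous_at_imp_continuous_on differentiable_imp_continuous_within)
  then show "continuous_on S (grad f)"
    unfolding grad_def[abs_def] by (intro continuous_on_vec_lambda)
qed

text \<open>
  The field \<open>step (2 u / \<epsilon>) (Y + q \<nabla>u)\<close> vanishes where \<open>u \<le> \<epsilon> / 2\<close>, hence has compact support in
  \<open>E\<close>, and its divergence integrates to zero. The derivative of the truncation contributes a nonnegative
  multiple of \<open>Y \<bullet> \<nabla>u + q \<bar>\<nabla>u\<bar>\<^sup>2\<close>, which is nonnegative in the layer \<open>u < \<epsilon>\<close> by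
  Cauchy-Schwarz. As \<open>\<epsilon>\<close> tends to \<open>0\<close> this becomes the statement that the flux of \<open>Y + q \<nabla>u\<close> out of
  \<open>E\<close> is not positive.
\<close>

lemma flux_inequality:
  fixes u q :: "real^2 \<Rightarrow> real" and Y dY dq :: "real^2 \<Rightarrow> real^2"
  assumes \<Omega>: "open \<Omega>" "continuous_on \<Omega> u" and E_def: "E = pos_set \<Omega> u" and harm: "harmonic_on E u"
    and \<epsilon>: "\<epsilon> > 0" and C0: "compact C0" "C0 \<subseteq> \<Omega>"
    and supp: "\<And>x. x \<notin> C0 \<Longrightarrow> Y x = 0" "\<And>x. x \<notin> C0 \<Longrightarrow> q x = 0"
    and cont: "continuous_on E Y" "continuous_on E dY" "continuous_on E q" "continuous_on E dq"
    and derY: "\<And>x i. x \<in> E \<Longrightarrow> ((\<lambda>t. Y (x + t *\<^sub>R axis i 1) $ i) has_real_derivative dY x $ i) (at 0)"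
    and derq: "\<And>x i. x \<in> E \<Longrightarrow> ((\<lambda>t. q (x + t *\<^sub>R axis i 1)) has_real_derivative dq x $ i) (at 0)"
    and le: "\<And>x. x \<in> E \<Longrightarrow> u x < \<epsilon> \<Longrightarrow> norm (Y x) \<le> q x * norm (grad u x)"
  shows "integrable lborel (\<lambda>x. indicator E x *\<^sub>R
            (step (2 * u x / \<epsilon>) * ((\<Sum>i\<in>UNIV. dY x $ i) + dq x \<bullet> grad u x)))"
    and "(LINT x|lborel. indicator E x *\<^sub>R
            (step (2 * u x / \<epsilon>) * ((\<Sum>i\<in>UNIV. dY x $ i) + dq x \<bullet> grad u x))) \<le> 0"
proof -
  define K where "K = C0 \<inter> u -` {\<epsilon>/2..}"
  have "continuous_on C0 u" using \<Omega>(2) C0(2) continuous_on_subset by blast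
  then have "closed K" unfolding K_def
    using continuous_closed_preimage[of C0 u "{\<epsilon>/2..}"] C0(1) compact_imp_closed by blast
  then have K: "compact K" "K \<subseteq> E"
    using C0 \<epsilon> by (auto simp: K_def E_def pos_set_def compact_eq_bounded_closed bounded_Int)
  have E: "open E"
  proof -
    have "E = \<Omega> \<inter> u -` {0<..}" by (auto simp: E_def pos_set_def)
    then show ?thesis using continuous_open_preimage[OF \<Omega>(2,1)] by auto
  qed
  have step0: "step (2 * u x / \<epsilon>) = 0" "step' (2 * u x / \<epsilon>) = 0"
    if "x \<in> C0" "x \<notin> K" for x
    using that \<epsilon> by (auto simp: K_def intro!: step_0)
  define g where "g = grad u"
  define Z where "Z i x = step (2 * u x / \<epsilon>) * (Y x $ i + q x * partial_deriv i u x)" for i x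
  define D where "D i x = step (2 * u x / \<epsilon>) * (dY x $ i + dq x $ i * g x $ i + q x * partial_deriv i (partial_deriv i u) x)
     + step' (2 * u x / \<epsilon>) * (2 / \<epsilon>) * (g x $ i * (Y x $ i + q x * g x $ i))" for i x
  have [simp]: "g x $ i = partial_deriv i u x" for x i by (simp add: g_def grad_def)
  note hc = harmonic_on_continuous[OF harm] harmonic_onD(3)[OF harm]
  have Zc: "continuous_on E (Z i)" for i
    unfolding Z_def[abs_def] using \<epsilon> by (intro continuous_intros cont hc continuous_on_component) auto
  have Dc: "continuous_on E (D i)" for i
    unfolding D_def[abs_def] using \<epsilon> 
    by (simp, intro continuous_intros cont hc continuous_on_component) auto
  have ZD: "((\<lambda>t. Z i (x + t *\<^sub>R axis i 1)) has_real_derivative D i x) (at 0)" if x: "x \<in> E" for x i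
  proof -
    note du = has_real_derivative_along_axis[OF harmonic_onD(1)[OF harm x], of i]
    note ddu = has_real_derivative_along_axis[OF harmonic_onD(2)[OF harm x], of i i]
    have st: "((\<lambda>t. step (2 * u (x + t *\<^sub>R axis i 1) / \<epsilon>)) has_real_derivative
        step' (2 * u x / \<epsilon>) * (2 * g x $ i / \<epsilon>)) (at 0)"
      using step_deriv_compose[OF DERIV_cdivide[OF DERIV_cmult[OF du]], of 2 \<epsilon>] by simp
    show ?thesis
      unfolding Z_def D_def
      by (rule DERIV_cong[OF DERIV_mult'[OF st DERIV_add[OF derY[OF x] DERIV_mult'[OF derq[OF x] ddu]]]])
        (simp add: algebra_simps add_divide_distrib)
  qed
  have Z0: "Z i x = 0" if "x \<in> E - K" for i x
    using that supp[of x] step0[of x] by (cases "x \<in> C0") (auto simp: Z_def)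
  note * = integral_directional_derivative_open_eq_0[OF E K Zc Dc ZD Z0]
  define T where "T x = step (2 * u x / \<epsilon>) * ((\<Sum>i\<in>UNIV. dY x $ i) + dq x \<bullet> g x)" for x
  have sumD: "(\<Sum>i\<in>UNIV. D i x) = T x + step' (2 * u x / \<epsilon>) * (2 / \<epsilon>) * (Y x \<bullet> g x + q x * (norm (g x))\<^sup>2)"
    if "x \<in> E" for x
  proof -
    have "(\<Sum>i\<in>UNIV. D i x) = step (2 * u x / \<epsilon>) * ((\<Sum>i\<in>UNIV. dY x $ i) + (\<Sum>i\<in>UNIV. dq x $ i * g x $ i) + q x * (\<Sum>i\<in>UNIV. partial_deriv i (partial_deriv i u) x))
      + step' (2 * u x / \<epsilon>) * (2 / \<epsilon>) * ((\<Sum>i\<in>UNIV. Y x $ i * g x $ i) + q x * (\<Sum>i\<in>UNIV. g x $ i * g x $ i))"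
      unfolding D_def sum_2 by algebra
    then show ?thesis using harmonic_onD(4)[OF harm that]
      by (simp add: T_def inner_vec_def power2_norm_eq_inner)
  qed
  have sumD_ge: "T x \<le> (\<Sum>i\<in>UNIV. D i x)" if x: "x \<in> E" for x
  proof (cases "u x < \<epsilon>")
    case True
    have "- (Y x \<bullet> g x) \<le> norm (Y x) * norm (g x)"
      using norm_cauchy_schwarz[of "- Y x" "g x"] by simp
    also have "\<dots> \<le> (q x * norm (g x)) * norm (g x)"
      using le[OF x True] by (simp add: g_def mult_right_mono)
    finally have "0 \<le> Y x \<bullet> g x + q x * (norm (g x))\<^sup>2" by (simp add: power2_eq_square mult.assoc)
    then show ?thesis using sumD[OF x] step'_bounds(1)[of "2 * u x / \<epsilon>"] \<epsilon> by simp
  next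
    case False
    then have "step' (2 * u x / \<epsilon>) = 0" using \<epsilon> by (simp add: field_simps)
    then show ?thesis using sumD[OF x] by simp
  qed
  have intT: "integrable lborel (\<lambda>x. indicator E x *\<^sub>R T x)"
  proof -
    have 1: "integrable lborel (\<lambda>x. \<Sum>i\<in>UNIV. indicator E x *\<^sub>R D i x)"
      using *(1) by (rule Bochner_Integration.integrable_sum)
    have c: "continuous_on E (\<lambda>x. step' (2 * u x / \<epsilon>) * (2 / \<epsilon>) * (Y x \<bullet> g x + q x * (norm (g x))\<^sup>2))"
      unfolding g_def using \<epsilon> by (intro continuous_intros cont hc) auto
    have 2: "integrable lborel (\<lambda>x. indicator E x *\<^sub>R (step' (2 * u x / \<epsilon>) * (2 / \<epsilon>) * (Y x \<bullet> g x + q x * (norm (g x))\<^sup>2)))"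
      by (rule integrable_extend_by_0[OF E K c]) (use supp step0 in fastforce)
    show ?thesis
      using Bochner_Integration.integrable_diff[OF 1 2]
      by (rule Bochner_Integration.integrable_cong[THEN iffD1, rotated -1])
        (auto simp: sumD indicator_def)
  qed
  have "(LINT x|lborel. indicator E x *\<^sub>R T x) \<le> (LINT x|lborel. (\<Sum>i\<in>UNIV. indicator E x *\<^sub>R D i x))"
    by (rule integral_mono[OF intT Bochner_Integration.integrable_sum[OF *(1)]])
      (use sumD_ge in \<open>auto simp: indicator_def\<close>)
  also have "\<dots> = (\<Sum>i\<in>UNIV. (LINT x|lborel. indicator E x *\<^sub>R D i x))"
    by (rule Bochner_Integration.integral_sum[OF *(1)])
  also have "\<dots> = 0" using *(2) by simp
  finally show "(LINT x|lborel. indicator E x *\<^sub>R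
      (step (2 * u x / \<epsilon>) * ((\<Sum>i\<in>UNIV. dY x $ i) + dq x \<bullet> grad u x))) \<le> 0"
    by (simp add: T_def g_def)
  show "integrable lborel (\<lambda>x. indicator E x *\<^sub>R
      (step (2 * u x / \<epsilon>) * ((\<Sum>i\<in>UNIV. dY x $ i) + dq x \<bullet> grad u x)))"
    using intT by (simp add: T_def g_def)
qed

section \<open>A calibration for the weighted isoperimetric inequality\<close>

lemma continuous_on_vector_2 [continuous_intros]:
  fixes f g :: "'a::topological_space \<Rightarrow> real"
  assumes "continuous_on S f" "continuous_on S g"
  shows "continuous_on S (\<lambda>z. vector [f z, g z] :: real^2)"
proof -
  have "continuous_on S (\<lambda>z. if i = 1 then f z else g z)" for i :: 2
    using assms by (cases "i = 1") auto
  then have "continuous_on S (\<lambda>z. (\<chi> i. if i = 1 then f z else g z) :: real^2)"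
    by (rule continuous_on_vec_lambda)
  then show ?thesis
    by (rule continuous_on_eq) (simp add: vec_eq_iff forall_2)
qed

text \<open>
  Identifies the plane of vectors with the product of two lines, so that integrals can be sliced.
\<close>

lemma distr_pair_eq_lborel_plane:
  "distr (lborel :: (real \<times> real) measure) borel (\<lambda>z. vector [fst z, snd z] :: real^2) = lborel"
proof (rule lborel_eqI[symmetric])
  have c: "continuous_on UNIV (\<lambda>z::real\<times>real. vector [fst z, snd z] :: real^2)"
    by (intro continuous_intros)
  then have m: "(\<lambda>z::real\<times>real. vector [fst z, snd z] :: real^2) \<in> lborel \<rightarrow>\<^sub>M borel"
    using borel_measurable_continuous_onI by (simp add: measurable_lborel1)
  fix l u :: "real^2"
  assume lu: "\<And>b. b \<in> Basis \<Longrightarrow> l \<bullet> b \<le> u \<bullet> b"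
  have lu': "l $ i \<le> u $ i" for i using lu[of "axis i 1"] by (auto simp: Basis_vec_def inner_axis axis_eq_axis)
  have pre: "(\<lambda>z. vector [fst z, snd z] :: real^2) -` box l u = box (l$1, l$2) (u$1, u$2)"
    by (auto simp: mem_box_cart forall_2 box_def[of "(_, _)"] Basis_prod_def)
  have B: "(Basis :: (real^2) set) = {axis 1 1, axis 2 1}" "axis 1 1 \<noteq> (axis 2 1 :: real^2)"
    by (auto simp: Basis_vec_def UNIV_2 axis_eq_axis)
  have "emeasure (distr lborel borel (\<lambda>z. vector [fst z, snd z] :: real^2)) (box l u) = emeasure lborel (box (l$1, l$2) (u$1, u$2))"
    using m by (subst emeasure_distr) (auto simp: pre)
  also have "\<dots> = ennreal ((u$1 - l$1) * (u$2 - l$2))"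
    using lu' by (subst emeasure_lborel_box) (auto simp: Basis_prod_def prod.union_disjoint prod.reindex inj_on_def)
  also have "\<dots> = (\<Prod>b\<in>Basis. (u - l) \<bullet> b)"
    unfolding B(1) using B(2) by (simp add: inner_axis)
  finally show "emeasure (distr lborel borel (\<lambda>z. vector [fst z, snd z] :: real^2)) (box l u) = (\<Prod>b\<in>Basis. (u - l) \<bullet> b)" .
qed simp

lemma integral_plane_iterated:
  fixes f :: "real^2 \<Rightarrow> real"
  assumes cont: "continuous_on UNIV f" and supp: "\<And>x. f x \<noteq> 0 \<Longrightarrow> \<bar>x$1\<bar> \<le> M \<and> \<bar>x$2\<bar> \<le> M"
  shows "(LINT x|lborel. f x) = integral {-M..M} (\<lambda>t. integral {-M..M} (\<lambda>s. f (vector [s, t])))"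
proof -
  define h where "h = (\<lambda>z::real\<times>real. f (vector [fst z, snd z]))"
  have c: "continuous_on UNIV (\<lambda>z::real\<times>real. vector [fst z, snd z] :: real^2)"
    by (intro continuous_intros)
  then have m: "(\<lambda>z::real\<times>real. vector [fst z, snd z] :: real^2) \<in> lborel \<rightarrow>\<^sub>M borel"
    using borel_measurable_continuous_onI by (simp add: measurable_lborel1)
  have hc: "continuous_on UNIV h"
    unfolding h_def using continuous_on_compose2[OF cont c] by simp
  have h0: "h z = 0" if "z \<notin> cbox (-M,-M) (M,M)" for z
    using supp[of "vector [fst z, snd z]"] that by (cases z) (fastforce simp: h_def cbox_Pair_eq abs_le_iff)
  have "(LINT x|lborel. f x) = (LINT x|distr lborel borel (\<lambda>z::real\<times>real. vector [fst z, snd z] :: real^2). f x)"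
    by (simp add: distr_pair_eq_lborel_plane)
  also have "\<dots> = (LINT z|lborel. h z)"
    unfolding h_def using m borel_measurable_continuous_onI[OF cont] by (rule integral_distr)
  also have "\<dots> = (LINT z:cbox (-M,-M) (M,M)|lborel. h z)"
    unfolding set_lebesgue_integral_def
    by (rule Bochner_Integration.integral_cong) (use h0 in \<open>auto simp: indicator_def\<close>)
  also have "\<dots> = integral (cbox (-M,-M) (M,M)) h"
    by (rule set_borel_integral_eq_integral(2)) 
      (unfold set_integrable_def, intro borel_integrable_compact continuous_on_subset[OF hc], auto)
  also have "\<dots> = integral {-M..M} (\<lambda>s. integral {-M..M} (\<lambda>t. h (s, t)))"
    using integral_prod_continuous[OF continuous_on_subset[OF hc subset_UNIV], of "- M" "- M" M M]
    by (simp only: cbox_interval)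
  also have "\<dots> = integral {-M..M} (\<lambda>t. integral {-M..M} (\<lambda>s. h (s, t)))"
  proof -
    have "continuous_on (cbox (-M,-M) (M,M)) (\<lambda>(s, t). h (s, t))"
      using continuous_on_subset[OF hc subset_UNIV] by (simp only: case_prod_eta)
    from integral_swap_continuous[OF this] show ?thesis by (simp only: cbox_interval)
  qed
  finally show ?thesis by (simp add: h_def)
qed

text \<open>
  Since \<open>\<beta> \<le> 1\<close>, at most half of the mass \<open>b = B t\<close> of \<open>\<beta>\<close> lies in \<open>[0, b / 2]\<close>; the other half
  carries weight at least \<open>(b / 2) powr \<gamma>\<close>. So the weighted mass is at least \<open>(b / 2) powr (1 + \<gamma>)\<close>.
\<close>

lemma bathtub_bound:
  fixes \<beta> B :: "real \<Rightarrow> real"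
  assumes \<beta>: "continuous_on UNIV \<beta>" "\<And>t. 0 \<le> \<beta> t" "\<And>t. \<beta> t \<le> 1"
    and B: "\<And>t. (B has_real_derivative \<beta> t) (at t)" "B 0 = 0"
    and "\<gamma> > 0" "l > 0" "t \<ge> 0"
    and le: "integral {0..t} (\<lambda>\<tau>. \<tau> powr \<gamma> * \<beta> \<tau>) \<le> l powr (1 + \<gamma>)"
  shows "0 \<le> B t" "B t \<le> 2 * l"
proof -
  have mono: "B s \<le> B t" if "s \<le> t" for s t
    by (rule DERIV_nonneg_imp_nondecreasing[OF that]) (use \<beta> B in blast)
  then show "0 \<le> B t" using B(2) \<open>t \<ge> 0\<close> by metis
  have lip: "B s \<le> s" if "s \<ge> 0" for s
  proof -
    have "0 - B 0 \<le> s - B s"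
      by (rule DERIV_nonneg_imp_nondecreasing[OF that, of "\<lambda>s. s - B s"])
        (use \<beta>(3) B(1) in \<open>auto intro!: exI[of _ "1 - \<beta> _"] derivative_eq_intros\<close>)
    then show ?thesis using B(2) by simp
  qed
  show "B t \<le> 2 * l"
  proof (cases "B t > 0")
    case True
    define b where "b = B t / 2"
    have b: "0 < b" "b \<le> t" using True lip[OF \<open>t \<ge> 0\<close>] \<open>t \<ge> 0\<close> by (auto simp: b_def)
    have intB: "(\<beta> has_integral (B t - B b)) {b..t}"
      by (rule fundamental_theorem_of_calculus)
        (use b B(1) in \<open>auto simp: has_real_derivative_iff_has_vector_derivative intro: has_vector_derivative_at_within\<close>)
    have c: "continuous_on S (\<lambda>\<tau>. \<tau> powr \<gamma> * \<beta> \<tau>)" if "S \<subseteq> {0..}" for S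
      by (intro continuous_on_mult continuous_on_powr' continuous_intros continuous_on_subset[OF \<beta>(1)])
        (use that \<open>\<gamma> > 0\<close> in auto)
    have "b powr (1 + \<gamma>) = b powr \<gamma> * b" using b by (simp add: powr_add)
    also have "\<dots> \<le> b powr \<gamma> * (B t - B b)"
      using lip[of b] b by (intro mult_left_mono) (auto simp: b_def)
    also have "\<dots> = integral {b..t} (\<lambda>\<tau>. b powr \<gamma> * \<beta> \<tau>)"
      using intB by (simp add: integral_unique)
    also have "\<dots> \<le> integral {b..t} (\<lambda>\<tau>. \<tau> powr \<gamma> * \<beta> \<tau>)"
      by (rule integral_le)
        (use b \<open>\<gamma> > 0\<close> \<beta>(2) in \<open>auto intro!: integrable_continuous_interval c mult_right_mono powr_mono2 continuous_intros
           continuous_on_subset[OF \<beta>(1)]\<close>)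
    also have "\<dots> \<le> integral {0..t} (\<lambda>\<tau>. \<tau> powr \<gamma> * \<beta> \<tau>)"
      by (rule integral_subset_le) (use b \<beta>(2) in \<open>auto intro!: integrable_continuous_interval c\<close>)
    finally have "b powr (1 + \<gamma>) \<le> l powr (1 + \<gamma>)" using le by simp
    then have "b \<le> l"
      using powr_less_mono2[of "1 + \<gamma>" l b] \<open>l > 0\<close> \<open>\<gamma> > 0\<close> by fastforce
    then show ?thesis by (simp add: b_def)
  qed (use \<open>l > 0\<close> in simp)
qed

lemma has_real_derivative_antiderivative_real:
  fixes f :: "real \<Rightarrow> real"
  assumes "continuous_on UNIV f"
  obtains F where "\<And>x. (F has_real_derivative f x) (at x)" "F 0 = 0"
proof -
  have "\<exists>F. \<forall>x::real. (-\<infinity>::ereal) < x \<longrightarrow> x < (\<infinity>::ereal) \<longrightarrow> (F has_vector_derivative f x) (at x)"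
    by (rule einterval_antiderivative) (use assms in \<open>auto simp: continuous_on_eq_continuous_at\<close>)
  then obtain F where F: "(F has_real_derivative f x) (at x)" for x
    by (auto simp: has_real_derivative_iff_has_vector_derivative)
  show thesis
    by (rule that[of "\<lambda>x. F x - F 0"]) (auto intro!: derivative_eq_intros F)
qed

text \<open>
  A dual form of the weighted isoperimetric inequality. The field \<open>N = (A, B)\<close>, with \<open>B\<close> depending on
  the height only, satisfies \<open>\<bar>N\<bar> \<le> 3 l\<close> and \<open>div N \<ge> f\<close>. Let \<open>slice t\<close> be the integral of \<open>f\<close> over
  the horizontal line at height \<open>t\<close>. The height density \<open>\<beta> = min 1 (slice / l)\<close> decides how the
  divergence is shared: \<open>A\<close> is \<open>(1 - \<beta>)\<close> times the horizontal primitive of \<open>f\<close>, hence bounded by \<open>l\<close>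
  because it vanishes on slices longer than \<open>l\<close>; \<open>B\<close> is the primitive of \<open>\<beta>\<close>, and since
  \<open>\<beta> \<le> slice / l\<close> its weighted mass is at most \<open>l powr (1 + \<gamma>)\<close>, so that \<open>bathtub_bound\<close> applies. The
  sign condition \<open>0 \<le> t * B t\<close> says that the field points away from the axis.
\<close>

lemma exists_calibration:
  fixes f :: "real^2 \<Rightarrow> real"
  assumes f: "continuous_on UNIV f" "compact K" "\<And>x. x \<notin> K \<Longrightarrow> f x = 0" "\<And>x. 0 \<le> f x" "\<And>x. f x \<le> 1"
    and "\<gamma> > 0" "l > 0" and le: "(LINT x|lborel. f x * \<bar>x$2\<bar> powr \<gamma>) \<le> l powr (2 + \<gamma>)"
  obtains A :: "real^2 \<Rightarrow> real" and \<kappa> \<beta> B :: "real \<Rightarrow> real" where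
    "continuous_on UNIV A" "continuous_on UNIV \<kappa>" "continuous_on UNIV \<beta>"
    "\<And>x. ((\<lambda>t. A (x + t *\<^sub>R axis 1 1)) has_real_derivative \<kappa> (x$2) * f x) (at 0)"
    "\<And>t. (B has_real_derivative \<beta> t) (at t)"
    "\<And>x. \<bar>A x\<bar> \<le> l" "\<And>t. \<bar>B t\<bar> \<le> 2 * l" "\<And>t. 0 \<le> t * B t" "\<And>t. 0 \<le> \<beta> t"
    "\<And>x. f x \<le> \<kappa> (x$2) * f x + \<beta> (x$2)"
proof -
  obtain M0 where M0: "\<And>x. x \<in> K \<Longrightarrow> norm x \<le> M0"
    using compact_imp_bounded[OF f(2)] by (auto simp: bounded_iff)
  define M where "M = max 0 M0"
  have supp: "\<bar>x$1\<bar> \<le> M \<and> \<bar>x$2\<bar> \<le> M" if "f x \<noteq> 0" for x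
    using that f(3)[of x] M0[of x] component_le_norm_cart[of x 1] component_le_norm_cart[of x 2]
    unfolding M_def by fastforce
  have "M \<ge> 0" by (simp add: M_def)
  have fc: "continuous_on S (\<lambda>z. f (vector [a z, b z]))" if "continuous_on S a" "continuous_on S b"
    for S :: "'z::topological_space set" and a b
    by (rule continuous_on_compose2[OF f(1)]) (use that in \<open>auto intro: continuous_on_vector_2\<close>)
  define slice where "slice t = integral {-M..M} (\<lambda>s. f (vector [s, t]))" for t
  have slice0: "0 \<le> slice t" for t unfolding slice_def 
    by (intro integral_nonneg integrable_continuous_interval fc continuous_intros f)
  have slicec: "continuous_on UNIV slice"
    unfolding slice_def
    using integral_continuous_on_param[of UNIV "-M" M "\<lambda>t s. f (vector [s, t])"]
    by (simp add: cbox_interval case_prod_unfold fc continuous_intros)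
  define \<beta> where "\<beta> t = min 1 (slice t / l)" for t
  define \<kappa> where "\<kappa> t = 1 - \<beta> t" for t
  have \<beta>: "continuous_on UNIV \<beta>" "\<And>t. 0 \<le> \<beta> t" "\<And>t. \<beta> t \<le> 1" "\<And>t. \<beta> t \<le> slice t / l"
    unfolding \<beta>_def using slicec slice0 \<open>l > 0\<close> by (auto intro!: continuous_intros)
  obtain B where B: "\<And>t. (B has_real_derivative \<beta> t) (at t)" "B 0 = 0"
    using has_real_derivative_antiderivative_real[OF \<beta>(1)] by blast
  have wc: "continuous_on S (\<lambda>t. \<bar>t\<bar> powr \<gamma>)" for S :: "real set"
    using \<open>\<gamma> > 0\<close> by (intro continuous_on_powr' continuous_intros) auto
  have "(LINT x|lborel. f x * \<bar>x$2\<bar> powr \<gamma>) = integral {-M..M} (\<lambda>t. slice t * \<bar>t\<bar> powr \<gamma>)"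
  proof (subst integral_plane_iterated)
    show "continuous_on UNIV (\<lambda>x::real^2. f x * \<bar>x$2\<bar> powr \<gamma>)"
      using \<open>\<gamma> > 0\<close> f(1) by (intro continuous_on_mult continuous_on_powr' continuous_intros) auto
  qed (use supp in \<open>auto simp: slice_def\<close>)
  then have tot: "integral {-M..M} (\<lambda>t. slice t * \<bar>t\<bar> powr \<gamma>) \<le> l powr (2 + \<gamma>)" using le by simp
  have sliceM: "slice t = 0" if "t \<notin> {-M..M}" for t
  proof -
    have "f (vector [s, t]) = 0" for s using supp[of "vector [s, t]"] that by fastforce
    then show ?thesis by (simp add: slice_def)
  qed
  have wint: "(\<lambda>t. slice t * \<bar>t\<bar> powr \<gamma>) integrable_on {a..b}" for a b
    by (intro integrable_continuous_interval continuous_on_mult wc continuous_on_subset[OF slicec]) auto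
  have slab: "integral {a..b} (\<lambda>t. \<bar>t\<bar> powr \<gamma> * \<beta> t) \<le> l powr (1 + \<gamma>)" for a b
  proof -
    define L where "L = M + \<bar>a\<bar> + \<bar>b\<bar>"
    have "integral {a..b} (\<lambda>t. \<bar>t\<bar> powr \<gamma> * \<beta> t) \<le> integral {a..b} (\<lambda>t. (1 / l) * (slice t * \<bar>t\<bar> powr \<gamma>))"
    proof (rule integral_le)
      show "(\<lambda>t. \<bar>t\<bar> powr \<gamma> * \<beta> t) integrable_on {a..b}"
        by (intro integrable_continuous_interval continuous_on_mult wc continuous_on_subset[OF \<beta>(1)]) auto
      show "\<bar>t\<bar> powr \<gamma> * \<beta> t \<le> (1 / l) * (slice t * \<bar>t\<bar> powr \<gamma>)" for t
        using mult_right_mono[OF \<beta>(4)[of t], of "\<bar>t\<bar> powr \<gamma>"] by (simp add: mult_ac)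
    next
      show "(\<lambda>t. (1 / l) * (slice t * \<bar>t\<bar> powr \<gamma>)) integrable_on {a..b}"
        using integrable_cmul[OF wint, of "1 / l" a b] by (simp only: real_scaleR_def)
    qed
    also have "\<dots> = (1 / l) * integral {a..b} (\<lambda>t. slice t * \<bar>t\<bar> powr \<gamma>)"
      by (rule integral_mult_right)
    also have "integral {a..b} (\<lambda>t. slice t * \<bar>t\<bar> powr \<gamma>) \<le> integral {-L..L} (\<lambda>t. slice t * \<bar>t\<bar> powr \<gamma>)"
      by (rule integral_subset_le) (use wint slice0 \<open>M \<ge> 0\<close> in \<open>auto simp: L_def\<close>)
    also have "integral {-L..L} (\<lambda>t. slice t * \<bar>t\<bar> powr \<gamma>) = integral {-M..M} (\<lambda>t. slice t * \<bar>t\<bar> powr \<gamma>)"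
      by (rule integral_unique, rule has_integral_on_superset[OF integrable_integral[OF wint]])
        (use sliceM in \<open>auto simp: L_def\<close>)
    also have "\<dots> \<le> l powr (2 + \<gamma>)" by (rule tot)
    finally have "integral {a..b} (\<lambda>t. \<bar>t\<bar> powr \<gamma> * \<beta> t) \<le> (1 / l) * l powr (2 + \<gamma>)"
      using \<open>l > 0\<close> by (simp add: divide_right_mono)
    also have "\<dots> = l powr (1 + \<gamma>)"
      using \<open>l > 0\<close> by (simp add: powr_add powr_one power2_eq_square)
    finally show ?thesis .
  qed
  have Bbound: "\<bar>B t\<bar> \<le> 2 * l \<and> 0 \<le> t * B t" for t
  proof (cases "t \<ge> 0")
    case True
    have "integral {0..t} (\<lambda>\<tau>. \<tau> powr \<gamma> * \<beta> \<tau>) = integral {0..t} (\<lambda>\<tau>. \<bar>\<tau>\<bar> powr \<gamma> * \<beta> \<tau>)"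
      by (rule Henstock_Kurzweil_Integration.integral_cong) simp
    then show ?thesis
      using bathtub_bound[OF \<beta>(1-3) B \<open>\<gamma> > 0\<close> \<open>l > 0\<close> True] slab[of 0 t] True by simp
  next
    case False
    have 1: "continuous_on UNIV (\<lambda>t. \<beta> (- t))" 
      by (rule continuous_on_compose2[OF \<beta>(1)]) (auto intro!: continuous_intros)
    have 2: "((\<lambda>t. - B (- t)) has_real_derivative \<beta> (- t)) (at t)" for t
      using DERIV_minus[OF DERIV_chain2[OF B(1) DERIV_minus[OF DERIV_ident]], of t] by simp
    have "integral {-0..-t} (\<lambda>\<tau>. \<tau> powr \<gamma> * \<beta> (- \<tau>)) = integral {-0..-t} (\<lambda>\<tau>. \<bar>- \<tau>\<bar> powr \<gamma> * \<beta> (- \<tau>))"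
      by (intro Henstock_Kurzweil_Integration.integral_cong) auto
    also have "\<dots> = integral {t..0} (\<lambda>\<tau>. \<bar>\<tau>\<bar> powr \<gamma> * \<beta> \<tau>)"
      using Henstock_Kurzweil_Integration.integral_reflect_real[where a = t and b = 0 and f = "\<lambda>\<tau>. \<bar>\<tau>\<bar> powr \<gamma> * \<beta> \<tau>"] .
    finally have "integral {0..-t} (\<lambda>\<tau>. \<tau> powr \<gamma> * \<beta> (- \<tau>)) = integral {t..0} (\<lambda>\<tau>. \<bar>\<tau>\<bar> powr \<gamma> * \<beta> \<tau>)"
      by (simp only: minus_zero)
    then show ?thesis
      using bathtub_bound[OF 1 \<beta>(2,3) 2 _ \<open>\<gamma> > 0\<close> \<open>l > 0\<close>, of "- t"] slab[of t 0] False B(2)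
      by (auto simp: mult_nonpos_nonpos)
  qed
  \<comment> \<open>The primitive \<open>\<integral>f\<close> from \<open>0\<close> to \<open>x\<^sub>1\<close>, rescaled to a fixed interval so that it is jointly continuous.\<close>
  define I where "I x = integral {0..1} (\<lambda>s. x$1 * f (vector [s * x$1, x$2]))" for x :: "real^2"
  have Ic: "continuous_on UNIV I"
    unfolding I_def
    using integral_continuous_on_param[of UNIV 0 1 "\<lambda>x s. x$1 * f (vector [s * x$1, x$2])"]
    by (simp add: cbox_interval case_prod_unfold fc continuous_intros)
  have I: "((\<lambda>t. I (x + t *\<^sub>R axis 1 1)) has_real_derivative f x) (at 0) \<and> \<bar>I x\<bar> \<le> slice (x$2)" for x
  proof -
    have "continuous_on UNIV (\<lambda>s. f (vector [s, x$2]))" by (intro fc continuous_intros)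
    then obtain \<Phi> where \<Phi>: "\<And>s. (\<Phi> has_real_derivative f (vector [s, x$2])) (at s)" "\<Phi> 0 = 0"
      using has_real_derivative_antiderivative_real by blast
    have eq: "I y = \<Phi> (y$1)" if "y$2 = x$2" for y
    proof -
      have "((\<lambda>s. y$1 * f (vector [s * y$1, y$2])) has_integral (\<Phi> (1 * y$1) - \<Phi> (0 * y$1))) {0..1}"
      proof (rule fundamental_theorem_of_calculus)
        show "((\<lambda>s. \<Phi> (s * y$1)) has_vector_derivative y$1 * f (vector [s * y$1, y$2])) (at s within {0..1})" for s
          using DERIV_chain2[OF \<Phi>(1) DERIV_cmult_right[OF DERIV_ident, of "y$1"]] that
          by (auto simp: has_real_derivative_iff_has_vector_derivative[symmetric] mult.commute intro: has_field_derivative_at_within)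
      qed simp
      from integral_unique[OF this] show ?thesis
        using \<Phi>(2) by (simp only: I_def mult_1 mult_zero_left diff_zero)
    qed
    have "((\<lambda>t. \<Phi> (x$1 + t)) has_real_derivative f (vector [x$1 + 0, x$2])) (at 0)"
      using DERIV_chain2[OF \<Phi>(1) DERIV_add[OF DERIV_const DERIV_ident], of "x$1" 0] by simp
    moreover have "vector [x$1, x$2] = x" by (simp add: vec_eq_iff forall_2)
    moreover have "I (x + t *\<^sub>R axis 1 1) = \<Phi> (x$1 + t)" for t
      by (subst eq) (auto simp: axis_def)
    ultimately have 1: "((\<lambda>t. I (x + t *\<^sub>R axis 1 1)) has_real_derivative f x) (at 0)"
      by simp
    have mono: "\<Phi> s \<le> \<Phi> t" if "s \<le> t" for s t
      by (rule DERIV_nonneg_imp_nondecreasing[OF that]) (use \<Phi> f(4) in blast)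
    define L where "L = M + \<bar>x$1\<bar>"
    have "\<Phi> (- L) \<le> \<Phi> (x$1)" "\<Phi> (x$1) \<le> \<Phi> L" "\<Phi> (-L) \<le> \<Phi> 0" "\<Phi> 0 \<le> \<Phi> L"
      using \<open>M \<ge> 0\<close> by (auto simp: L_def intro!: mono)
    then have "\<bar>I x\<bar> \<le> \<Phi> L - \<Phi> (- L)" using eq[of x] \<Phi>(2) by auto
    also have "\<dots> = slice (x$2)"
    proof -
      have "((\<lambda>s. f (vector [s, x$2])) has_integral (\<Phi> L - \<Phi> (- L))) {-L..L}"
        by (rule fundamental_theorem_of_calculus)
          (use \<open>M \<ge> 0\<close> \<Phi>(1) in \<open>auto simp: L_def has_real_derivative_iff_has_vector_derivative intro: has_vector_derivative_at_within\<close>)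
      moreover have "((\<lambda>s. f (vector [s, x$2])) has_integral slice (x$2)) {-L..L}"
      proof (rule has_integral_on_superset)
        show "((\<lambda>s. f (vector [s, x$2])) has_integral slice (x$2)) {-M..M}"
          unfolding slice_def by (intro integrable_integral integrable_continuous_interval fc continuous_intros)
        show "f (vector [s, x$2]) = 0" if "s \<notin> {-M..M}" for s
          using supp[of "vector [s, x$2]"] that by fastforce
      qed (auto simp: L_def)
      ultimately show ?thesis by (rule has_integral_unique)
    qed
    finally show ?thesis using 1 by blast
  qed
  define A where "A x = \<kappa> (x$2) * I x" for x
  have \<kappa>c: "continuous_on UNIV \<kappa>" unfolding \<kappa>_def by (intro continuous_intros \<beta>)
  show thesis
  proof (rule that[of A \<kappa> \<beta> B])
    show "continuous_on UNIV A"
      unfolding A_def by (intro continuous_on_mult Ic continuous_on_compose2[OF \<kappa>c] continuous_intros) auto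
    show "((\<lambda>t. A (x + t *\<^sub>R axis 1 1)) has_real_derivative \<kappa> (x$2) * f x) (at 0)" for x
      using DERIV_cmult[OF I[THEN conjunct1, of x], of "\<kappa> (x$2)"] by (simp add: A_def axis_def)
    show "\<bar>A x\<bar> \<le> l" for x
    proof (cases "slice (x$2) \<le> l")
      case True
      have "\<bar>\<kappa> (x$2)\<bar> \<le> 1" using \<beta>(2,3)[of "x$2"] by (simp add: \<kappa>_def)
      then have "\<bar>A x\<bar> \<le> 1 * l" unfolding A_def abs_mult
        using I[of x] True \<open>l > 0\<close> by (intro mult_mono) auto
      then show ?thesis by simp
    next
      case False
      then have "\<kappa> (x$2) = 0" using \<open>l > 0\<close> by (simp add: \<kappa>_def \<beta>_def)
      then show ?thesis using \<open>l > 0\<close> by (simp add: A_def)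
    qed
    show "f x \<le> \<kappa> (x$2) * f x + \<beta> (x$2)" for x
      using mult_left_mono[OF f(5)[of x] \<beta>(2)[of "x$2"]] by (simp add: \<kappa>_def algebra_simps)
  qed (use \<kappa>c \<beta> B Bbound in auto)
qed

section \<open>Cutting out the axis and the singular set\<close>

lemma GDERIV_along_axis:
  assumes "GDERIV (f :: real^'n \<Rightarrow> real) x :> D"
  shows "((\<lambda>t. f (x + t *\<^sub>R axis i 1)) has_real_derivative D $ i) (at 0)"
proof -
  have f: "(f has_derivative (\<lambda>h. h \<bullet> D)) (at x)" using assms by (simp add: gderiv_def)
  have g: "((\<lambda>t::real. x + t *\<^sub>R axis i 1) has_derivative (\<lambda>t. t *\<^sub>R axis i 1)) (at 0)"
    by (auto intro!: derivative_eq_intros)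
  have "((\<lambda>t. f (x + t *\<^sub>R axis i 1)) has_derivative (\<lambda>t. (t *\<^sub>R axis i 1) \<bullet> D)) (at 0)"
    by (rule has_derivative_compose[OF g, unfolded scaleR_zero_left add_0_right, OF f])
  moreover have "axis i 1 \<bullet> D = D $ i" by (simp add: inner_axis inner_commute)
  ultimately show ?thesis
    by (simp add: has_field_derivative_def mult.commute[of _ "D $ i"])
qed

lemma GDERIV_continuous:
  assumes "\<And>x. GDERIV f x :> D x"
  shows "continuous_on UNIV f"
  using assms unfolding gderiv_def
  by (intro continuous_at_imp_continuous_on) (auto dest: has_derivative_continuous)

text \<open>
  A cutoff with gradient \<open>d\<eta>\<close> such that both the gradient and the deviation from \<open>1\<close> cost at most
  \<open>c\<close> in \<open>L\<^sup>1\<close>. These costs add up under products.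
\<close>

definition cutoff_bound :: "(real^2 \<Rightarrow> real) \<Rightarrow> (real^2 \<Rightarrow> real^2) \<Rightarrow> real \<Rightarrow> bool" where
  "cutoff_bound \<eta> d\<eta> c \<longleftrightarrow> (\<forall>x. GDERIV \<eta> x :> d\<eta> x) \<and> continuous_on UNIV d\<eta> \<and> (\<forall>x. 0 \<le> \<eta> x \<and> \<eta> x \<le> 1) \<and>
     integrable lborel (\<lambda>x. norm (d\<eta> x)) \<and> (LINT x|lborel. norm (d\<eta> x)) \<le> c \<and>
     integrable lborel (\<lambda>x. 1 - \<eta> x) \<and> (LINT x|lborel. 1 - \<eta> x) \<le> c"

lemma cutoff_product_bounds:
  fixes d\<eta> d\<zeta> :: "'a::real_normed_vector"
  assumes "0 \<le> \<eta>" "\<eta> \<le> 1" "0 \<le> \<zeta>" "\<zeta> \<le> (1::real)"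
  shows "0 \<le> \<eta> * \<zeta>" "\<eta> * \<zeta> \<le> 1" "1 - \<eta> * \<zeta> \<le> (1 - \<eta>) + (1 - \<zeta>)"
    "norm (\<eta> *\<^sub>R d\<zeta> + \<zeta> *\<^sub>R d\<eta>) \<le> norm d\<zeta> + norm d\<eta>"
proof -
  show "0 \<le> \<eta> * \<zeta>" "\<eta> * \<zeta> \<le> 1" using assms by (auto simp: mult_le_one)
  have "0 \<le> (1 - \<eta>) * (1 - \<zeta>)" using assms by simp
  then show "1 - \<eta> * \<zeta> \<le> (1 - \<eta>) + (1 - \<zeta>)" by (simp add: algebra_simps)
  have "norm (\<eta> *\<^sub>R d\<zeta> + \<zeta> *\<^sub>R d\<eta>) \<le> \<eta> * norm d\<zeta> + \<zeta> * norm d\<eta>"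
    using norm_triangle_ineq[of "\<eta> *\<^sub>R d\<zeta>" "\<zeta> *\<^sub>R d\<eta>"] assms by simp
  also have "\<dots> \<le> norm d\<zeta> + norm d\<eta>"
    using assms by (intro add_mono mult_left_le_one_le) auto
  finally show "norm (\<eta> *\<^sub>R d\<zeta> + \<zeta> *\<^sub>R d\<eta>) \<le> norm d\<zeta> + norm d\<eta>" .
qed

lemma cutoff_bound_mult:
  assumes "cutoff_bound \<eta> d\<eta> c" "cutoff_bound \<zeta> d\<zeta> d"
  shows "cutoff_bound (\<lambda>x. \<eta> x * \<zeta> x) (\<lambda>x. \<eta> x *\<^sub>R d\<zeta> x + \<zeta> x *\<^sub>R d\<eta> x) (c + d)"
proof -
  have \<eta>: "\<And>x. GDERIV \<eta> x :> d\<eta> x" "continuous_on UNIV d\<eta>" "\<And>x. 0 \<le> \<eta> x" "\<And>x. \<eta> x \<le> 1"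
     "integrable lborel (\<lambda>x. norm (d\<eta> x))" "(LINT x|lborel. norm (d\<eta> x)) \<le> c"
     "integrable lborel (\<lambda>x. 1 - \<eta> x)" "(LINT x|lborel. 1 - \<eta> x) \<le> c"
    and \<zeta>: "\<And>x. GDERIV \<zeta> x :> d\<zeta> x" "continuous_on UNIV d\<zeta>" "\<And>x. 0 \<le> \<zeta> x" "\<And>x. \<zeta> x \<le> 1"
     "integrable lborel (\<lambda>x. norm (d\<zeta> x))" "(LINT x|lborel. norm (d\<zeta> x)) \<le> d"
     "integrable lborel (\<lambda>x. 1 - \<zeta> x)" "(LINT x|lborel. 1 - \<zeta> x) \<le> d"
    using assms unfolding cutoff_bound_def by blast+
  note c = GDERIV_continuous[OF \<eta>(1)] GDERIV_continuous[OF \<zeta>(1)]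
  note b = cutoff_product_bounds[OF \<eta>(3,4) \<zeta>(3,4)]
  have dc: "continuous_on UNIV (\<lambda>x. \<eta> x *\<^sub>R d\<zeta> x + \<zeta> x *\<^sub>R d\<eta> x)"
    by (intro continuous_intros c \<eta> \<zeta>)
  have "continuous_on UNIV (\<lambda>x. norm (\<eta> x *\<^sub>R d\<zeta> x + \<zeta> x *\<^sub>R d\<eta> x))" "continuous_on UNIV (\<lambda>x. 1 - \<eta> x * \<zeta> x)"
    by (intro continuous_intros c dc)+
  then have m: "(\<lambda>x. norm (\<eta> x *\<^sub>R d\<zeta> x + \<zeta> x *\<^sub>R d\<eta> x)) \<in> borel_measurable lborel"
     "(\<lambda>x. 1 - \<eta> x * \<zeta> x) \<in> borel_measurable lborel"
    by (simp_all add: borel_measurable_continuous_onI)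
  have s: "integrable lborel (\<lambda>x. norm (d\<zeta> x) + norm (d\<eta> x))" "integrable lborel (\<lambda>x. (1 - \<eta> x) + (1 - \<zeta> x))"
    using Bochner_Integration.integrable_add[OF \<zeta>(5) \<eta>(5)] Bochner_Integration.integrable_add[OF \<eta>(7) \<zeta>(7)] .
  have i1: "integrable lborel (\<lambda>x. norm (\<eta> x *\<^sub>R d\<zeta> x + \<zeta> x *\<^sub>R d\<eta> x))"
    by (rule Bochner_Integration.integrable_bound[OF s(1) m(1)]) (simp add: b(4))
  have i2: "integrable lborel (\<lambda>x. 1 - \<eta> x * \<zeta> x)"
  proof (rule Bochner_Integration.integrable_bound[OF s(2) m(2)], rule AE_I2)
    fix x show "norm (1 - \<eta> x * \<zeta> x) \<le> norm ((1 - \<eta> x) + (1 - \<zeta> x))"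
      using b(2)[of x x] b(3)[of x x] unfolding real_norm_def by linarith
  qed
  have "(LINT x|lborel. norm (\<eta> x *\<^sub>R d\<zeta> x + \<zeta> x *\<^sub>R d\<eta> x)) \<le> (LINT x|lborel. norm (d\<zeta> x) + norm (d\<eta> x))"
    by (rule integral_mono[OF i1 s(1)]) (rule b)
  moreover have "(LINT x|lborel. 1 - \<eta> x * \<zeta> x) \<le> (LINT x|lborel. (1 - \<eta> x) + (1 - \<zeta> x))"
    by (rule integral_mono[OF i2 s(2)]) (rule b)
  moreover have "GDERIV (\<lambda>x. \<eta> x * \<zeta> x) x :> \<eta> x *\<^sub>R d\<zeta> x + \<zeta> x *\<^sub>R d\<eta> x" for x
    using GDERIV_mult[OF \<eta>(1) \<zeta>(1)] .
  moreover have "(LINT x|lborel. norm (d\<zeta> x) + norm (d\<eta> x)) \<le> c + d"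
    using \<eta> \<zeta> by simp
  moreover have "(LINT x|lborel. (1 - \<eta> x) + (1 - \<zeta> x)) \<le> c + d"
    using \<eta>(7,8) \<zeta>(7,8) by (subst Bochner_Integration.integral_add) auto
  ultimately show ?thesis
    unfolding cutoff_bound_def using dc b(1,2) i1 i2 by fastforce
qed

lemma integral_le_const_mult_measure:
  fixes f :: "'a::euclidean_space \<Rightarrow> real"
  assumes "integrable lborel f" "bounded A" "A \<in> sets borel" "\<And>x. f x \<le> c * indicator A x"
  shows "(LINT x|lborel. f x) \<le> c * measure lborel A"
proof -
  have "emeasure lborel A < \<infinity>" using assms(2) emeasure_bounded_finite by blast
  then have i: "integrable lborel (\<lambda>x. c * indicator A x)" using assms(3) by simp
  have "(LINT x|lborel. f x) \<le> (LINT x|lborel. c * indicator A x)"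
    by (rule integral_mono[OF assms(1) i assms(4)])
  then show ?thesis using assms(3) by simp
qed

lemma GDERIV_square_dist: "GDERIV (\<lambda>x. (norm (x - a))\<^sup>2) x :> 2 *\<^sub>R (x - a)"
  unfolding gderiv_def power2_norm_eq_inner
  by (auto intro!: derivative_eq_intros simp: inner_commute inner_add_left scaleR_2 inner_diff_right algebra_simps)

text \<open>
  In the plane the gradient is of size \<open>1 / r\<close> on a set of area \<open>r\<^sup>2\<close>: cutting out a ball costs a
  multiple of its radius.
\<close>

lemma cutoff_bound_ball:
  fixes a :: "real^2"
  assumes "0 < r" "r \<le> 1"
  shows "cutoff_bound (\<lambda>x. step ((norm (x - a))\<^sup>2 / r\<^sup>2)) (\<lambda>x. (step' ((norm (x - a))\<^sup>2 / r\<^sup>2) / r\<^sup>2) *\<^sub>R (2 *\<^sub>R (x - a))) (128 * r)"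
proof -
  define \<eta> where "\<eta> x = step ((norm (x - a))\<^sup>2 / r\<^sup>2)" for x
  define d\<eta> where "d\<eta> x = (step' ((norm (x - a))\<^sup>2 / r\<^sup>2) / r\<^sup>2) *\<^sub>R (2 *\<^sub>R (x - a))" for x
  have g: "GDERIV \<eta> x :> d\<eta> x" for x
    unfolding \<eta>_def d\<eta>_def
    using GDERIV_DERIV_compose[OF GDERIV_square_dist[of a x] DERIV_chain2[OF step_deriv DERIV_cdivide[OF DERIV_ident, of "r\<^sup>2"]]]
    by simp
  have c: "continuous_on UNIV \<eta>" "continuous_on UNIV d\<eta>"
    unfolding \<eta>_def d\<eta>_def using assms by (auto intro!: continuous_intros)
  have far: "\<eta> x = 1 \<and> d\<eta> x = 0" if "x \<notin> cball a (2 * r)" for x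
  proof -
    have "(2 * r)\<^sup>2 \<le> (norm (x - a))\<^sup>2"
      using that assms by (intro power_mono) (auto simp: dist_norm norm_minus_commute)
    then have "4 * r\<^sup>2 \<le> (norm (x - a))\<^sup>2" by (simp add: power_mult_distrib)
    then have "2 * r\<^sup>2 \<le> (norm (x - a))\<^sup>2" using zero_le_power2[of r] by linarith
    then have "2 \<le> (norm (x - a))\<^sup>2 / r\<^sup>2"
      using assms by (subst pos_le_divide_eq) auto
    then show ?thesis by (simp add: \<eta>_def d\<eta>_def)
  qed
  have i: "integrable lborel (\<lambda>x. norm (d\<eta> x))" "integrable lborel (\<lambda>x. 1 - \<eta> x)"
  proof -
    have "continuous_on UNIV (\<lambda>x. norm (d\<eta> x))" "continuous_on UNIV (\<lambda>x. 1 - \<eta> x)"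
      by (intro continuous_intros c)+
    note c2 = this
    show "integrable lborel (\<lambda>x. norm (d\<eta> x))"
      by (rule integrable_continuous_compact_support[OF c2(1) compact_cball[of a "2 * r"]]) (simp add: far)
    show "integrable lborel (\<lambda>x. 1 - \<eta> x)"
      by (rule integrable_continuous_compact_support[OF c2(2) compact_cball[of a "2 * r"]]) (simp add: far)
  qed
  have meas: "measure lborel (cball a (2 * r)) \<le> 16 * r\<^sup>2"
    using assms pi_less_4 by (simp add: content_cball power2_eq_square unit_ball_vol_2 numeral_eq_of_nat)
  have "(LINT x|lborel. norm (d\<eta> x)) \<le> (8 / r) * measure lborel (cball a (2 * r))"
  proof (rule integral_le_const_mult_measure[OF i(1)])
    show "norm (d\<eta> x) \<le> 8 / r * indicator (cball a (2 * r)) x" for x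
    proof (cases "x \<in> cball a (2 * r)")
      case True
      have "norm (d\<eta> x) = (step' ((norm (x - a))\<^sup>2 / r\<^sup>2) / r\<^sup>2) * (2 * norm (x - a))"
        unfolding d\<eta>_def using step'_bounds(1) by simp
      also have "\<dots> \<le> (2 / r\<^sup>2) * (2 * (2 * r))"
        using True assms step'_bounds
        by (intro mult_mono divide_right_mono) (auto simp: dist_norm norm_minus_commute)
      also have "\<dots> = 8 / r" using assms by (simp add: power2_eq_square)
      finally show ?thesis using True by simp
    qed (use far in auto)
  qed auto
  also have "\<dots> \<le> (8 / r) * (16 * r\<^sup>2)" using meas assms by (intro mult_left_mono) auto
  also have "\<dots> = 128 * r" using assms by (simp add: power2_eq_square)
  finally have 1: "(LINT x|lborel. norm (d\<eta> x)) \<le> 128 * r" .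
  have "(LINT x|lborel. 1 - \<eta> x) \<le> 1 * measure lborel (cball a (2 * r))"
    by (rule integral_le_const_mult_measure[OF i(2)])
      (use far step_bounds in \<open>auto simp: indicator_def \<eta>_def\<close>)
  also have "\<dots> \<le> 128 * r"
  proof -
    have "r\<^sup>2 \<le> r" using assms by (simp add: power2_eq_square mult_left_le)
    then show ?thesis using meas assms by linarith
  qed
  finally have 2: "(LINT x|lborel. 1 - \<eta> x) \<le> 128 * r" .
  show ?thesis
    using g c i 1 2 step_bounds unfolding cutoff_bound_def \<eta>_def d\<eta>_def by blast
qed

lemma finite_balls_cutoff:
  fixes a :: "'i \<Rightarrow> real^2"
  assumes "finite I" "\<And>i. i \<in> I \<Longrightarrow> 0 < r i \<and> r i \<le> 1"
  shows "\<exists>\<eta> d\<eta>. cutoff_bound \<eta> d\<eta> (\<Sum>i\<in>I. 128 * r i) \<and> (\<forall>x \<in> (\<Union>i\<in>I. ball (a i) (r i)). \<eta> x = 0)"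
  using assms
proof (induction I)
  case empty
  have "cutoff_bound (\<lambda>x. 1) (\<lambda>x. 0) 0" by (simp add: cutoff_bound_def GDERIV_const)
  then show ?case by auto
next
  case (insert j I)
  then obtain \<eta> d\<eta> where \<eta>: "cutoff_bound \<eta> d\<eta> (\<Sum>i\<in>I. 128 * r i)" "\<forall>x \<in> (\<Union>i\<in>I. ball (a i) (r i)). \<eta> x = 0"
    by auto
  have r: "0 < r j" "r j \<le> 1" using insert by auto
  have z: "step ((norm (x - a j))\<^sup>2 / (r j)\<^sup>2) = 0" if "x \<in> ball (a j) (r j)" for x
  proof -
    have "(norm (x - a j))\<^sup>2 \<le> (r j)\<^sup>2" using that by (intro power_mono) (auto simp: dist_norm norm_minus_commute)
    then show ?thesis using r by (intro step_0) simp
  qed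
  have A: "cutoff_bound (\<lambda>x. step ((norm (x - a j))\<^sup>2 / (r j)\<^sup>2) * \<eta> x)
     (\<lambda>x. step ((norm (x - a j))\<^sup>2 / (r j)\<^sup>2) *\<^sub>R d\<eta> x
        + \<eta> x *\<^sub>R ((step' ((norm (x - a j))\<^sup>2 / (r j)\<^sup>2) / (r j)\<^sup>2) *\<^sub>R (2 *\<^sub>R (x - a j))))
     (\<Sum>i\<in>insert j I. 128 * r i)"
    using cutoff_bound_mult[OF cutoff_bound_ball[OF r, of "a j"] \<eta>(1)]
    by (simp only: sum.insert[OF insert.hyps(1,2)])
  show ?case
    by (intro exI conjI, rule A) (use z \<eta>(2) in auto)
qed

lemma hausdorff_null_cover:
  fixes S :: "(real^2) set"
  assumes "hausdorff_measure 1 S = 0" "\<rho> > 0" "\<delta> > 0"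
  obtains U :: "nat \<Rightarrow> (real^2) set" where "S \<subseteq> (\<Union>i. U i)" "\<And>i. bounded (U i)" "\<And>i. diameter (U i) \<le> \<delta>"
    "(\<Sum>i. ennreal (diameter (U i))) < ennreal \<rho>"
proof -
  have "hausdorff_premeasure 1 \<delta> S \<le> hausdorff_measure 1 S"
    unfolding hausdorff_measure_def using assms(3) by (intro SUP_upper) auto
  then have "hausdorff_premeasure 1 \<delta> S < ennreal \<rho>" using assms by simp
  then obtain U where "S \<subseteq> (\<Union>i. U i)" "\<forall>i. bounded (U i) \<and> diameter (U i) \<le> \<delta>"
     "(\<Sum>i. ennreal (unit_ball_vol 1 * (diameter (U i) / 2) powr 1)) < ennreal \<rho>"
    unfolding hausdorff_premeasure_def by (auto simp: INF_less_iff)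
  moreover from this have "unit_ball_vol 1 * (diameter (U i) / 2) powr 1 = diameter (U i)" for i
    using diameter_ge_0[of "U i"] by simp
  ultimately show thesis using that[of U] by simp
qed

text \<open>
  A compact set of vanishing one-dimensional measure is covered by finitely many balls of small total
  radius, and the product of their cutoffs is cheap.
\<close>

lemma null_set_cutoff:
  fixes S :: "(real^2) set"
  assumes S: "compact S" "hausdorff_measure 1 S = 0" and "\<rho> > 0"
  obtains \<eta> d\<eta> U where "cutoff_bound \<eta> d\<eta> \<rho>" "open U" "S \<subseteq> U" "\<And>x. x \<in> U \<Longrightarrow> \<eta> x = 0"
proof -
  define \<sigma> where "\<sigma> = min 1 (\<rho> / 256)"
  have \<sigma>: "0 < \<sigma>" "\<sigma> \<le> 1" "256 * \<sigma> \<le> \<rho>" using \<open>\<rho> > 0\<close> by (auto simp: \<sigma>_def)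
  obtain U :: "nat \<Rightarrow> (real^2) set" where U: "S \<subseteq> (\<Union>i. U i)" "\<And>i. bounded (U i)" "\<And>i. diameter (U i) \<le> 1/2"
    "(\<Sum>i. ennreal (diameter (U i))) < ennreal \<sigma>"
    using hausdorff_null_cover[OF S(2) \<sigma>(1), of "1/2"] by auto
  \<comment> \<open>The summable extra term makes the balls open neighbourhoods even of sets of diameter \<open>0\<close>.\<close>
  define r where "r i = diameter (U i) + \<sigma> * (1/2) ^ Suc i" for i
  define a where "a i = (SOME x. x \<in> U i)" for i
  have p: "(1/2 :: real) ^ Suc i \<le> 1/2" for i by (simp add: power_le_one)
  have r: "0 < r i" "r i \<le> 1" for i
  proof -
    show "0 < r i" using \<sigma>(1) diameter_ge_0[OF U(2), of i] by (auto simp: r_def intro: add_nonneg_pos)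
    have "\<sigma> * (1/2) ^ Suc i \<le> 1 * (1/2)" using \<sigma> p by (intro mult_mono) auto
    then show "r i \<le> 1" using U(3)[of i] by (simp add: r_def)
  qed
  have sub: "U i \<subseteq> ball (a i) (r i)" for i
  proof
    fix x assume x: "x \<in> U i"
    then have "a i \<in> U i" unfolding a_def by (rule someI)
    then have "dist (a i) x \<le> diameter (U i)" using x U(2) diameter_bounded_bound by blast
    also have "\<dots> < r i" using \<sigma>(1) by (simp add: r_def)
    finally show "x \<in> ball (a i) (r i)" by simp
  qed
  have "S \<subseteq> (\<Union>i\<in>UNIV. ball (a i) (r i))" using U(1) sub by fastforce
  then obtain I where I: "finite I" "S \<subseteq> (\<Union>i\<in>I. ball (a i) (r i))"
    by (rule compactE_image[OF S(1), rotated]) auto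
  have "ennreal (\<Sum>i\<in>I. diameter (U i)) = (\<Sum>i\<in>I. ennreal (diameter (U i)))"
    using diameter_ge_0[OF U(2)] by (simp add: sum_ennreal)
  also have "\<dots> \<le> (\<Sum>i. ennreal (diameter (U i)))"
    using I(1) by (intro sum_le_suminf) auto
  finally have "(\<Sum>i\<in>I. diameter (U i)) \<le> \<sigma>"
    using U(4) \<sigma>(1) by (metis ennreal_le_iff less_imp_le order_trans)
  moreover have "(\<Sum>i\<in>I. (1/2::real) ^ Suc i) \<le> (\<Sum>i. (1/2) ^ Suc i)"
    using I(1) by (intro sum_le_suminf) (auto simp: summable_Suc_iff)
  then have "(\<Sum>i\<in>I. (1/2::real) ^ Suc i) \<le> 1"
    using power_half_series by (simp add: sums_iff)
  then have "\<sigma> * (\<Sum>i\<in>I. (1/2::real) ^ Suc i) \<le> \<sigma>" using \<sigma>(1) by (simp add: mult_left_le)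
  ultimately have "(\<Sum>i\<in>I. 128 * r i) \<le> \<rho>"
    using \<sigma>(3) by (simp add: r_def sum_distrib_left[symmetric] sum.distrib del: power_Suc)
  moreover obtain \<eta> d\<eta> where "cutoff_bound \<eta> d\<eta> (\<Sum>i\<in>I. 128 * r i)" "\<forall>x \<in> (\<Union>i\<in>I. ball (a i) (r i)). \<eta> x = 0"
    using finite_balls_cutoff[OF I(1), of r a] r by blast
  ultimately have c: "cutoff_bound \<eta> d\<eta> \<rho>" and "\<And>x. x \<in> (\<Union>i\<in>I. ball (a i) (r i)) \<Longrightarrow> \<eta> x = 0"
    by (auto simp: cutoff_bound_def)
  then show thesis
    using I(2) by (intro that[OF c, of "\<Union>i\<in>I. ball (a i) (r i)"]) auto
qed

lemma measure_strip_le: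
  fixes p :: "real^2"
  assumes "0 < r" "0 \<le> h"
  shows "measure lborel (ball p r \<inter> {x. \<bar>x$2\<bar> \<le> h}) \<le> 4 * r * h"
proof -
  have "ball p r \<inter> {x. \<bar>x$2\<bar> \<le> h} \<subseteq> cbox (vector [p$1 - r, - h]) (vector [p$1 + r, h])" (is "_ \<subseteq> ?B")
  proof
    fix x assume x: "x \<in> ball p r \<inter> {x. \<bar>x$2\<bar> \<le> h}"
    then have "\<bar>x$1 - p$1\<bar> < r"
      using component_le_norm_cart[of "x - p" 1] by (simp add: dist_norm norm_minus_commute)
    then show "x \<in> ?B" using x by (auto simp: mem_box_cart forall_2)
  qed
  then have "measure lborel (ball p r \<inter> {x. \<bar>x$2\<bar> \<le> h}) \<le> measure lborel ?B"
    by (intro measure_mono_fmeasurable) auto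
  also have "?B \<noteq> {}" using assms by (simp add: interval_ne_empty_cart forall_2)
  then have "measure lborel ?B = 4 * r * h"
    by (simp add: content_cbox_cart UNIV_2 algebra_simps)
  finally show ?thesis .
qed

lemma GDERIV_component: "GDERIV (\<lambda>x::real^'n. x $ i) x :> axis i 1"
  unfolding gderiv_def inner_axis
  by (auto intro!: derivative_eq_intros bounded_linear.has_derivative[OF bounded_linear_vec_nth])

lemma integrable_indicator_mult_continuous:
  fixes f :: "'a::euclidean_space \<Rightarrow> real"
  assumes "continuous_on UNIV f" "A \<in> sets borel" "bounded A"
  shows "integrable lborel (\<lambda>x. indicator A x * f x)"
proof -
  have "compact (closure A)" using assms(3) by simp
  then have i: "integrable lborel (\<lambda>x. indicator (closure A) x *\<^sub>R f x)"
    by (intro borel_integrable_compact continuous_on_subset[OF assms(1)]) auto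
  have "integrable lborel (\<lambda>x. indicator A x *\<^sub>R (indicator (closure A) x *\<^sub>R f x))"
    using assms(2) by (intro integrable_mult_indicator[OF _ i]) simp
  moreover have "(\<lambda>x. indicator A x *\<^sub>R (indicator (closure A) x *\<^sub>R f x)) = (\<lambda>x. indicator A x * f x)"
    using closure_subset[of A] by (auto simp: indicator_def fun_eq_iff)
  ultimately show ?thesis by (simp only:)
qed

text \<open>
  Cuts out the strip \<open>\<bar>x\<^sub>2\<bar> \<le> \<delta>\<close> together with the null set \<open>S \<delta>\<close>. The gradient of the strip cutoff
  is of size \<open>1 / \<delta>\<close> on a set of area \<open>\<delta>\<close> where the weight is at most \<open>(2 \<delta>) powr \<gamma>\<close>, so its
  weighted cost tends to \<open>0\<close>. The width \<open>\<delta>\<close> is chosen first, because the set \<open>S \<delta>\<close> on which the free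
  boundary is not regular depends on it.
\<close>

lemma degenerate_cutoff:
  fixes p :: "real^2" and S :: "real \<Rightarrow> (real^2) set"
  assumes "\<gamma> > 0" "\<rho> > 0" and r: "0 < r" "r \<le> 1" and p: "p$2 = 0"
    and S: "\<And>\<delta>. \<delta> > 0 \<Longrightarrow> compact (S \<delta>) \<and> hausdorff_measure 1 (S \<delta>) = 0"
  obtains \<delta> \<eta> d\<eta> U where "\<delta> > 0" "\<And>x. GDERIV \<eta> x :> d\<eta> x" "continuous_on UNIV d\<eta>"
    "\<And>x. 0 \<le> \<eta> x" "\<And>x. \<eta> x \<le> 1" "open U" "S \<delta> \<subseteq> U" "\<And>x. x \<in> U \<Longrightarrow> \<eta> x = 0"
    "\<And>x. \<bar>x$2\<bar> \<le> \<delta> \<Longrightarrow> \<eta> x = 0"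
    "(LINT x|lborel. indicator (ball p r) x * (1 - \<eta> x)) \<le> \<rho>"
    "(LINT x|lborel. indicator (ball p r) x * (norm (d\<eta> x) * \<bar>x$2\<bar> powr \<gamma>)) \<le> \<rho>"
proof -
  have "((\<lambda>\<delta>. 64 * r * (2 * \<delta>) powr \<gamma>) \<longlongrightarrow> 64 * r * (2 * 0) powr \<gamma>) (at_right 0)"
    using \<open>\<gamma> > 0\<close> by (intro tendsto_intros) (auto simp: eventually_at_right_less intro!: eventually_at_rightI[of 0 1])
  then have e1: "\<forall>\<^sub>F \<delta> in at_right 0. 64 * r * (2 * \<delta>) powr \<gamma> < \<rho> / 2"
    using \<open>\<rho> > 0\<close> by (auto dest!: order_tendstoD(2)[of _ _ _ "\<rho> / 2"])
  have "((\<lambda>\<delta>. 8 * r * \<delta>) \<longlongrightarrow> 8 * r * 0) (at_right 0)" by (intro tendsto_intros)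
  then have e2: "\<forall>\<^sub>F \<delta> in at_right 0. 8 * r * \<delta> < \<rho> / 2"
    using \<open>\<rho> > 0\<close> by (auto dest!: order_tendstoD(2)[of _ _ _ "\<rho> / 2"])
  obtain \<delta> where \<delta>: "\<delta> > 0" "64 * r * (2 * \<delta>) powr \<gamma> < \<rho> / 2" "8 * r * \<delta> < \<rho> / 2"
    using eventually_happens[OF eventually_conj[OF eventually_at_right_less[of 0] eventually_conj[OF e1 e2]]]
    by auto
  obtain \<zeta> d\<zeta> U where \<zeta>b: "cutoff_bound \<zeta> d\<zeta> (\<rho>/2)" and U: "open U" "S \<delta> \<subseteq> U" "\<And>x. x \<in> U \<Longrightarrow> \<zeta> x = 0"
    using null_set_cutoff[of "S \<delta>" "\<rho>/2"] S[OF \<delta>(1)] \<open>\<rho> > 0\<close> by auto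
  have \<zeta>: "\<And>x. GDERIV \<zeta> x :> d\<zeta> x" "continuous_on UNIV d\<zeta>" "\<And>x. 0 \<le> \<zeta> x" "\<And>x. \<zeta> x \<le> 1"
     "integrable lborel (\<lambda>x. norm (d\<zeta> x))" "(LINT x|lborel. norm (d\<zeta> x)) \<le> \<rho>/2"
     "integrable lborel (\<lambda>x. 1 - \<zeta> x)" "(LINT x|lborel. 1 - \<zeta> x) \<le> \<rho>/2"
    using \<zeta>b unfolding cutoff_bound_def by blast+
  define \<alpha> where "\<alpha> x = step ((x$2)\<^sup>2 / \<delta>\<^sup>2)" for x :: "real^2"
  define d\<alpha> :: "real^2 \<Rightarrow> real^2" where "d\<alpha> x = (step' ((x$2)\<^sup>2 / \<delta>\<^sup>2) * (2 * x$2 / \<delta>\<^sup>2)) *\<^sub>R axis 2 1" for x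
  have \<alpha>g: "GDERIV \<alpha> x :> d\<alpha> x" for x
  proof -
    have "((\<lambda>t. step (t\<^sup>2 / \<delta>\<^sup>2)) has_real_derivative step' ((x$2)\<^sup>2 / \<delta>\<^sup>2) * (2 * x$2 / \<delta>\<^sup>2)) (at (x$2))"
      using step_deriv_compose[OF DERIV_cdivide[OF DERIV_pow[of 2 "x$2"], of "\<delta>\<^sup>2"]] by simp
    from GDERIV_DERIV_compose[OF GDERIV_component this] show ?thesis by (simp add: \<alpha>_def[abs_def] d\<alpha>_def)
  qed
  have \<alpha>c: "continuous_on UNIV \<alpha>" "continuous_on UNIV d\<alpha>"
    unfolding \<alpha>_def d\<alpha>_def using \<delta>(1) by (auto intro!: continuous_intros)
  have \<alpha>01: "0 \<le> \<alpha> x" "\<alpha> x \<le> 1" for x by (auto simp: \<alpha>_def step_bounds)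
  have far: "\<alpha> x = 1" "d\<alpha> x = 0" if "\<not> \<bar>x$2\<bar> \<le> 2 * \<delta>" for x
  proof -
    have "(2 * \<delta>)\<^sup>2 \<le> (\<bar>x$2\<bar>)\<^sup>2" using that \<delta>(1) by (intro power_mono) auto
    then have "4 * \<delta>\<^sup>2 \<le> (x$2)\<^sup>2" by (simp add: power_mult_distrib)
    then have "2 * \<delta>\<^sup>2 \<le> (x$2)\<^sup>2" using zero_le_power2[of \<delta>] by linarith
    then have "2 \<le> (x$2)\<^sup>2 / \<delta>\<^sup>2" using \<delta>(1) by (subst pos_le_divide_eq) auto
    then show "\<alpha> x = 1" "d\<alpha> x = 0" by (auto simp: \<alpha>_def d\<alpha>_def)
  qed
  have near: "\<alpha> x = 0" if "\<bar>x$2\<bar> \<le> \<delta>" for x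
  proof -
    have "(\<bar>x$2\<bar>)\<^sup>2 \<le> \<delta>\<^sup>2" using that by (intro power_mono) auto
    then show ?thesis using \<delta>(1) by (auto simp: \<alpha>_def intro!: step_0)
  qed
  have d\<alpha>: "norm (d\<alpha> x) \<le> 8 / \<delta>" for x
  proof (cases "\<bar>x$2\<bar> \<le> 2 * \<delta>")
    case True
    have "norm (d\<alpha> x) = step' ((x$2)\<^sup>2 / \<delta>\<^sup>2) * (2 * \<bar>x$2\<bar> / \<delta>\<^sup>2)"
      using step'_bounds(1) by (simp add: d\<alpha>_def abs_mult)
    also have "\<dots> \<le> 2 * (2 * (2 * \<delta>) / \<delta>\<^sup>2)"
      using True \<delta>(1) step'_bounds by (intro mult_mono divide_right_mono) auto
    also have "\<dots> = 8 / \<delta>" using \<delta>(1) by (simp add: power2_eq_square)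
    finally show ?thesis .
  qed (use far \<delta> in simp)
  define \<eta> where "\<eta> x = \<alpha> x * \<zeta> x" for x
  define d\<eta> where "d\<eta> x = \<alpha> x *\<^sub>R d\<zeta> x + \<zeta> x *\<^sub>R d\<alpha> x" for x
  have \<eta>g: "GDERIV \<eta> x :> d\<eta> x" for x
    unfolding \<eta>_def[abs_def] d\<eta>_def using GDERIV_mult[OF \<alpha>g \<zeta>(1)] .
  note \<zeta>c = GDERIV_continuous[OF \<zeta>(1)]
  have \<eta>c: "continuous_on UNIV \<eta>" "continuous_on UNIV d\<eta>"
    unfolding \<eta>_def d\<eta>_def by (intro continuous_intros \<alpha>c \<zeta>c \<zeta>(2))+
  note b = cutoff_product_bounds[OF \<alpha>01 \<zeta>(3,4), folded \<eta>_def d\<eta>_def]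
  define T where "T = ball p r \<inter> {x. \<bar>x$2\<bar> \<le> 2 * \<delta>}"
  have T: "bounded T" "T \<in> sets borel" "measure lborel T \<le> 8 * r * \<delta>"
  proof -
    show "bounded T" unfolding T_def by (intro bounded_Int) simp
    have "closed {x::real^2. \<bar>x$2\<bar> \<le> 2 * \<delta>}"
      by (intro closed_Collect_le continuous_intros)
    then show "T \<in> sets borel" unfolding T_def by (intro sets.Int) auto
    show "measure lborel T \<le> 8 * r * \<delta>"
      unfolding T_def using measure_strip_le[of r "2 * \<delta>" p] r \<delta>(1) by simp
  qed
  have iT: "integrable lborel (\<lambda>x. indicator T x * c)" for c :: real
    using T emeasure_bounded_finite[OF T(1)] by simp
  have w1: "\<bar>x$2\<bar> powr \<gamma> \<le> 1" if "x \<in> ball p r" for x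
  proof -
    have "\<bar>x$2\<bar> \<le> 1"
      using that component_le_norm_cart[of "x - p" 2] p r by (simp add: dist_norm norm_minus_commute)
    then show ?thesis using \<open>\<gamma> > 0\<close> powr_le1[of \<gamma> "\<bar>x$2\<bar>"] by simp
  qed
  have ball_int: "integrable lborel (\<lambda>x. indicator (ball p r) x * f x)" if "continuous_on UNIV f" for f :: "real^2 \<Rightarrow> real"
    by (rule integrable_indicator_mult_continuous[OF that _ bounded_ball]) simp
  have wc: "continuous_on UNIV (\<lambda>x::real^2. \<bar>x$2\<bar> powr \<gamma>)"
    using \<open>\<gamma> > 0\<close> by (intro continuous_on_powr' continuous_intros) auto
  show thesis
  proof (rule that[of \<delta> \<eta> d\<eta> U])
    have "(LINT x|lborel. indicator (ball p r) x * (1 - \<eta> x)) \<le> (LINT x|lborel. (1 - \<zeta> x) + indicator T x * 1)"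
    proof (rule integral_mono)
      show "integrable lborel (\<lambda>x. indicator (ball p r) x * (1 - \<eta> x))"
        by (intro ball_int continuous_intros \<eta>c)
      show "integrable lborel (\<lambda>x. (1 - \<zeta> x) + indicator T x * 1)"
        using \<zeta>(7) iT[of 1] by (intro Bochner_Integration.integrable_add)
      show "indicator (ball p r) x * (1 - \<eta> x) \<le> (1 - \<zeta> x) + indicator T x * 1" for x
        using b(3)[of x x] \<zeta>(3,4)[of x] \<alpha>01[of x] far[of x] by (auto simp: indicator_def T_def \<eta>_def)
    qed
    also have "\<dots> = (LINT x|lborel. 1 - \<zeta> x) + measure lborel T"
      using \<zeta>(7) iT[of 1] T by (subst Bochner_Integration.integral_add) auto
    also have "\<dots> \<le> \<rho>" using \<zeta>(8) T(3) \<delta>(3) by simp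
    finally show "(LINT x|lborel. indicator (ball p r) x * (1 - \<eta> x)) \<le> \<rho>" .
    define c where "c = 8 / \<delta> * (2 * \<delta>) powr \<gamma>"
    have "(LINT x|lborel. indicator (ball p r) x * (norm (d\<eta> x) * \<bar>x$2\<bar> powr \<gamma>))
        \<le> (LINT x|lborel. norm (d\<zeta> x) + indicator T x * c)"
    proof (rule integral_mono)
      show "integrable lborel (\<lambda>x. indicator (ball p r) x * (norm (d\<eta> x) * \<bar>x$2\<bar> powr \<gamma>))"
        by (intro ball_int continuous_on_mult continuous_on_norm \<eta>c wc)
      show "integrable lborel (\<lambda>x. norm (d\<zeta> x) + indicator T x * c)"
        using \<zeta>(5) iT[of c] by (intro Bochner_Integration.integrable_add)
      show "indicator (ball p r) x * (norm (d\<eta> x) * \<bar>x$2\<bar> powr \<gamma>) \<le> norm (d\<zeta> x) + indicator T x * c" for x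
      proof (cases "x \<in> ball p r")
        case True
        have 1: "norm (d\<zeta> x) * \<bar>x$2\<bar> powr \<gamma> \<le> norm (d\<zeta> x)"
          using w1[OF True] by (simp add: mult_left_le)
        have 2: "norm (d\<alpha> x) * \<bar>x$2\<bar> powr \<gamma> \<le> indicator T x * c"
        proof (cases "x \<in> T")
          case True
          then have "norm (d\<alpha> x) * \<bar>x$2\<bar> powr \<gamma> \<le> 8 / \<delta> * (2 * \<delta>) powr \<gamma>"
            using d\<alpha>[of x] \<open>\<gamma> > 0\<close> \<delta>(1) by (intro mult_mono powr_mono2) (auto simp: T_def)
          then show ?thesis using True by (simp add: c_def)
        qed (use far True in \<open>auto simp: T_def\<close>)
        have "norm (d\<eta> x) * \<bar>x$2\<bar> powr \<gamma> \<le> (norm (d\<zeta> x) + norm (d\<alpha> x)) * \<bar>x$2\<bar> powr \<gamma>"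
          using b(4)[where d\<zeta> = "d\<zeta> x" and d\<eta> = "d\<alpha> x"] by (intro mult_right_mono) (auto simp: d\<eta>_def)
        then show ?thesis using 1 2 True by (simp add: distrib_right)
      qed (use \<delta> in \<open>auto simp: c_def\<close>)
    qed
    also have "\<dots> = (LINT x|lborel. norm (d\<zeta> x)) + measure lborel T * c"
      using \<zeta>(5) iT[of c] T by (subst Bochner_Integration.integral_add) auto
    also have "measure lborel T * c \<le> (8 * r * \<delta>) * c"
      using T(3) \<delta>(1) by (intro mult_right_mono) (auto simp: c_def)
    also have "(8 * r * \<delta>) * c = 64 * r * (2 * \<delta>) powr \<gamma>" using \<delta>(1) by (simp add: c_def)
    finally show "(LINT x|lborel. indicator (ball p r) x * (norm (d\<eta> x) * \<bar>x$2\<bar> powr \<gamma>)) \<le> \<rho>"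
      using \<zeta>(6) \<delta>(2) by simp
  qed (use \<delta> \<eta>g \<eta>c b U near in \<open>auto simp: \<eta>_def\<close>)
qed

section \<open>The gradient near the free boundary\<close>

lemma GDERIV_imp_grad:
  fixes u :: "real^2 \<Rightarrow> real"
  assumes "GDERIV u x :> D"
  shows "grad u x = D" "partial_deriv i u x = D $ i" "u differentiable (at x)"
proof -
  have d: "(u has_derivative (\<lambda>h. h \<bullet> D)) (at x)" using assms by (simp add: gderiv_def)
  then have "partial_deriv j u x = axis j 1 \<bullet> D" for j
    unfolding partial_deriv_def using frechet_derivative_at[OF d] by metis
  then have p: "partial_deriv j u x = D $ j" for j by (simp add: inner_axis inner_commute)
  then show "partial_deriv i u x = D $ i" "grad u x = D" by (auto simp: grad_def vec_eq_iff)
  show "u differentiable (at x)" using d by (auto simp: differentiable_def)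
qed

lemma open_pos_set:
  assumes "open \<Omega>" "continuous_on \<Omega> u"
  shows "open (pos_set \<Omega> u)"
proof -
  have "pos_set \<Omega> u = \<Omega> \<inter> u -` {0<..}" by (auto simp: pos_set_def)
  then show ?thesis using continuous_open_preimage[OF assms(2,1)] by auto
qed

text \<open>
  Otherwise points of \<open>C \<inter> E\<close> with \<open>u\<close> tending to \<open>0\<close> would violate the bound and accumulate at a
  point of \<open>C\<close> on the free boundary. There the gradient extends continuously with length
  \<open>\<bar>x\<^sub>2\<bar> powr \<gamma> > 0\<close>, which contradicts the factor \<open>2\<close>.
\<close>

lemma gradient_lower_bound_near_free_boundary:
  fixes u :: "real^2 \<Rightarrow> real" and \<Omega> :: "(real^2) set"
  assumes \<Omega>: "open \<Omega>" "continuous_on \<Omega> u" and E_def: "E = pos_set \<Omega> u"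
    and C: "compact C" "C \<subseteq> \<Omega>" "\<And>x. x \<in> C \<Longrightarrow> x$2 \<noteq> 0"
    and reg: "\<And>x0. x0 \<in> C \<Longrightarrow> x0 \<in> frontier E \<Longrightarrow> \<exists>V G. open V \<and> x0 \<in> V \<and>
        C1_up_to_boundary V E u G \<and> norm (G x0) = \<bar>x0$2\<bar> powr \<gamma>"
  obtains \<epsilon> where "\<epsilon> > 0" "\<And>x. x \<in> C \<Longrightarrow> x \<in> E \<Longrightarrow> u x < \<epsilon> \<Longrightarrow> \<bar>x$2\<bar> powr \<gamma> \<le> 2 * norm (grad u x)"
proof (rule ccontr)
  assume "\<not> thesis"
  have "\<exists>x. x \<in> C \<and> x \<in> E \<and> u x < 1 / real (Suc n) \<and> 2 * norm (grad u x) < \<bar>x$2\<bar> powr \<gamma>" for n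
  proof (rule ccontr)
    assume no: "\<not> ?thesis"
    have "\<bar>x$2\<bar> powr \<gamma> \<le> 2 * norm (grad u x)" if "x \<in> C" "x \<in> E" "u x < 1 / real (Suc n)" for x
      using no that not_le by blast
    then show False using \<open>\<not> thesis\<close> that[of "1 / real (Suc n)"] by simp
  qed
  then obtain x where x: "\<And>n. x n \<in> C" "\<And>n. x n \<in> E" "\<And>n. u (x n) < 1 / real (Suc n)"
    "\<And>n. 2 * norm (grad u (x n)) < \<bar>x n$2\<bar> powr \<gamma>" by metis
  obtain l s where l: "l \<in> C" and s: "strict_mono (s::nat \<Rightarrow> nat)" "(x \<circ> s) \<longlonglongrightarrow> l"
    using C(1) x(1) unfolding compact_def by metis
  then have lim: "(\<lambda>n. x (s n)) \<longlonglongrightarrow> l" by (simp add: o_def)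
  have "isCont u l" using \<Omega> l C(2) continuous_on_eq_continuous_at by blast
  then have "(\<lambda>n. u (x (s n))) \<longlonglongrightarrow> u l" using lim by (rule isCont_tendsto_compose)
  moreover have "(\<lambda>n. u (x (s n))) \<longlonglongrightarrow> 0"
  proof (rule tendsto_sandwich[of "\<lambda>n. 0" _ _ "\<lambda>n. 1 / real (Suc (s n))"])
    have "(\<lambda>n. 1 / real (Suc n)) \<longlonglongrightarrow> 0" using LIMSEQ_inverse_real_of_nat by (simp add: inverse_eq_divide)
    from LIMSEQ_subseq_LIMSEQ[OF this s(1)] show "(\<lambda>n. 1 / real (Suc (s n))) \<longlonglongrightarrow> 0" by (simp add: o_def)
    have "0 \<le> u (x n)" for n using x(2)[of n] by (auto simp: E_def pos_set_def)
    then show "\<forall>\<^sub>F n in sequentially. 0 \<le> u (x (s n))" by simp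
    show "\<forall>\<^sub>F n in sequentially. u (x (s n)) \<le> 1 / real (Suc (s n))"
      using x(3) by (intro always_eventually) (auto intro: less_imp_le simp del: of_nat_Suc)
  qed simp
  ultimately have "u l = 0" by (rule LIMSEQ_unique)
  then have "l \<notin> E" by (simp add: E_def pos_set_def)
  moreover have lc: "l \<in> closure E" unfolding closure_sequential
    using lim x(2) by (intro exI[of _ "\<lambda>n. x (s n)"]) simp
  ultimately have "l \<in> frontier E"
    using interior_subset by (auto simp: frontier_def)
  then obtain V G where V: "open V" "l \<in> V" "C1_up_to_boundary V E u G" "norm (G l) = \<bar>l$2\<bar> powr \<gamma>"
    using reg[OF l] by blast
  have G: "continuous_on (V \<inter> closure E) G" "\<And>x. x \<in> V \<inter> E \<Longrightarrow> grad u x = G x"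
    using V(3) GDERIV_imp_grad(1) unfolding C1_up_to_boundary_def by blast+
  have ev: "\<forall>\<^sub>F n in sequentially. x (s n) \<in> V" using topological_tendstoD[OF lim V(1,2)] .
  have "(\<lambda>n. G (x (s n))) \<longlonglongrightarrow> G l"
    by (rule continuous_on_tendsto_compose[OF G(1) lim])
      (use ev V(2) lc x(2) closure_subset in \<open>auto elim!: eventually_mono\<close>)
  then have 1: "(\<lambda>n. 2 * norm (G (x (s n)))) \<longlonglongrightarrow> 2 * norm (G l)" by (intro tendsto_intros)
  have nz: "l$2 \<noteq> 0" using C(3) l by blast
  have 2: "(\<lambda>n. \<bar>x (s n)$2\<bar> powr \<gamma>) \<longlonglongrightarrow> \<bar>l$2\<bar> powr \<gamma>"
    using nz by (intro tendsto_intros lim) auto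
  have "2 * norm (G l) \<le> \<bar>l$2\<bar> powr \<gamma>"
  proof (rule tendsto_le[OF _ 2 1])
    show "\<forall>\<^sub>F n in sequentially. 2 * norm (G (x (s n))) \<le> \<bar>x (s n)$2\<bar> powr \<gamma>"
      using ev
    proof eventually_elim
      case (elim n)
      then show ?case using x(2,4)[of "s n"] G(2)[of "x (s n)"] by simp
    qed
  qed simp
  then show False using V(4) nz by simp
qed

lemma hausdorff_measure_mono:
  assumes "A \<subseteq> B" shows "hausdorff_measure s A \<le> hausdorff_measure s B"
proof -
  have "hausdorff_premeasure s \<delta> A \<le> hausdorff_premeasure s \<delta> B" for \<delta>
    unfolding hausdorff_premeasure_def by (rule INF_superset_mono) (use assms in auto)
  then show ?thesis unfolding hausdorff_measure_def by (intro SUP_mono) auto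
qed

text \<open>
  Each set of a cover lies in a disc whose radius is its diameter; this crude choice costs the factor
  \<open>4\<close>, which is harmless for sets of density zero.
\<close>

lemma emeasure_lborel_le_hausdorff_measure_2:
  fixes A :: "(real^2) set"
  assumes "A \<in> sets borel"
  shows "emeasure lborel A \<le> 4 * hausdorff_measure 2 A"
proof -
  have "emeasure lborel A / 4 \<le> hausdorff_premeasure 2 1 A"
    unfolding hausdorff_premeasure_def
  proof (rule INF_greatest)
    fix U :: "nat \<Rightarrow> (real^2) set"
    assume "U \<in> {U. A \<subseteq> (\<Union>i. U i) \<and> (\<forall>i. bounded (U i) \<and> diameter (U i) \<le> 1)}"
    then have U: "A \<subseteq> (\<Union>i. U i)" "\<And>i. bounded (U i)" by auto
    define a where "a i = (SOME x. x \<in> U i)" for i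
    have sub: "U i \<subseteq> cball (a i) (diameter (U i))" for i
    proof
      fix x assume x: "x \<in> U i"
      then have "a i \<in> U i" unfolding a_def by (rule someI)
      then show "x \<in> cball (a i) (diameter (U i))" using x U(2) diameter_bounded_bound by auto
    qed
    have "emeasure lborel A \<le> emeasure lborel (\<Union>i. cball (a i) (diameter (U i)))"
      using U(1) sub by (intro emeasure_mono) fastforce+
    also have "\<dots> \<le> (\<Sum>i. emeasure lborel (cball (a i) (diameter (U i))))"
      by (rule emeasure_subadditive_countably) auto
    also have "\<dots> = (\<Sum>i. 4 * ennreal (unit_ball_vol 2 * (diameter (U i) / 2) powr 2))"
    proof (rule suminf_cong)
      fix i
      have d: "0 \<le> diameter (U i)" using diameter_ge_0[OF U(2)] .
      have "emeasure lborel (cball (a i) (diameter (U i))) = ennreal (unit_ball_vol 2 * (diameter (U i))\<^sup>2)"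
        using d by (subst emeasure_cball) auto
      also have "\<dots> = ennreal (4 * (unit_ball_vol 2 * (diameter (U i) / 2) powr 2))"
        using d by (simp add: power_divide)
      also have "\<dots> = 4 * ennreal (unit_ball_vol 2 * (diameter (U i) / 2) powr 2)"
        by (subst ennreal_mult) auto
      finally show "emeasure lborel (cball (a i) (diameter (U i))) = 4 * ennreal (unit_ball_vol 2 * (diameter (U i) / 2) powr 2)" .
    qed
    finally have "emeasure lborel A \<le> (\<Sum>i. ennreal (unit_ball_vol 2 * (diameter (U i) / 2) powr 2)) * 4"
      by (simp add: mult.commute)
    then show "emeasure lborel A / 4 \<le> (\<Sum>i. ennreal (unit_ball_vol 2 * (diameter (U i) / 2) powr 2))"
      by (intro divide_le_posI_ennreal) (auto simp: mult.commute)
  qed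
  also have "\<dots> \<le> hausdorff_measure 2 A"
    unfolding hausdorff_measure_def by (intro SUP_upper) auto
  finally have "4 * (emeasure lborel A / 4) \<le> 4 * hausdorff_measure 2 A"
    by (rule mult_left_mono) simp
  moreover have "4 * (emeasure lborel A / 4) = emeasure lborel A"
    by (simp add: ennreal_times_divide mult.commute[of 4] mult_divide_eq_ennreal)
  ultimately show ?thesis by simp
qed

section \<open>From the weak gradient to a pointwise bound\<close>

text \<open>
  The functions \<open>x powr (- n) * exp (- 1 / x)\<close>, extended by \<open>0\<close>: the span of this family is closed
  under differentiation.
\<close>

definition exp_recip :: "nat \<Rightarrow> real \<Rightarrow> real" where
  "exp_recip n x = (if x > 0 then (1 / x) ^ n * exp (- (1 / x)) else 0)"

lemma exp_recip_deriv:
  "(exp_recip n has_real_derivative exp_recip (n + 2) x - real n * exp_recip (n + 1) x) (at x)"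
proof -
  consider "x < 0" | "x = 0" | "x > 0" by linarith
  then show ?thesis
  proof cases
    case 1
    have ev: "\<forall>\<^sub>F s in nhds x. exp_recip n s = 0"
      using eventually_nhds_in_open[of "{..<0}" x] 1 by (auto elim!: eventually_mono simp: exp_recip_def)
    show ?thesis using 1 by (subst DERIV_cong_ev[OF refl ev refl]) (simp add: exp_recip_def)
  next
    case 2
    have lim: "((\<lambda>y::real. y ^ Suc n / exp y) \<longlongrightarrow> 0) at_top" by (rule tendsto_power_div_exp_0)
    have "((\<lambda>h::real. (inverse h) ^ Suc n / exp (inverse h)) \<longlongrightarrow> 0) (at_right 0)"
      by (rule filterlim_compose[OF lim filterlim_inverse_at_top_right])
    moreover have "\<forall>\<^sub>F h in at_right 0. (inverse h) ^ Suc n / exp (inverse h) = (exp_recip n h - exp_recip n 0) / h"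
      using eventually_at_right_less[of "0::real"]
      by eventually_elim (simp add: exp_recip_def exp_minus field_simps)
    ultimately have r: "((\<lambda>h. (exp_recip n h - exp_recip n 0) / h) \<longlongrightarrow> 0) (at_right 0)"
      by (rule Lim_transform_eventually)
    have "\<forall>\<^sub>F h in at_left 0. 0 = (exp_recip n h - exp_recip n 0) / h"
      using eventually_at_left_real[of "-1" "0::real"] by (auto elim!: eventually_mono simp: exp_recip_def)
    then have l: "((\<lambda>h. (exp_recip n h - exp_recip n 0) / h) \<longlongrightarrow> 0) (at_left 0)"
      by (rule Lim_transform_eventually[rotated]) simp
    have "((\<lambda>h. (exp_recip n h - exp_recip n 0) / h) \<longlongrightarrow> 0) (at 0)"
      using l r by (simp add: filterlim_at_split)
    then show ?thesis using 2 by (simp add: has_field_derivative_iff exp_recip_def)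
  next
    case 3
    have "((\<lambda>x. (1 / x) ^ n * exp (- (1 / x))) has_real_derivative
       (real n * (1 / x) ^ (n - 1) * (- 1 / x\<^sup>2)) * exp (- (1 / x)) + (1 / x) ^ n * (exp (- (1 / x)) * (1 / x\<^sup>2))) (at x)"
      using 3 by (auto intro!: derivative_eq_intros simp: power2_eq_square)
    moreover have "(real n * (1 / x) ^ (n - 1) * (- 1 / x\<^sup>2)) * exp (- (1 / x)) + (1 / x) ^ n * (exp (- (1 / x)) * (1 / x\<^sup>2))
       = exp_recip (n + 2) x - real n * exp_recip (n + 1) x"
      using 3 by (cases n) (auto simp: exp_recip_def power2_eq_square field_simps)
    moreover have ev: "\<forall>\<^sub>F s in nhds x. exp_recip n s = (1 / s) ^ n * exp (- (1 / s))"
      using eventually_nhds_in_open[of "{0<..}" x] 3 by (auto elim!: eventually_mono simp: exp_recip_def)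
    ultimately show ?thesis by (subst DERIV_cong_ev[OF refl ev refl]) simp
  qed
qed

text \<open>
  A class of functions that contains the bumps needed and is closed under partial derivatives, so that
  smoothness of all orders follows by induction.
\<close>

inductive smooth_fun :: "(real^2 \<Rightarrow> real) \<Rightarrow> bool" where
  "smooth_fun (\<lambda>x. c)"
| "smooth_fun (\<lambda>x. exp_recip n (s * x $ i + c))"
| "smooth_fun f \<Longrightarrow> smooth_fun g \<Longrightarrow> smooth_fun (\<lambda>x. f x + g x)"
| "smooth_fun f \<Longrightarrow> smooth_fun g \<Longrightarrow> smooth_fun (\<lambda>x. f x * g x)"

lemma smooth_fun_GDERIV:
  assumes "smooth_fun f"
  shows "\<exists>D. (\<forall>x. GDERIV f x :> D x) \<and> (\<forall>i. smooth_fun (\<lambda>x. D x $ i))"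
  using assms
proof induction
  case (1 c)
  then show ?case by (intro exI[of _ "\<lambda>x. 0"]) (auto simp: GDERIV_const intro: smooth_fun.intros)
next
  case (2 n s j c)
  define e where "e y = exp_recip (n + 2) y - real n * exp_recip (n + 1) y" for y
  define D :: "real^2 \<Rightarrow> real^2" where "D x = (e (s * x $ j + c) * s) *\<^sub>R axis j 1" for x
  have "GDERIV (\<lambda>x. exp_recip n (s * x $ j + c)) x :> D x" for x :: "real^2"
  proof -
    have "((\<lambda>t. exp_recip n (s * t + c)) has_real_derivative e (s * x $ j + c) * s) (at (x $ j))"
      unfolding e_def by (rule DERIV_chain2[OF exp_recip_deriv]) (auto intro!: derivative_eq_intros)
    from GDERIV_DERIV_compose[OF GDERIV_component this] show ?thesis by (simp add: D_def)
  qed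
  moreover have "smooth_fun (\<lambda>x. D x $ i)" for i
  proof -
    have "(\<lambda>x. D x $ i) = (\<lambda>x. (exp_recip (n + 2) (s * x $ j + c) + (- real n) * exp_recip (n + 1) (s * x $ j + c)) * (s * axis j 1 $ i))"
      by (simp add: D_def e_def fun_eq_iff)
    then show ?thesis by (simp only:) (intro smooth_fun.intros)
  qed
  ultimately show ?case by blast
next
  case (3 f g)
  then obtain Df Dg where "\<forall>x. GDERIV f x :> Df x" "\<forall>i. smooth_fun (\<lambda>x. Df x $ i)"
     "\<forall>x. GDERIV g x :> Dg x" "\<forall>i. smooth_fun (\<lambda>x. Dg x $ i)" by blast
  then show ?case
    by (intro exI[of _ "\<lambda>x. Df x + Dg x"]) (auto intro: smooth_fun.intros GDERIV_add)
next
  case (4 f g)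
  then obtain Df Dg where "\<forall>x. GDERIV f x :> Df x" "\<forall>i. smooth_fun (\<lambda>x. Df x $ i)"
     "\<forall>x. GDERIV g x :> Dg x" "\<forall>i. smooth_fun (\<lambda>x. Dg x $ i)" by blast
  then show ?case using 4(1,2)
    by (intro exI[of _ "\<lambda>x. f x *\<^sub>R Dg x + g x *\<^sub>R Df x"]) (auto intro!: GDERIV_mult smooth_fun.intros(3)[OF smooth_fun.intros(4) smooth_fun.intros(4)])
qed

lemma smooth_fun_Ck: "smooth_fun f \<Longrightarrow> Ck_on k UNIV f"
proof (induction k arbitrary: f)
  case 0
  then obtain D where "\<And>x. GDERIV f x :> D x" using smooth_fun_GDERIV by blast
  then show ?case using GDERIV_continuous by auto
next
  case (Suc k)
  then obtain D where D: "\<And>x. GDERIV f x :> D x" "\<And>i. smooth_fun (\<lambda>x. D x $ i)"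
    using smooth_fun_GDERIV by blast
  have "partial_deriv i f = (\<lambda>x. D x $ i)" for i
    using GDERIV_imp_grad(2)[OF D(1)] by auto
  then show ?case using Suc.IH[OF D(2)] GDERIV_imp_grad(3)[OF D(1)] by simp
qed

lemma exists_bump_function:
  fixes a b :: "real^2"
  obtains \<phi> d\<phi> :: "_" where "\<And>x. GDERIV \<phi> x :> d\<phi> x" "continuous_on UNIV \<phi>" "continuous_on UNIV d\<phi>"
    "\<And>x. 0 \<le> \<phi> x" "\<And>x. 0 < \<phi> x \<longleftrightarrow> x \<in> box a b"
    "\<And>x. x \<notin> box a b \<Longrightarrow> d\<phi> x = 0" "\<And>\<Omega>. cbox a b \<subseteq> \<Omega> \<Longrightarrow> test_function \<Omega> \<phi>"
proof -
  define \<phi> where "\<phi> x = (exp_recip 0 (1 * x $ 1 + (- a $ 1)) * exp_recip 0 ((-1) * x $ 1 + b $ 1)) *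
     (exp_recip 0 (1 * x $ 2 + (- a $ 2)) * exp_recip 0 ((-1) * x $ 2 + b $ 2))" for x :: "real^2"
  have s: "smooth_fun \<phi>" unfolding \<phi>_def by (intro smooth_fun.intros)
  then obtain D where D: "\<And>x. GDERIV \<phi> x :> D x" "\<And>i. smooth_fun (\<lambda>x. D x $ i)"
    using smooth_fun_GDERIV by blast
  have c: "continuous_on UNIV f" if "smooth_fun f" for f using smooth_fun_Ck[OF that, of 0] by simp
  have "continuous_on UNIV (\<lambda>x. \<chi> i. D x $ i)" by (intro continuous_on_vec_lambda c D)
  then have Dc: "continuous_on UNIV D" by simp
  have nn: "0 \<le> \<phi> x" and pos: "0 < \<phi> x \<longleftrightarrow> x \<in> box a b" for x
    by (auto simp: \<phi>_def exp_recip_def mem_box_cart forall_2)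
  have "\<phi> x \<noteq> 0 \<longleftrightarrow> x \<in> box a b" for x using pos[of x] nn[of x] by (cases "\<phi> x = 0") auto
  then have "{x. \<phi> x \<noteq> 0} = box a b" by auto
  moreover have "closure (box a b) \<subseteq> cbox a b" by (rule closure_minimal[OF box_subset_cbox closed_cbox])
  moreover have "compact (closure (box a b))" by (simp add: bounded_box)
  ultimately have "test_function \<Omega> \<phi>" if "cbox a b \<subseteq> \<Omega>" for \<Omega>
    using that smooth_fun_Ck[OF s] by (auto simp: test_function_def)
  moreover have "D x = 0" if "x \<notin> box a b" for x
  proof -
    have "\<phi> x = 0" using that pos[of x] nn[of x] by linarith
    then have "\<forall>\<^sub>F y in at x. \<phi> x \<le> \<phi> y" using nn by simp
    then have "(\<lambda>h. h \<bullet> D x) = (\<lambda>h. 0)"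
      using D(1)[of x] unfolding gderiv_def by (rule has_derivative_local_min[rotated])
    then show ?thesis by (metis inner_eq_zero_iff)
  qed
  ultimately show thesis using that[OF D(1) c[OF s] Dc nn pos] by blast
qed

text \<open>
  If the bound failed at \<open>x0\<close>, the component of the classical gradient in the direction \<open>v\<close> of
  \<open>grad u x0\<close> would exceed \<open>w\<close> in a box around \<open>x0\<close>. Testing the weak gradient with a bump in that box,
  where integration by parts is classical, shows that the bump times \<open>grad u \<bullet> v\<close> has the same
  integral as the bump times \<open>Du \<bullet> v \<le> w\<close>.
\<close>

lemma norm_grad_le_of_weak_gradient_bound:
  fixes u w :: "real^2 \<Rightarrow> real" and Du :: "real^2 \<Rightarrow> real^2"
  assumes E: "open E" "E \<subseteq> \<Omega>" and harm: "harmonic_on E u" and weak: "weak_gradient \<Omega> u Du"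
    and le: "AE y in lebesgue. y \<in> K \<longrightarrow> norm (Du y) \<le> w y"
    and w: "continuous_on UNIV w" and x0: "x0 \<in> E" "x0 \<in> interior K"
  shows "norm (grad u x0) \<le> w x0"
proof (rule ccontr)
  assume contra: "\<not> ?thesis"
  define v where "v = sgn (grad u x0)"
  have v: "norm v \<le> 1" "grad u x0 \<bullet> v = norm (grad u x0)"
    by (cases "grad u x0 = 0"; simp add: v_def norm_sgn sgn_div_norm dot_square_norm power2_eq_square)+
  note hc = harmonic_on_continuous[OF harm]
  define d where "d x = grad u x \<bullet> v - w x" for x
  have d0: "d x0 > 0" using contra v by (simp add: d_def)
  have dc: "continuous_on (E \<inter> interior K) d"
    unfolding d_def by (intro continuous_intros continuous_on_subset[OF hc(3)] continuous_on_subset[OF w]) auto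
  have "open ((E \<inter> interior K) \<inter> d -` {0<..})"
    by (rule continuous_open_preimage[OF dc open_Int[OF E(1) open_interior] open_greaterThan])
  moreover have "x0 \<in> (E \<inter> interior K) \<inter> d -` {0<..}" using x0 d0 by auto
  ultimately obtain a b where ab: "cbox a b \<subseteq> (E \<inter> interior K) \<inter> d -` {0<..}" "x0 \<in> box a b"
    by (rule open_contains_cbox)
  define Q where "Q = cbox a b"
  have Q: "compact Q" "Q \<subseteq> E" "Q \<subseteq> K" "Q \<subseteq> \<Omega>" "\<And>x. x \<in> Q \<Longrightarrow> d x > 0" "box a b \<subseteq> Q"
    using ab(1) E(2) interior_subset[of K] box_subset_cbox[of a b] by (auto simp: Q_def)
  obtain \<phi> d\<phi> where \<phi>: "\<And>x. GDERIV \<phi> x :> d\<phi> x" "continuous_on UNIV \<phi>" "continuous_on UNIV d\<phi>"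
    "\<And>x. 0 \<le> \<phi> x" "\<And>x. 0 < \<phi> x \<longleftrightarrow> x \<in> box a b" "\<And>x. x \<notin> box a b \<Longrightarrow> d\<phi> x = 0"
    "\<And>\<Omega>. cbox a b \<subseteq> \<Omega> \<Longrightarrow> test_function \<Omega> \<phi>"
    using exists_bump_function[of a b] by blast
  have \<phi>0: "\<phi> x = 0" if "x \<notin> Q" for x
  proof -
    have "\<not> 0 < \<phi> x" using \<phi>(5)[of x] that Q(6) by blast
    then show ?thesis using \<phi>(4)[of x] by linarith
  qed
  have d\<phi>0: "d\<phi> x = 0" if "x \<notin> Q" for x using \<phi>(6)[of x] that Q(6) by blast
  have cE: "continuous_on E \<phi>" "continuous_on E d\<phi>" using \<phi> continuous_on_subset by blast+
  define D where "D i x = partial_deriv i u x * \<phi> x + d\<phi> x $ i * u x" for i x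
  have Di: "integrable lborel (\<lambda>x. indicator E x *\<^sub>R D i x)" "(LINT x|lborel. indicator E x *\<^sub>R D i x) = 0" for i
  proof -
    have 1: "continuous_on E (\<lambda>x. u x * \<phi> x)" "continuous_on E (D i)"
      unfolding D_def[abs_def] by (intro continuous_intros hc cE)+
    have 2: "((\<lambda>t. u (x + t *\<^sub>R axis i 1) * \<phi> (x + t *\<^sub>R axis i 1)) has_real_derivative D i x) (at 0)" if "x \<in> E" for x
      using DERIV_mult[OF has_real_derivative_along_axis[OF harmonic_onD(1)[OF harm that], where i = i]
          GDERIV_along_axis[OF \<phi>(1), where i = i and x = x]]
      by (simp add: D_def)
    show "integrable lborel (\<lambda>x. indicator E x *\<^sub>R D i x)" "(LINT x|lborel. indicator E x *\<^sub>R D i x) = 0"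
      using integral_directional_derivative_open_eq_0[OF E(1) Q(1,2) 1 2] \<phi>0 by simp_all
  qed
  define P1 where "P1 x = indicator E x *\<^sub>R (\<phi> x * (grad u x \<bullet> v))" for x
  define P2 where "P2 x = indicator E x *\<^sub>R (u x *\<^sub>R d\<phi> x)" for x
  define P3 where "P3 x = \<phi> x * w x" for x
  have P1: "integrable lborel P1"
    unfolding P1_def by (rule integrable_extend_by_0[OF E(1) Q(1,2)]) (auto intro!: continuous_intros hc cE simp: \<phi>0)
  have P2: "integrable lborel P2"
    unfolding P2_def by (rule integrable_extend_by_0[OF E(1) Q(1,2)]) (auto intro!: continuous_intros hc cE simp: d\<phi>0)
  have P3: "integrable lborel P3"
    unfolding P3_def by (rule integrable_continuous_compact_support[OF _ Q(1)]) (auto intro!: continuous_intros w \<phi> simp: \<phi>0)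
  have "(LINT x|lborel. P1 x + P2 x \<bullet> v) = (LINT x|lborel. (\<Sum>i\<in>UNIV. v $ i * (indicator E x *\<^sub>R D i x)))"
  proof (rule Bochner_Integration.integral_cong[OF refl])
    fix x
    have "(\<Sum>i\<in>UNIV. v $ i * (indicator E x *\<^sub>R D i x)) = indicator E x * (\<phi> x * (\<Sum>i\<in>UNIV. grad u x $ i * v $ i) + u x * (\<Sum>i\<in>UNIV. d\<phi> x $ i * v $ i))"
      unfolding D_def sum_2 grad_def by (simp add: algebra_simps)
    then show "P1 x + P2 x \<bullet> v = (\<Sum>i\<in>UNIV. v $ i * (indicator E x *\<^sub>R D i x))"
      by (simp add: P1_def P2_def inner_vec_def sum_2 algebra_simps)
  qed
  also have "\<dots> = (\<Sum>i\<in>UNIV. (LINT x|lborel. v $ i * (indicator E x *\<^sub>R D i x)))"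
    by (rule Bochner_Integration.integral_sum) (intro integrable_mult_right Di)
  also have "\<dots> = 0" using Di(2) by simp
  finally have "(LINT x|lborel. P1 x) + (LINT x|lborel. P2 x) \<bullet> v = 0"
    using P1 P2 by (subst (asm) Bochner_Integration.integral_add) auto
  moreover have "- ((LINT x|lborel. P2 x) \<bullet> v) \<le> (LINT x|lborel. P3 x)"
  proof -
    have "grad \<phi> = d\<phi>" using GDERIV_imp_grad(1)[OF \<phi>(1)] by auto
    moreover have "(LINT x:\<Omega>|lebesgue. u x *\<^sub>R grad \<phi> x) = - (LINT x:\<Omega>|lebesgue. \<phi> x *\<^sub>R Du x)"
      using weak \<phi>(7)[OF Q(4)[unfolded Q_def]] unfolding weak_gradient_def by blast
    ultimately have "(LINT x:\<Omega>|lebesgue. u x *\<^sub>R d\<phi> x) = - (LINT x:\<Omega>|lebesgue. \<phi> x *\<^sub>R Du x)"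
      by simp
    moreover have "(LINT x:\<Omega>|lebesgue. u x *\<^sub>R d\<phi> x) = (LINT x|lebesgue. P2 x)"
      unfolding set_lebesgue_integral_def P2_def
    proof (rule Bochner_Integration.integral_cong[OF refl])
      show "indicator \<Omega> x *\<^sub>R u x *\<^sub>R d\<phi> x = indicator E x *\<^sub>R (u x *\<^sub>R d\<phi> x)" for x
        using Q(2,4) d\<phi>0[of x] by (cases "x \<in> Q") (auto simp: indicator_def)
    qed
    moreover have "(LINT x|lebesgue. P2 x) = (LINT x|lborel. P2 x)"
      using P2 by (intro integral_completion) auto
    moreover have "(LINT x:\<Omega>|lebesgue. \<phi> x *\<^sub>R Du x) = (LINT x|lebesgue. \<phi> x *\<^sub>R (indicator Q x *\<^sub>R Du x))"
      unfolding set_lebesgue_integral_def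
    proof (rule Bochner_Integration.integral_cong[OF refl])
      show "indicator \<Omega> x *\<^sub>R \<phi> x *\<^sub>R Du x = \<phi> x *\<^sub>R (indicator Q x *\<^sub>R Du x)" for x
        using Q(4) \<phi>0[of x] by (cases "x \<in> Q") (auto simp: indicator_def)
    qed
    ultimately have eq: "(LINT x|lborel. P2 x) = - (LINT x|lebesgue. \<phi> x *\<^sub>R (indicator Q x *\<^sub>R Du x))"
      by simp
    have m: "(\<lambda>x. indicator Q x *\<^sub>R Du x) \<in> borel_measurable lebesgue"
      using weak Q(1,4) unfolding weak_gradient_def Lp_loc_def set_borel_measurable_def by blast
    have P3': "integrable lebesgue P3" using P3 by (subst integrable_completion) auto
    have \<phi>m: "\<phi> \<in> borel_measurable lebesgue"
      using borel_measurable_continuous_onI[OF \<phi>(2)] by (intro measurable_completion) simp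
    have P3nn: "0 \<le> P3 x" if "norm (\<phi> x *\<^sub>R (indicator Q x *\<^sub>R Du x)) \<le> P3 x" for x
      using that norm_ge_zero order_trans by blast
    have bound: "AE x in lebesgue. norm (\<phi> x *\<^sub>R (indicator Q x *\<^sub>R Du x)) \<le> P3 x"
      using le
    proof eventually_elim
      case (elim x)
      show ?case
      proof (cases "x \<in> Q")
        case True
        then show ?thesis using elim Q(3) \<phi>(4)[of x] by (auto simp: P3_def mult_left_mono)
      qed (use \<phi>0 in \<open>simp add: P3_def\<close>)
    qed
    have int: "integrable lebesgue (\<lambda>x. \<phi> x *\<^sub>R (indicator Q x *\<^sub>R Du x))"
    proof (rule Bochner_Integration.integrable_bound[OF P3'])
      show "(\<lambda>x. \<phi> x *\<^sub>R (indicator Q x *\<^sub>R Du x)) \<in> borel_measurable lebesgue"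
        using \<phi>m m by (rule borel_measurable_scaleR)
      show "AE x in lebesgue. norm (\<phi> x *\<^sub>R (indicator Q x *\<^sub>R Du x)) \<le> norm (P3 x)"
        using bound by eventually_elim (use P3nn in simp)
    qed
    have "- ((LINT x|lborel. P2 x) \<bullet> v) = (LINT x|lebesgue. (\<phi> x *\<^sub>R (indicator Q x *\<^sub>R Du x)) \<bullet> v)"
      unfolding integral_inner_left[OF int] eq by simp
    also have "\<dots> \<le> (LINT x|lebesgue. P3 x)"
    proof (rule integral_mono_AE[OF integrable_inner_left[OF int] P3'])
      show "AE x in lebesgue. (\<phi> x *\<^sub>R (indicator Q x *\<^sub>R Du x)) \<bullet> v \<le> P3 x"
        using bound
      proof eventually_elim
        case (elim x)
        have "(\<phi> x *\<^sub>R (indicator Q x *\<^sub>R Du x)) \<bullet> v \<le> norm (\<phi> x *\<^sub>R (indicator Q x *\<^sub>R Du x)) * norm v"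
          by (rule norm_cauchy_schwarz)
        also have "\<dots> \<le> norm (\<phi> x *\<^sub>R (indicator Q x *\<^sub>R Du x)) * 1"
          using v(1) by (intro mult_left_mono) auto
        finally show ?case using elim by linarith
      qed
    qed
    also have "\<dots> = (LINT x|lborel. P3 x)" using P3 by (intro integral_completion) auto
    finally show ?thesis .
  qed
  ultimately have "(LINT x|lborel. P1 x - P3 x) \<le> 0" using P1 P3 by simp
  moreover have P13: "P1 x - P3 x = \<phi> x * d x" for x
    using Q(2) \<phi>0[of x] by (auto simp: P1_def P3_def d_def indicator_def algebra_simps)
  moreover have nn: "0 \<le> \<phi> x * d x" for x
    using Q(5)[of x] \<phi>(4)[of x] \<phi>0[of x] by (cases "x \<in> Q") auto
  ultimately have "(LINT x|lborel. P1 x - P3 x) = 0"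
    using integral_nonneg_AE[of "\<lambda>x. P1 x - P3 x" lborel] by (simp add: antisym)
  then have "AE x in lborel. P1 x - P3 x = 0"
    using integral_nonneg_eq_0_iff_AE[OF Bochner_Integration.integrable_diff[OF P1 P3]] P13 nn by simp
  then have "AE x in lborel. x \<notin> box a b"
  proof eventually_elim
    case (elim x)
    then show ?case using P13[of x] \<phi>(5)[of x] Q(5)[of x] Q(6) by auto
  qed
  then have "emeasure lborel (box a b) = 0"
    using AE_iff_measurable[of "box a b" lborel "\<lambda>x. x \<notin> box a b"] by simp
  then have "negligible (box a b)"
    by (simp add: negligible_iff_emeasure0 emeasure_completion)
  then show False using open_not_negligible[OF open_box, of a b] ab(2) by auto
qed

section \<open>The calibrated flux inequality\<close>

lemma radial_cutoff:
  fixes p :: "real^2"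
  assumes "0 < s" "s < r"
  obtains \<phi> :: "real^2 \<Rightarrow> real" and d\<phi> :: "real^2 \<Rightarrow> real^2" where "\<And>x. GDERIV \<phi> x :> d\<phi> x" "continuous_on UNIV d\<phi>" "\<And>x. 0 \<le> \<phi> x" "\<And>x. \<phi> x \<le> 1"
    "\<And>x. x \<in> ball p s \<Longrightarrow> \<phi> x = 1" "\<And>x. x \<notin> ball p r \<Longrightarrow> \<phi> x = 0" "\<And>x. x \<notin> ball p r \<Longrightarrow> d\<phi> x = 0"
    "\<And>x. norm (d\<phi> x) \<le> 4 / (r - s)"
proof -
  define w where "w = r\<^sup>2 - s\<^sup>2"
  have w: "w = (r - s) * (r + s)" by (simp add: w_def power2_eq_square algebra_simps)
  then have w0: "w > 0" using assms by simp
  \<comment> \<open>Interpolates the squared radius affinely, from \<open>1\<close> at \<open>s\<close> to \<open>2\<close> at \<open>r\<close>, the range where \<open>step\<close> rises.\<close>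
  define T where "T x = 1 + ((norm (x - p))\<^sup>2 - s\<^sup>2) / w" for x
  define \<phi> where "\<phi> x = 1 - step (T x)" for x
  define d\<phi> where "d\<phi> x = - ((step' (T x) / w) *\<^sub>R (2 *\<^sub>R (x - p)))" for x
  have g: "GDERIV \<phi> x :> d\<phi> x" for x
  proof -
    have "((\<lambda>t. 1 + (t - s\<^sup>2) / w) has_real_derivative 1 / w) (at ((norm (x - p))\<^sup>2))"
      using w0 by (auto intro!: derivative_eq_intros)
    from GDERIV_DERIV_compose[OF GDERIV_square_dist DERIV_chain2[OF step_deriv this]]
    have "GDERIV (\<lambda>x. step (T x)) x :> (step' (T x) / w) *\<^sub>R (2 *\<^sub>R (x - p))"
      by (simp add: T_def)
    from GDERIV_diff[OF GDERIV_const this] show ?thesis by (simp add: \<phi>_def[abs_def] d\<phi>_def)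
  qed
  have c: "continuous_on UNIV d\<phi>"
    unfolding d\<phi>_def T_def using w0 by (intro continuous_intros) auto
  have far: "\<phi> x = 0 \<and> d\<phi> x = 0" if "x \<notin> ball p r" for x
  proof -
    have "r\<^sup>2 \<le> (norm (x - p))\<^sup>2"
      using that assms by (intro power_mono) (auto simp: dist_norm norm_minus_commute)
    then have "2 \<le> T x" using w0 by (simp add: T_def w_def)
    then show ?thesis by (simp add: \<phi>_def d\<phi>_def)
  qed
  have near: "\<phi> x = 1" if "x \<in> ball p s" for x
  proof -
    have "(norm (x - p))\<^sup>2 \<le> s\<^sup>2"
      using that by (intro power_mono) (auto simp: dist_norm norm_minus_commute)
    then have "T x \<le> 1" using w0 by (simp add: T_def divide_nonpos_pos)
    then show ?thesis by (simp add: \<phi>_def)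
  qed
  have bd: "norm (d\<phi> x) \<le> 4 / (r - s)" for x
  proof (cases "x \<in> ball p r")
    case True
    have "norm (d\<phi> x) = (step' (T x) / w) * (2 * norm (x - p))"
      unfolding d\<phi>_def using step'_bounds(1)[of "T x"] w0 by simp
    also have "\<dots> \<le> (2 / w) * (2 * (r + s))"
      using True w0 assms step'_bounds
      by (intro mult_mono divide_right_mono) (auto simp: dist_norm norm_minus_commute)
    also have "\<dots> = 4 / (r - s)"
    proof -
      have "r - s \<noteq> 0" "r + s \<noteq> 0" using assms by auto
      then show ?thesis unfolding w by (simp add: divide_simps)
    qed
    finally show ?thesis .
  qed (use far assms in simp)
  show thesis
    using that[of \<phi> d\<phi>] g c far near bd step_bounds by (auto simp: \<phi>_def)
qed

lemma harmonic_on_subset: "harmonic_on S f \<Longrightarrow> T \<subseteq> S \<Longrightarrow> harmonic_on T f"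
  unfolding harmonic_on_def numeral_2_eq_2 by simp (meson continuous_on_subset subsetD)

lemma continuous_on_weight:
  "0 < \<gamma> \<Longrightarrow> continuous_on S (\<lambda>x::real^2. \<bar>x$2\<bar> powr \<gamma>)"
  by (intro continuous_on_powr' continuous_intros) auto

lemma abs_powr_deriv:
  assumes "t \<noteq> (0::real)"
  shows "((\<lambda>h. \<bar>t + h\<bar> powr \<gamma>) has_real_derivative \<gamma> * \<bar>t\<bar> powr (\<gamma> - 1) * sgn t) (at 0)"
proof -
  have "((\<lambda>h. \<bar>h\<bar>) has_real_derivative sgn t) (at t)"
  proof (cases "t > 0")
    case True
    have ev: "\<forall>\<^sub>F h in nhds t. \<bar>h\<bar> = h"
      using eventually_nhds_in_open[of "{0<..}" t] True by (auto elim!: eventually_mono)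
    show ?thesis using True by (subst DERIV_cong_ev[OF refl ev refl]) simp
  next
    case False
    have ev: "\<forall>\<^sub>F h in nhds t. \<bar>h\<bar> = - h"
      using eventually_nhds_in_open[of "{..<0}" t] False assms by (auto elim!: eventually_mono)
    show ?thesis using False assms by (subst DERIV_cong_ev[OF refl ev refl]) (auto intro!: derivative_eq_intros)
  qed
  then have "((\<lambda>h. \<bar>t + h\<bar>) has_real_derivative sgn t) (at 0)"
    using DERIV_shift[of "\<lambda>h. \<bar>h\<bar>" "sgn t" 0 t] by (simp add: add.commute)
  moreover have "((\<lambda>y. y powr \<gamma>) has_real_derivative \<gamma> * \<bar>t + 0\<bar> powr (\<gamma> - 1)) (at \<bar>t + 0\<bar>)"
    using assms by (intro has_real_derivative_powr) simp
  ultimately show ?thesis using DERIV_chain2 by fastforce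
qed

text \<open>
  The flux inequality for \<open>Y = \<eta> \<phi> w N / (3 l)\<close> and \<open>q = 2 \<eta> \<phi>\<close>, where \<open>N\<close> is the calibration of \<open>f\<close>,
  \<open>\<phi>\<close> localises to a ball and \<open>\<eta>\<close> removes the axis and the singular set. The divergence of \<open>Y\<close> bounds
  \<open>\<eta> \<phi> f w / (3 l)\<close> from below up to terms with derivatives of the cutoffs; those are controlled by
  \<open>\<bar>\<nabla>u\<bar> \<le> C w\<close>. All of this takes place off the axis, where \<open>w\<close> is smooth.
\<close>

lemma calibrated_flux_inequality:
  fixes u f \<eta> \<phi> :: "real^2 \<Rightarrow> real" and d\<eta> d\<phi> :: "real^2 \<Rightarrow> real^2"
  assumes "\<gamma> > 0" and \<Omega>: "open \<Omega>" "continuous_on \<Omega> u" and E_def: "E = pos_set \<Omega> u" and harm: "harmonic_on E u"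
    and "C \<ge> 0" and gb: "\<And>x. x \<in> E \<Longrightarrow> x \<in> ball p r \<Longrightarrow> norm (grad u x) \<le> C * \<bar>x$2\<bar> powr \<gamma>"
    and \<phi>: "\<And>x. GDERIV \<phi> x :> d\<phi> x" "continuous_on UNIV d\<phi>" "\<And>x. 0 \<le> \<phi> x" "\<And>x. \<phi> x \<le> 1"
      "\<And>x. x \<notin> ball p r \<Longrightarrow> \<phi> x = 0" "\<And>x. x \<notin> ball p r \<Longrightarrow> d\<phi> x = 0" "\<And>x. norm (d\<phi> x) \<le> c"
    and \<eta>: "\<And>x. GDERIV \<eta> x :> d\<eta> x" "continuous_on UNIV d\<eta>" "\<And>x. 0 \<le> \<eta> x" "\<And>x. \<eta> x \<le> 1"
    and C0: "compact C0" "C0 \<subseteq> \<Omega>" "\<And>x. x \<in> C0 \<Longrightarrow> x$2 \<noteq> 0" "\<And>x. x \<notin> C0 \<Longrightarrow> \<eta> x * \<phi> x = 0"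
    and \<epsilon>: "\<epsilon> > 0" "\<And>x. x \<in> C0 \<Longrightarrow> x \<in> E \<Longrightarrow> u x < \<epsilon> \<Longrightarrow> \<bar>x$2\<bar> powr \<gamma> \<le> 2 * norm (grad u x)"
    and f: "continuous_on UNIV f" "compact K" "K \<subseteq> E \<inter> ball p r" "\<And>x. x \<notin> K \<Longrightarrow> f x = 0" "\<And>x. 0 \<le> f x" "\<And>x. f x \<le> 1"
      "\<And>x. x \<in> K \<Longrightarrow> \<epsilon> \<le> u x"
    and "l > 0" and l: "(LINT x|lborel. f x * \<bar>x$2\<bar> powr \<gamma>) \<le> l powr (2 + \<gamma>)"
  shows "(LINT x|lborel. \<eta> x * \<phi> x * f x * \<bar>x$2\<bar> powr \<gamma>) \<le> 3 * l * (1 + 2 * C) *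
     (c * (LINT x|lborel. indicator (E \<inter> ball p r) x * \<bar>x$2\<bar> powr \<gamma>) +
      (LINT x|lborel. indicator (ball p r) x * (norm (d\<eta> x) * \<bar>x$2\<bar> powr \<gamma>)))"
proof -
  obtain A :: "real^2 \<Rightarrow> real" and \<kappa> \<beta> B :: "real \<Rightarrow> real" where
    cal: "continuous_on UNIV A" "continuous_on UNIV \<kappa>" "continuous_on UNIV \<beta>"
    "\<And>x. ((\<lambda>t. A (x + t *\<^sub>R axis 1 1)) has_real_derivative \<kappa> (x$2) * f x) (at 0)"
    "\<And>t. (B has_real_derivative \<beta> t) (at t)"
    "\<And>x. \<bar>A x\<bar> \<le> l" "\<And>t. \<bar>B t\<bar> \<le> 2 * l" "\<And>t. 0 \<le> t * B t" "\<And>t. 0 \<le> \<beta> t"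
    "\<And>x. f x \<le> \<kappa> (x$2) * f x + \<beta> (x$2)"
    using exists_calibration[OF f(1,2,4,5,6) \<open>\<gamma> > 0\<close> \<open>l > 0\<close> l] by blast
  define \<omega> where "\<omega> x = \<bar>x$2\<bar> powr \<gamma>" for x :: "real^2"
  define \<omega>' where "\<omega>' x = \<gamma> * \<bar>x$2\<bar> powr (\<gamma> - 1) * sgn (x$2)" for x :: "real^2"
  define k where "k = 3 * l"
  have k: "k > 0" using \<open>l > 0\<close> by (simp add: k_def)
  define X where "X x = \<eta> x *\<^sub>R d\<phi> x + \<phi> x *\<^sub>R d\<eta> x" for x
  define q where "q x = \<eta> x * \<phi> x" for x
  define Y :: "real^2 \<Rightarrow> real^2" where "Y x = vector [q x * (\<omega> x * A x) / k, q x * (\<omega> x * B (x$2)) / k]" for x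
  define dY :: "real^2 \<Rightarrow> real^2" where "dY x = vector
     [(q x * (\<omega> x * (\<kappa> (x$2) * f x)) + X x $ 1 * (\<omega> x * A x)) / k,
      (q x * (\<omega> x * \<beta> (x$2) + \<omega>' x * B (x$2)) + X x $ 2 * (\<omega> x * B (x$2))) / k]" for x
  \<comment> \<open>Removing the axis makes the weight smooth and keeps the support \<open>C0\<close> compact in the domain.\<close>
  define \<Omega>' where "\<Omega>' = \<Omega> \<inter> {x. x$2 \<noteq> 0}"
  define E' where "E' = pos_set \<Omega>' u"
  have E'_eq: "E' = E \<inter> {x. x$2 \<noteq> 0}" by (auto simp: E'_def E_def \<Omega>'_def pos_set_def)
  have "open {x::real^2. x$2 \<noteq> 0}" by (intro open_Collect_neq continuous_intros)
  then have \<Omega>': "open \<Omega>'" "continuous_on \<Omega>' u" "C0 \<subseteq> \<Omega>'"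
    using \<Omega> C0 continuous_on_subset[OF \<Omega>(2)] by (auto simp: \<Omega>'_def)
  have harm': "harmonic_on E' u" using harmonic_on_subset[OF harm] E'_eq by auto
  have qX: "GDERIV q x :> X x" for x
    unfolding q_def[abs_def] X_def by (rule GDERIV_mult[OF \<eta>(1) \<phi>(1)])
  have q0: "q x = 0" if "x \<notin> C0" for x using C0(4) that by (simp add: q_def)
  have q01: "0 \<le> q x" "q x \<le> 1" for x using \<eta>(3,4)[of x] \<phi>(3,4)[of x] by (auto simp: q_def mult_le_one)
  have Xoff: "X x = 0" "q x = 0" if "x \<notin> ball p r" for x using \<phi>(5,6)[OF that] by (auto simp: X_def q_def)
  have \<omega>0: "0 \<le> \<omega> x" for x by (simp add: \<omega>_def)
  note c\<eta> = GDERIV_continuous[OF \<eta>(1)] and c\<phi> = GDERIV_continuous[OF \<phi>(1)] and cq = GDERIV_continuous[OF qX]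
  have c\<omega>: "continuous_on S \<omega>" for S unfolding \<omega>_def using \<open>\<gamma> > 0\<close> by (rule continuous_on_weight)
  have cX: "continuous_on UNIV X" unfolding X_def by (intro continuous_intros c\<eta> c\<phi> \<eta>(2) \<phi>(2))
  have cB: "continuous_on UNIV B" using cal(5) DERIV_continuous_on[of UNIV B \<beta>] by blast
  have c2: "continuous_on S (\<lambda>x. h (x$2))" if "continuous_on UNIV h" for h :: "real \<Rightarrow> real" and S :: "(real^2) set"
    by (rule continuous_on_compose2[OF that]) (auto intro: continuous_intros)
  have c\<omega>': "continuous_on E' \<omega>'"
    unfolding \<omega>'_def by (intro continuous_intros) (auto simp: E'_eq)
  have sub: "continuous_on E' h" if "continuous_on UNIV h" for h :: "real^2 \<Rightarrow> 'z::topological_space"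
    using that continuous_on_subset by blast
  have cY: "continuous_on E' Y"
    unfolding Y_def using k
    by (intro continuous_on_vector_2 continuous_intros sub[OF cq] c\<omega> sub[OF cal(1)] c2[OF cB]) auto
  have cdY: "continuous_on E' dY"
    unfolding dY_def using k
    by (intro continuous_on_vector_2 continuous_intros sub[OF cq] sub[OF cX] c\<omega> c\<omega>' sub[OF cal(1)] sub[OF f(1)] c2[OF cB] c2[OF cal(2)] c2[OF cal(3)]) auto
  have derY: "((\<lambda>t. Y (x + t *\<^sub>R axis i 1) $ i) has_real_derivative dY x $ i) (at 0)" if x: "x \<in> E'" for x i
  proof -
    consider "i = 1" | "i = 2" using exhaust_2[of i] by blast
    then show ?thesis
    proof cases
      case 1
      have "((\<lambda>t. q (x + t *\<^sub>R axis 1 1) * (\<omega> x * A (x + t *\<^sub>R axis 1 1)) / k) has_real_derivative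
         (q (x + 0 *\<^sub>R axis 1 1) * (\<omega> x * (\<kappa> (x$2) * f x)) + X x $ 1 * (\<omega> x * A (x + 0 *\<^sub>R axis 1 1))) / k) (at 0)"
        by (intro DERIV_cdivide DERIV_mult' DERIV_cmult GDERIV_along_axis[OF qX] cal(4))
      moreover have "\<omega> (x + t *\<^sub>R axis 1 1) = \<omega> x" for t by (simp add: \<omega>_def axis_def)
      ultimately show ?thesis using 1 by (simp add: Y_def dY_def)
    next
      case 2
      have x2: "x$2 \<noteq> 0" using x by (simp add: E'_eq)
      have "((\<lambda>h. B (x$2 + h)) has_real_derivative \<beta> (x$2)) (at 0)"
        using cal(5)[of "x$2"] DERIV_shift[of B "\<beta> (x$2)" 0 "x$2"] by (simp add: add.commute)
      then have "((\<lambda>t. q (x + t *\<^sub>R axis 2 1) * (\<bar>x$2 + t\<bar> powr \<gamma> * B (x$2 + t)) / k) has_real_derivative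
         (q (x + 0 *\<^sub>R axis 2 1) * (\<bar>x$2 + 0\<bar> powr \<gamma> * \<beta> (x$2) + \<gamma> * \<bar>x$2\<bar> powr (\<gamma> - 1) * sgn (x$2) * B (x$2 + 0)) + X x $ 2 * (\<bar>x$2 + 0\<bar> powr \<gamma> * B (x$2 + 0))) / k) (at 0)"
        by (intro DERIV_cdivide DERIV_mult' GDERIV_along_axis[OF qX] abs_powr_deriv[OF x2])
      then show ?thesis using 2 by (simp add: Y_def dY_def \<omega>_def \<omega>'_def axis_def)
    qed
  qed
  have derq: "((\<lambda>t. 2 * q (x + t *\<^sub>R axis i 1)) has_real_derivative (2 *\<^sub>R X x) $ i) (at 0)" for x i
    using DERIV_cmult[OF GDERIV_along_axis[OF qX, where i = i], of 2] by simp
  have normY: "norm (Y x) \<le> q x * \<omega> x" for x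
  proof -
    have "norm (Y x) \<le> \<bar>Y x $ 1\<bar> + \<bar>Y x $ 2\<bar>" using norm_le_l1_cart[of "Y x"] by (simp add: sum_2)
    also have "\<dots> = q x * \<omega> x * ((\<bar>A x\<bar> + \<bar>B (x$2)\<bar>) / k)"
      using q01(1)[of x] \<omega>0[of x] k by (simp add: Y_def abs_mult algebra_simps add_divide_distrib)
    also have "\<dots> \<le> q x * \<omega> x * 1"
      using cal(6)[of x] cal(7)[of "x$2"] q01(1)[of x] \<omega>0[of x] k by (intro mult_left_mono) (auto simp: k_def)
    finally show ?thesis by simp
  qed
  have le: "norm (Y x) \<le> 2 * q x * norm (grad u x)" if "x \<in> E'" "u x < \<epsilon>" for x
  proof (cases "x \<in> C0")
    case True
    have "q x * \<omega> x \<le> q x * (2 * norm (grad u x))"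
      using \<epsilon>(2)[OF True _ that(2)] that(1) q01(1) by (intro mult_left_mono) (auto simp: E'_eq \<omega>_def)
    then show ?thesis using normY[of x] by simp
  next
    case False
    then show ?thesis using normY[of x] q0 by simp
  qed
  define W where "W x = indicator E' x *\<^sub>R (step (2 * u x / \<epsilon>) * ((\<Sum>i\<in>UNIV. dY x $ i) + (2 *\<^sub>R X x) \<bullet> grad u x))" for x
  have Y0: "Y x = 0" if "x \<notin> C0" for x using normY[of x] q0[OF that] by simp
  have c2q: "continuous_on E' (\<lambda>x. 2 * q x)" "continuous_on E' (\<lambda>x. 2 *\<^sub>R X x)"
    by (intro continuous_intros sub cq cX)+
  have W: "integrable lborel W" "(LINT x|lborel. W x) \<le> 0"
    unfolding W_def
    using flux_inequality[OF \<Omega>'(1,2) E'_def harm' \<epsilon>(1) C0(1) \<Omega>'(3) Y0 _ cY cdY c2q derY derq le] q0 by auto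
  define P where "P x = indicator (E \<inter> ball p r) x * \<omega> x" for x
  define N where "N x = indicator (ball p r) x * (norm (d\<eta> x) * \<omega> x)" for x
  have pt: "q x * f x * \<omega> x / k \<le> W x + (1 + 2 * C) * (c * P x + N x)" for x
  proof -
    have c0: "0 \<le> c" using \<phi>(7)[of x] norm_ge_zero order_trans by blast
    have rhs0: "0 \<le> (1 + 2 * C) * (c * P x + N x)"
      using \<open>C \<ge> 0\<close> c0 \<omega>0[of x] by (auto simp: P_def N_def)
    show ?thesis
    proof (cases "x \<in> E' \<and> x \<in> ball p r")
      case False
      have "W x = 0"
      proof (cases "x \<in> E'")
        case True
        then have "x \<notin> ball p r" using False by blast
        from Xoff[OF this] show ?thesis by (simp add: W_def dY_def sum_2)
      qed (simp add: W_def)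
      moreover have "f x * \<omega> x = 0"
      proof (cases "x \<in> K")
        case True
        then have "x$2 = 0" using False f(3) by (auto simp: E'_eq)
        then show ?thesis by (simp add: \<omega>_def)
      qed (use f(4) in simp)
      ultimately show ?thesis using rhs0 by (auto simp: mult.assoc)
    next
      case True
      then have xE: "x \<in> E" "x \<in> E'" "x \<in> ball p r" by (auto simp: E'_eq)
      define \<theta> where "\<theta> = step (2 * u x / \<epsilon>)"
      have \<theta>: "0 \<le> \<theta>" "\<theta> \<le> 1" using step_bounds by (auto simp: \<theta>_def)
      \<comment> \<open>The truncation is invisible on the support of \<open>f\<close>, where \<open>u \<ge> \<epsilon>\<close>.\<close>
      have \<theta>f: "\<theta> * f x = f x"
      proof (cases "x \<in> K")
        case True
        then have "\<theta> = 1" using f(7)[OF True] \<epsilon>(1) unfolding \<theta>_def by (intro step_1) (simp add: field_simps)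
        then show ?thesis by simp
      qed (use f(4) in simp)
      have X1: "X x $ 1 * A x + X x $ 2 * B (x$2) \<ge> - (norm (X x) * k)"
      proof -
        have a: "\<bar>X x $ i\<bar> \<le> norm (X x)" for i using component_le_norm_cart by blast
        have "\<bar>X x $ 1 * A x\<bar> \<le> norm (X x) * l" "\<bar>X x $ 2 * B (x$2)\<bar> \<le> norm (X x) * (2 * l)"
          unfolding abs_mult using a cal(6)[of x] cal(7)[of "x$2"] by (intro mult_mono; simp)+
        then show ?thesis by (simp add: k_def algebra_simps)
      qed
      \<comment> \<open>The vertical part of the calibration points away from the axis, the direction in which \<open>w\<close> grows.\<close>
      have wB: "0 \<le> \<omega>' x * B (x$2)"
      proof -
        have "0 \<le> sgn (x$2) * B (x$2)" using cal(8)[of "x$2"]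
          by (auto simp: sgn_real_def zero_le_mult_iff)
        moreover have "0 \<le> \<gamma> * \<bar>x$2\<bar> powr (\<gamma> - 1)" using \<open>\<gamma> > 0\<close> by simp
        ultimately have "0 \<le> \<gamma> * \<bar>x$2\<bar> powr (\<gamma> - 1) * (sgn (x$2) * B (x$2))"
          by (rule mult_nonneg_nonneg[rotated])
        then show ?thesis by (simp add: \<omega>'_def mult_ac)
      qed
      have "(\<Sum>i\<in>UNIV. dY x $ i) * k = q x * \<omega> x * (\<kappa> (x$2) * f x + \<beta> (x$2)) + q x * (\<omega>' x * B (x$2)) + \<omega> x * (X x $ 1 * A x + X x $ 2 * B (x$2))"
      proof -
        have "(a / k + b / k) * k = a + b" for a b using k by (simp add: distrib_right)
        then show ?thesis by (simp add: sum_2 dY_def) (simp add: algebra_simps)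
      qed
      moreover have "q x * \<omega> x * (\<kappa> (x$2) * f x + \<beta> (x$2)) \<ge> q x * \<omega> x * f x"
        using cal(10)[of x] q01(1)[of x] \<omega>0[of x] by (intro mult_left_mono) auto
      moreover have "q x * (\<omega>' x * B (x$2)) \<ge> 0" using wB q01(1)[of x] by simp
      moreover have "\<omega> x * (X x $ 1 * A x + X x $ 2 * B (x$2)) \<ge> \<omega> x * (- (norm (X x) * k))"
        using X1 \<omega>0[of x] by (intro mult_left_mono)
      ultimately have "(q x * \<omega> x * f x / k - norm (X x) * \<omega> x) * k \<le> (\<Sum>i\<in>UNIV. dY x $ i) * k"
        using k by (simp add: algebra_simps)
      then have d1: "q x * \<omega> x * f x / k - norm (X x) * \<omega> x \<le> (\<Sum>i\<in>UNIV. dY x $ i)"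
        using k by simp
      have d2: "- (2 * C * (norm (X x) * \<omega> x)) \<le> (2 *\<^sub>R X x) \<bullet> grad u x"
      proof -
        have "- ((2 *\<^sub>R X x) \<bullet> grad u x) \<le> norm (2 *\<^sub>R X x) * norm (grad u x)"
          using norm_cauchy_schwarz[of "- (2 *\<^sub>R X x)" "grad u x"] by simp
        also have "\<dots> \<le> norm (2 *\<^sub>R X x) * (C * \<omega> x)"
          using gb[OF xE(1,3)] by (intro mult_left_mono) (auto simp: \<omega>_def)
        also have "\<dots> = 2 * C * (norm (X x) * \<omega> x)" by simp
        finally show ?thesis by linarith
      qed
      have nX: "norm (X x) \<le> c + norm (d\<eta> x)"
        using cutoff_product_bounds(4)[OF \<eta>(3)[of x] \<eta>(4)[of x] \<phi>(3)[of x] \<phi>(4)[of x], of "d\<phi> x" "d\<eta> x"] \<phi>(7)[of x]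
        by (simp add: X_def)
      have "q x * f x * \<omega> x / k = \<theta> * (q x * \<omega> x * f x / k)"
      proof -
        have "\<theta> * (q x * \<omega> x * f x / k) = (\<theta> * f x) * (q x * \<omega> x / k)" by simp
        also have "\<dots> = q x * f x * \<omega> x / k" by (simp only: \<theta>f) simp
        finally show ?thesis by (rule sym)
      qed
      also have "\<dots> \<le> \<theta> * ((\<Sum>i\<in>UNIV. dY x $ i) + (2 *\<^sub>R X x) \<bullet> grad u x + (1 + 2 * C) * (norm (X x) * \<omega> x))"
      proof (rule mult_left_mono[OF _ \<theta>(1)])
        have "(1 + 2 * C) * (norm (X x) * \<omega> x) = norm (X x) * \<omega> x + 2 * C * (norm (X x) * \<omega> x)"
          by (simp add: distrib_right)
        then show "q x * \<omega> x * f x / k \<le> (\<Sum>i\<in>UNIV. dY x $ i) + (2 *\<^sub>R X x) \<bullet> grad u x + (1 + 2 * C) * (norm (X x) * \<omega> x)"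
          using d1 d2 by linarith
      qed
      also have "\<dots> = W x + \<theta> * ((1 + 2 * C) * (norm (X x) * \<omega> x))"
        using xE by (simp add: W_def \<theta>_def distrib_left)
      also have "\<theta> * ((1 + 2 * C) * (norm (X x) * \<omega> x)) \<le> 1 * ((1 + 2 * C) * ((c + norm (d\<eta> x)) * \<omega> x))"
        using \<theta> nX \<omega>0[of x] \<open>C \<ge> 0\<close> by (intro mult_mono[of \<theta> 1] mult_left_mono mult_right_mono) auto
      also have "\<dots> = (1 + 2 * C) * (c * P x + N x)"
        using xE by (simp add: P_def N_def algebra_simps)
      finally show ?thesis by simp
    qed
  qed
  have bE: "E \<inter> ball p r \<in> sets borel" using open_pos_set[OF \<Omega>] E_def by auto
  have P: "integrable lborel P"
    unfolding P_def by (rule integrable_indicator_mult_continuous[OF c\<omega> bE]) (simp add: bounded_Int)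
  have N: "integrable lborel N"
    unfolding N_def by (rule integrable_indicator_mult_continuous) (auto intro!: continuous_intros \<eta>(2) c\<omega>)
  have qf: "integrable lborel (\<lambda>x. q x * f x * \<omega> x / k)"
    by (rule integrable_continuous_compact_support[OF _ f(2)])
      (use k f(4) in \<open>auto intro!: continuous_intros cq f(1) c\<omega>\<close>)
  have "(LINT x|lborel. q x * f x * \<omega> x / k) \<le> (LINT x|lborel. W x + (1 + 2 * C) * (c * P x + N x))"
    by (rule integral_mono[OF qf _ pt]) (use W P N in auto)
  also have "\<dots> = (LINT x|lborel. W x) + (1 + 2 * C) * (c * (LINT x|lborel. P x) + (LINT x|lborel. N x))"
    using W P N by simp
  also have "\<dots> \<le> (1 + 2 * C) * (c * (LINT x|lborel. P x) + (LINT x|lborel. N x))" using W by simp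
  finally have "(LINT x|lborel. q x * f x * \<omega> x) \<le> k * ((1 + 2 * C) * (c * (LINT x|lborel. P x) + (LINT x|lborel. N x)))"
    using k by (simp add: pos_divide_le_eq mult.commute)
  then show ?thesis by (simp add: k_def q_def P_def N_def \<omega>_def mult.assoc)
qed

section \<open>Decay of the weighted volume\<close>

text \<open>
  Along the radii \<open>R / 2 * (1 + 2 powr (- k))\<close> the volume decays like \<open>2 powr (- k D)\<close> times a power of
  \<open>R\<close>: choosing \<open>l\<close> proportional to \<open>2 powr (- k)\<close> makes the factor \<open>K * l / (r - s)\<close> equal to
  \<open>2 powr (- D)\<close> in every step, and this reproduces the smallness assumption at the next radius.
\<close>

lemma de_giorgi_iteration:
  fixes V :: "real \<Rightarrow> real"
  assumes pos: "\<And>r. 0 \<le> V r" and mono: "\<And>s r. s \<le> r \<Longrightarrow> V s \<le> V r"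
    and "K > 0" "R > 0" "D > 0"
    and decay: "\<And>s r l. 0 < s \<Longrightarrow> s < r \<Longrightarrow> r \<le> R \<Longrightarrow> 0 < l \<Longrightarrow> V r \<le> l powr D \<Longrightarrow> V s \<le> K * l / (r - s) * V r"
    and small: "V R \<le> (2 powr (- D) / (4 * K) * R) powr D"
  shows "V (R / 2) = 0"
proof -
  define \<kappa> where "\<kappa> = 2 powr (- D) / (4 * K)"
  have \<kappa>: "\<kappa> > 0" using \<open>K > 0\<close> by (simp add: \<kappa>_def)
  define r where "r k = R / 2 * (1 + (1/2) ^ k)" for k :: nat
  have main: "V (r k) \<le> (\<kappa> * R * (1/2) ^ k) powr D" for k
  proof (induction k)
    case 0
    then show ?case using small by (simp add: r_def \<kappa>_def)
  next
    case (Suc k)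
    define l where "l = \<kappa> * R * (1/2) ^ k"
    have l: "l > 0" using \<kappa> \<open>R > 0\<close> by (simp add: l_def)
    have d: "r k - r (Suc k) = R * (1/2) ^ k / 4" by (simp add: r_def algebra_simps)
    have p1: "(1/2 :: real) ^ k \<le> 1" by (simp add: power_le_one)
    have "0 < R * (1/2) ^ k / 4" using \<open>R > 0\<close> by simp
    then have "r (Suc k) < r k" using d by linarith
    moreover have "r k \<le> R" using p1 \<open>R > 0\<close> unfolding r_def by (simp add: field_simps)
    moreover have "0 < r (Suc k)" using \<open>R > 0\<close> by (simp add: r_def add_pos_pos)
    ultimately have "V (r (Suc k)) \<le> K * l / (r k - r (Suc k)) * V (r k)"
      using decay l Suc by (simp add: l_def)
    also have "K * l / (r k - r (Suc k)) = 2 powr (- D)"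
      unfolding d l_def \<kappa>_def using \<open>K > 0\<close> \<open>R > 0\<close> by (simp add: field_simps)
    also have "2 powr (- D) * V (r k) \<le> (1/2) powr D * l powr D"
      using divide_right_mono[OF Suc, of "2 powr D"] by (simp add: l_def powr_minus_divide powr_divide)
    also have "\<dots> = (\<kappa> * R * (1/2) ^ Suc k) powr D"
      using l by (simp add: powr_mult[symmetric] l_def mult_ac)
    finally show ?case .
  qed
  have lim: "(\<lambda>k. (\<kappa> * R * (1/2) ^ k) powr D) \<longlonglongrightarrow> (\<kappa> * R * 0) powr D"
    using \<open>D > 0\<close> \<kappa> \<open>R > 0\<close>
    by (intro tendsto_powr' tendsto_intros LIMSEQ_power_zero) (auto intro!: always_eventually)
  have "V (R / 2) \<le> (\<kappa> * R * (1/2) ^ k) powr D" for k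
    using mono[of "R / 2" "r k"] main[of k] \<open>R > 0\<close> by (auto simp: r_def)
  then have "V (R / 2) \<le> (\<kappa> * R * 0) powr D"
    using LIMSEQ_le_const[OF lim] by blast
  then show ?thesis using pos[of "R / 2"] by simp
qed

lemma weight_le_1:
  fixes p :: "real^2"
  assumes "p$2 = 0" "r \<le> 1" "0 < \<gamma>" "x \<in> ball p r"
  shows "\<bar>x$2\<bar> \<le> r" "\<bar>x$2\<bar> powr \<gamma> \<le> 1"
proof -
  show "\<bar>x$2\<bar> \<le> r"
    using assms component_le_norm_cart[of "x - p" 2] by (simp add: dist_norm norm_minus_commute)
  then show "\<bar>x$2\<bar> powr \<gamma> \<le> 1" using assms powr_le1[of \<gamma> "\<bar>x$2\<bar>"] by simp
qed

lemma exhaust_by_compact_functions: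
  fixes F :: "'a::euclidean_space set"
  assumes "open F" "bounded F"
  obtains f :: "nat \<Rightarrow> 'a \<Rightarrow> real" and K :: "nat \<Rightarrow> 'a set" where
    "\<And>n. continuous_on UNIV (f n)" "\<And>n. compact (K n)" "\<And>n. K n \<subseteq> F" "\<And>n x. x \<notin> K n \<Longrightarrow> f n x = 0"
    "\<And>n x. 0 \<le> f n x" "\<And>n x. f n x \<le> 1" "\<And>x. (\<lambda>n. f n x) \<longlonglongrightarrow> indicator F x"
proof -
  have ne: "- F \<noteq> {}"
  proof
    assume "- F = {}"
    then have "F = UNIV" by blast
    then show False using assms(2) not_bounded_UNIV by blast
  qed
  have cl: "closed (- F)" using assms(1) by (simp add: closed_def)
  define d where "d x = infdist x (- F)" for x
  have dc: "continuous_on S d" for S unfolding d_def by (intro continuous_intros)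
  have dpos: "d x > 0 \<longleftrightarrow> x \<in> F" for x
    using in_closed_iff_infdist_zero[OF cl ne, of x] infdist_nonneg[of x "- F"] by (auto simp: d_def less_le)
  have d0: "d x \<ge> 0" for x by (simp add: d_def infdist_nonneg)
  define f where "f n x = min 1 (max 0 (real n * d x - 1))" for n x
  define K where "K n = {x. 1 \<le> real n * d x}" for n
  have KF: "K n \<subseteq> F" for n 
  proof
    fix x assume "x \<in> K n"
    then have "d x \<noteq> 0" by (auto simp: K_def)
    then show "x \<in> F" using dpos[of x] d0[of x] by linarith
  qed
  have "closed (K n)" for n unfolding K_def by (intro closed_Collect_le continuous_intros dc)
  then have "compact (K n)" for n using bounded_subset[OF assms(2) KF] compact_eq_bounded_closed by blast
  moreover have "(\<lambda>n. f n x) \<longlonglongrightarrow> indicator F x" for x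
  proof (cases "x \<in> F")
    case True
    then have "d x > 0" using dpos by blast
    obtain N :: nat where N: "2 / d x \<le> real N" using real_arch_simple by blast
    have "f n x = 1" if "n \<ge> N" for n
    proof -
      have "2 / d x \<le> real n" using N that by (meson of_nat_mono order_trans)
      then have "2 \<le> real n * d x" using \<open>d x > 0\<close> by (simp add: pos_divide_le_eq)
      then show ?thesis by (simp add: f_def)
    qed
    then have "\<forall>\<^sub>F n in sequentially. f n x = indicator F x"
      using True by (auto simp: eventually_sequentially)
    then show ?thesis by (rule tendsto_eventually)
  next
    case False
    then have "d x = 0" using dpos[of x] d0[of x] by linarith
    then show ?thesis using False by (simp add: f_def)
  qed
  moreover have "continuous_on UNIV (f n)" for n unfolding f_def by (intro continuous_intros dc)
  moreover have "f n x = 0" if "x \<notin> K n" for n x using that by (simp add: f_def K_def)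
  ultimately show thesis using that[of f K] KF by (auto simp: f_def)
qed

text \<open>
  The previous inequality with \<open>\<eta>\<close> from \<open>degenerate_cutoff\<close>, whose cost \<open>\<rho>\<close> is sent to \<open>0\<close>, and with
  \<open>f\<close> increasing to the indicator function of \<open>E \<inter> ball p r\<close>.
\<close>

lemma weighted_volume_decay:
  fixes u :: "real^2 \<Rightarrow> real" and p :: "real^2" and E :: "(real^2) set" and \<gamma> :: real
  defines "V \<equiv> \<lambda>r. (LINT x|lborel. indicator (E \<inter> ball p r) x * \<bar>x$2\<bar> powr \<gamma>)"
  assumes "\<gamma> > 0" and \<Omega>: "open \<Omega>" "continuous_on \<Omega> u" and E_def: "E = pos_set \<Omega> u" and harm: "harmonic_on E u"
    and "C \<ge> 0" and p: "p$2 = 0" and s: "0 < s" "s < r" "r \<le> 1" and sub: "cball p r \<subseteq> \<Omega>"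
    and gb: "\<And>x. x \<in> E \<Longrightarrow> x \<in> ball p r \<Longrightarrow> norm (grad u x) \<le> C * \<bar>x$2\<bar> powr \<gamma>"
    and reg: "\<And>\<tau>. \<tau> > 0 \<Longrightarrow> \<exists>R. openin (top_of_set (frontier E)) R \<and>
        hausdorff_measure 1 (frontier E \<inter> \<Omega> \<inter> {x. \<bar>x$2\<bar> > \<tau>} - R) = 0 \<and>
        (\<forall>x0\<in>R. \<exists>V G. open V \<and> x0 \<in> V \<and> C1_up_to_boundary V E u G \<and> norm (G x0) = \<bar>x0$2\<bar> powr \<gamma>)"
    and "l > 0" and l: "V r \<le> l powr (2 + \<gamma>)"
  shows "V s \<le> 12 * (1 + 2 * C) * l / (r - s) * V r"
proof -
  define \<omega> where "\<omega> x = \<bar>x$2\<bar> powr \<gamma>" for x :: "real^2"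
  have c\<omega>: "continuous_on S \<omega>" for S unfolding \<omega>_def using \<open>\<gamma> > 0\<close> by (rule continuous_on_weight)
  have \<omega>0: "0 \<le> \<omega> x" for x by (simp add: \<omega>_def)
  have \<omega>1: "\<omega> x \<le> 1" if "x \<in> ball p r" for x
    unfolding \<omega>_def using weight_le_1[OF p s(3) \<open>\<gamma> > 0\<close> that] by simp
  have r0: "0 < r" using s by simp
  define v where "v = V r"
  define F where "F = E \<inter> ball p r"
  have oE: "open E" using open_pos_set[OF \<Omega>] E_def by simp
  then have F: "open F" "bounded F" by (auto simp: F_def bounded_Int)
  have Fi: "integrable lborel (\<lambda>x. indicator F x * \<omega> x)"
    by (rule integrable_indicator_mult_continuous[OF c\<omega> _ F(2)]) (use F(1) in simp)
  have v: "v = (LINT x|lborel. indicator F x * \<omega> x)" by (simp add: v_def V_def F_def \<omega>_def)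
  obtain \<phi> d\<phi> where \<phi>: "\<And>x. GDERIV \<phi> x :> d\<phi> x" "continuous_on UNIV d\<phi>" "\<And>x. 0 \<le> \<phi> x" "\<And>x. \<phi> x \<le> 1"
    "\<And>x. x \<in> ball p s \<Longrightarrow> \<phi> x = 1" "\<And>x. x \<notin> ball p r \<Longrightarrow> \<phi> x = 0" "\<And>x. x \<notin> ball p r \<Longrightarrow> d\<phi> x = 0"
    "\<And>x. norm (d\<phi> x) \<le> 4 / (r - s)"
  proof (rule radial_cutoff[OF s(1,2), of p], goal_cases)
    case (1 \<phi> d\<phi>)
    show ?case by (rule 1(1)[OF 1(2-)])
  qed
  note c\<phi> = GDERIV_continuous[OF \<phi>(1)]
  define M where "M = 3 * l * (1 + 2 * C)"
  have M: "M > 0" using \<open>l > 0\<close> \<open>C \<ge> 0\<close> by (simp add: M_def)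
  have "\<forall>\<delta>. \<exists>R. \<delta> > 0 \<longrightarrow> openin (top_of_set (frontier E)) R \<and>
        hausdorff_measure 1 (frontier E \<inter> \<Omega> \<inter> {x. \<bar>x$2\<bar> > \<delta> / 2} - R) = 0 \<and>
        (\<forall>x0\<in>R. \<exists>V G. open V \<and> x0 \<in> V \<and> C1_up_to_boundary V E u G \<and> norm (G x0) = \<bar>x0$2\<bar> powr \<gamma>)"
    using reg by (metis half_gt_zero)
  then obtain Reg where Reg: "\<And>\<delta>. \<delta> > 0 \<Longrightarrow> openin (top_of_set (frontier E)) (Reg \<delta>)"
        "\<And>\<delta>. \<delta> > 0 \<Longrightarrow> hausdorff_measure 1 (frontier E \<inter> \<Omega> \<inter> {x. \<bar>x$2\<bar> > \<delta> / 2} - Reg \<delta>) = 0"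
        "\<And>\<delta> x0. \<delta> > 0 \<Longrightarrow> x0\<in>Reg \<delta> \<Longrightarrow> \<exists>V G. open V \<and> x0 \<in> V \<and> C1_up_to_boundary V E u G \<and> norm (G x0) = \<bar>x0$2\<bar> powr \<gamma>"
    by metis
  have clos: "closed {x::real^2. \<delta> \<le> \<bar>x$2\<bar>}" for \<delta>
    by (intro closed_Collect_le continuous_intros)
  \<comment> \<open>The regular set of level \<open>\<delta> / 2\<close> is used at heights \<open>\<bar>x\<^sub>2\<bar> \<ge> \<delta>\<close>: the weak inequality makes
     what it misses closed, the smaller level makes it a null set.\<close>
  define S where "S \<delta> = frontier E \<inter> cball p r \<inter> {x. \<delta> \<le> \<bar>x$2\<bar>} - Reg \<delta>" for \<delta>
  have S: "compact (S \<delta>) \<and> hausdorff_measure 1 (S \<delta>) = 0" if \<delta>: "\<delta> > 0" for \<delta>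
  proof
    obtain T where T: "open T" "Reg \<delta> = frontier E \<inter> T" using Reg(1)[OF \<delta>] unfolding openin_open by blast
    have "S \<delta> = cball p r \<inter> (frontier E \<inter> {x. \<delta> \<le> \<bar>x$2\<bar>} \<inter> - T)" by (auto simp: S_def T(2))
    then show "compact (S \<delta>)" using T(1) clos by (auto intro!: compact_Int_closed closed_Int)
    have "S \<delta> \<subseteq> frontier E \<inter> \<Omega> \<inter> {x. \<bar>x$2\<bar> > \<delta> / 2} - Reg \<delta>" using sub \<delta> by (auto simp: S_def)
    from hausdorff_measure_mono[OF this, of 1] show "hausdorff_measure 1 (S \<delta>) = 0" using Reg(2)[OF \<delta>] by simp
  qed
  have step1: "(LINT x|lborel. \<phi> x * f x * \<omega> x) \<le> M * (4 / (r - s) * v)"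
    if f: "continuous_on UNIV f" "compact K" "K \<subseteq> F" "\<And>x. x \<notin> K \<Longrightarrow> f x = 0" "\<And>x. 0 \<le> f x" "\<And>x. f x \<le> 1" for f K
  proof (rule field_le_epsilon)
    fix e :: real assume "e > 0"
    define \<rho> where "\<rho> = e / (M + 1)"
    have \<rho>: "\<rho> > 0" using \<open>e > 0\<close> M by (simp add: \<rho>_def)
    obtain \<delta> \<eta> d\<eta> U where \<delta>: "\<delta> > 0" and \<eta>: "\<And>x. GDERIV \<eta> x :> d\<eta> x" "continuous_on UNIV d\<eta>"
      "\<And>x. 0 \<le> \<eta> x" "\<And>x. \<eta> x \<le> 1" and U: "open U" "S \<delta> \<subseteq> U" "\<And>x. x \<in> U \<Longrightarrow> \<eta> x = 0"
      "\<And>x. \<bar>x$2\<bar> \<le> \<delta> \<Longrightarrow> \<eta> x = 0"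
      and small: "(LINT x|lborel. indicator (ball p r) x * (1 - \<eta> x)) \<le> \<rho>"
      "(LINT x|lborel. indicator (ball p r) x * (norm (d\<eta> x) * \<bar>x$2\<bar> powr \<gamma>)) \<le> \<rho>"
    proof (rule degenerate_cutoff[where S = S, OF \<open>\<gamma> > 0\<close> \<rho> r0 s(3) p], goal_cases)
      case (1 \<delta>)
      show ?case by (rule S[OF 1(2)])
    next
      case (2 \<delta> \<eta> d\<eta> U)
      show ?case by (rule 2(1)[OF 2(2-)])
    qed
    note c\<eta> = GDERIV_continuous[OF \<eta>(1)]
    define C0 where "C0 = cball p r \<inter> (- U \<inter> {x. \<delta> \<le> \<bar>x$2\<bar>})"
    have C0: "compact C0" "C0 \<subseteq> \<Omega>" "\<And>x. x \<in> C0 \<Longrightarrow> x$2 \<noteq> 0"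
      using U(1) clos sub \<delta> by (auto simp: C0_def intro!: compact_Int_closed closed_Int)
    have C0': "\<eta> x * \<phi> x = 0" if "x \<notin> C0" for x
    proof -
      have "x \<notin> cball p r \<or> x \<in> U \<or> \<not> \<delta> \<le> \<bar>x$2\<bar>" using that unfolding C0_def by blast
      then show ?thesis
        using \<phi>(6)[of x] U(3)[of x] U(4)[of x] by (elim disjE) auto
    qed
    have regC: "\<exists>V G. open V \<and> x0 \<in> V \<and> C1_up_to_boundary V E u G \<and> norm (G x0) = \<bar>x0$2\<bar> powr \<gamma>"
      if "x0 \<in> C0" "x0 \<in> frontier E" for x0
      using that U(2) by (intro Reg(3)[OF \<delta>]) (auto simp: C0_def S_def)
    obtain \<epsilon>1 where \<epsilon>1: "\<epsilon>1 > 0" "\<And>x. x \<in> C0 \<Longrightarrow> x \<in> E \<Longrightarrow> u x < \<epsilon>1 \<Longrightarrow> \<bar>x$2\<bar> powr \<gamma> \<le> 2 * norm (grad u x)"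
    proof (rule gradient_lower_bound_near_free_boundary[where \<gamma> = \<gamma>, OF \<Omega> E_def C0(1,2)], goal_cases)
      case (1 x)
      show ?case by (rule C0(3)[OF 1(2)])
    next
      case (2 x)
      show ?case by (rule regC[OF 2(2,3)])
    next
      case (3 \<epsilon>)
      show ?case by (rule 3(1)[OF 3(2-)])
    qed
    obtain \<epsilon>2 where \<epsilon>2: "\<epsilon>2 > 0" "\<And>x. x \<in> K \<Longrightarrow> \<epsilon>2 \<le> u x"
    proof (cases "K = {}")
      case True
      then show thesis using that[of 1] by simp
    next
      case False
      have KE: "K \<subseteq> E" using f(3) by (auto simp: F_def)
      then have "continuous_on K u" using harmonic_on_continuous(1)[OF harm] continuous_on_subset by blast
      then obtain z where z: "z \<in> K" "\<And>x. x \<in> K \<Longrightarrow> u z \<le> u x"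
        using continuous_attains_inf[OF f(2) False] by blast
      then show thesis using that[of "u z"] KE by (auto simp: E_def pos_set_def)
    qed
    define \<epsilon> where "\<epsilon> = min \<epsilon>1 \<epsilon>2"
    have \<epsilon>: "\<epsilon> > 0" "\<And>x. x \<in> C0 \<Longrightarrow> x \<in> E \<Longrightarrow> u x < \<epsilon> \<Longrightarrow> \<bar>x$2\<bar> powr \<gamma> \<le> 2 * norm (grad u x)"
      "\<And>x. x \<in> K \<Longrightarrow> \<epsilon> \<le> u x"
      using \<epsilon>1 \<epsilon>2 by (auto simp: \<epsilon>_def min_le_iff_disj)
    have fi: "integrable lborel (\<lambda>x. f x * \<omega> x)"
      by (rule integrable_continuous_compact_support[OF _ f(2)]) (auto intro!: continuous_intros f(1) c\<omega> simp: f(4))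
    have "(LINT x|lborel. f x * \<omega> x) \<le> (LINT x|lborel. indicator F x * \<omega> x)"
    proof (rule integral_mono[OF fi Fi])
      show "f x * \<omega> x \<le> indicator F x * \<omega> x" for x
      proof (rule mult_right_mono[OF _ \<omega>0])
        show "f x \<le> indicator F x"
        proof (cases "x \<in> F")
          case False
          then have "x \<notin> K" using f(3) by blast
          then show ?thesis using f(4) False by simp
        qed (use f(6) in simp)
      qed
    qed
    also have "\<dots> \<le> l powr (2 + \<gamma>)" using l v by (simp add: v_def)
    finally have fl: "(LINT x|lborel. f x * \<bar>x$2\<bar> powr \<gamma>) \<le> l powr (2 + \<gamma>)" by (simp add: \<omega>_def)
    have "(LINT x|lborel. \<eta> x * \<phi> x * f x * \<omega> x) \<le> M * (4 / (r - s) * v +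
      (LINT x|lborel. indicator (ball p r) x * (norm (d\<eta> x) * \<bar>x$2\<bar> powr \<gamma>)))"
      using calibrated_flux_inequality[OF \<open>\<gamma> > 0\<close> \<Omega> E_def harm \<open>C \<ge> 0\<close> gb \<phi>(1-4,6-8) \<eta> C0 C0' \<epsilon>(1,2)
          f(1,2) f(3)[unfolded F_def] f(4-6) \<epsilon>(3) \<open>l > 0\<close> fl]
      by (simp add: M_def v F_def \<omega>_def)
    also have "\<dots> \<le> M * (4 / (r - s) * v + \<rho>)" using small(2) M by simp
    finally have 1: "(LINT x|lborel. \<eta> x * \<phi> x * f x * \<omega> x) \<le> M * (4 / (r - s) * v + \<rho>)" .
    have i1: "integrable lborel (\<lambda>x. \<phi> x * f x * \<omega> x)" "integrable lborel (\<lambda>x. \<eta> x * \<phi> x * f x * \<omega> x)"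
      by (rule integrable_continuous_compact_support[OF _ f(2)]; auto intro!: continuous_intros f(1) c\<omega> c\<phi> c\<eta> simp: f(4))+
    have i2: "integrable lborel (\<lambda>x. indicator (ball p r) x * (1 - \<eta> x))"
      by (rule integrable_indicator_mult_continuous) (auto intro!: continuous_intros c\<eta>)
    have "(LINT x|lborel. \<phi> x * f x * \<omega> x) \<le> (LINT x|lborel. \<eta> x * \<phi> x * f x * \<omega> x + indicator (ball p r) x * (1 - \<eta> x))"
    proof (rule integral_mono[OF i1(1) Bochner_Integration.integrable_add[OF i1(2) i2]])
      fix x
      show "\<phi> x * f x * \<omega> x \<le> \<eta> x * \<phi> x * f x * \<omega> x + indicator (ball p r) x * (1 - \<eta> x)"
      proof (cases "x \<in> ball p r")
        case True
        have "0 \<le> \<phi> x * f x * \<omega> x" using \<phi>(3)[of x] f(5)[of x] \<omega>0[of x] by simp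
        moreover have "\<phi> x * f x * \<omega> x \<le> 1"
          using \<phi>(3,4)[of x] f(5,6)[of x] \<omega>0[of x] \<omega>1[OF True] by (simp add: mult_le_one)
        ultimately have "(1 - \<eta> x) * (\<phi> x * f x * \<omega> x) \<le> (1 - \<eta> x) * 1"
          using \<eta>(4)[of x] by (intro mult_left_mono) auto
        then show ?thesis using True by (simp add: algebra_simps)
      qed (use \<phi>(6) in simp)
    qed
    also have "\<dots> \<le> M * (4 / (r - s) * v + \<rho>) + \<rho>"
      using 1 small(1) i1 i2 by simp
    also have "\<dots> = M * (4 / (r - s) * v) + (M + 1) * \<rho>" by (simp add: algebra_simps)
    also have "(M + 1) * \<rho> = e" using M by (simp add: \<rho>_def)
    finally show "(LINT x|lborel. \<phi> x * f x * \<omega> x) \<le> M * (4 / (r - s) * v) + e" .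
  qed
  obtain f :: "nat \<Rightarrow> real^2 \<Rightarrow> real" and K where f: "\<And>n. continuous_on UNIV (f n)" "\<And>n. compact (K n)" "\<And>n. K n \<subseteq> F" "\<And>n x. x \<notin> K n \<Longrightarrow> f n x = 0"
    "\<And>n x. 0 \<le> f n x" "\<And>n x. f n x \<le> 1" "\<And>x. (\<lambda>n. f n x) \<longlonglongrightarrow> indicator F x"
  proof (rule exhaust_by_compact_functions[OF F], goal_cases)
    case (1 f K)
    show ?case by (rule 1(1)[OF 1(2-)])
  qed
  have fm: "integrable lborel (\<lambda>x. \<phi> x * f n x * \<omega> x)" for n
    by (rule integrable_continuous_compact_support[OF _ f(2)[of n]]) (auto intro!: continuous_intros f(1) c\<omega> c\<phi> simp: f(4))
  have \<phi>i: "integrable lborel (\<lambda>x. indicator F x * (\<phi> x * \<omega> x))"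
    by (rule integrable_indicator_mult_continuous[OF _ _ F(2)]) (use F(1) in \<open>auto intro!: continuous_intros c\<omega> c\<phi>\<close>)
  have "(\<lambda>n. LINT x|lborel. \<phi> x * f n x * \<omega> x) \<longlonglongrightarrow> (LINT x|lborel. indicator F x * (\<phi> x * \<omega> x))"
  proof (rule integral_dominated_convergence)
    show "integrable lborel (\<lambda>x. indicator F x * (\<phi> x * \<omega> x))" by (rule \<phi>i)
    show "AE x in lborel. (\<lambda>n. \<phi> x * f n x * \<omega> x) \<longlonglongrightarrow> indicator F x * (\<phi> x * \<omega> x)"
    proof (rule AE_I2)
      fix x
      have "(\<lambda>n. f n x * (\<phi> x * \<omega> x)) \<longlonglongrightarrow> indicator F x * (\<phi> x * \<omega> x)"
        by (intro tendsto_intros f(7))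
      then show "(\<lambda>n. \<phi> x * f n x * \<omega> x) \<longlonglongrightarrow> indicator F x * (\<phi> x * \<omega> x)" by (simp add: mult_ac)
    qed
    show "AE x in lborel. norm (\<phi> x * f n x * \<omega> x) \<le> indicator F x * (\<phi> x * \<omega> x)" for n
    proof (rule AE_I2)
      fix x
      have "f n x \<le> indicator F x"
      proof (cases "x \<in> F")
        case False
        then have "x \<notin> K n" using f(3) by blast
        then show ?thesis using f(4) False by simp
      qed (use f(6) in simp)
      then have "f n x * (\<phi> x * \<omega> x) \<le> indicator F x * (\<phi> x * \<omega> x)"
        using \<phi>(3)[of x] \<omega>0[of x] by (intro mult_right_mono) auto
      then show "norm (\<phi> x * f n x * \<omega> x) \<le> indicator F x * (\<phi> x * \<omega> x)"
        using \<phi>(3)[of x] \<omega>0[of x] f(5)[of n x] by (simp add: abs_mult mult_ac)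
    qed
  qed (use fm \<phi>i in auto)
  then have lim: "(LINT x|lborel. indicator F x * (\<phi> x * \<omega> x)) \<le> M * (4 / (r - s) * v)"
    by (rule LIMSEQ_le_const2) (use step1[OF f(1-6)] in blast)
  have "E \<inter> ball p s \<in> sets borel" using oE by simp
  then have si: "integrable lborel (\<lambda>x. indicator (E \<inter> ball p s) x * \<omega> x)"
    by (rule integrable_indicator_mult_continuous[OF c\<omega>]) (simp add: bounded_Int)
  have "V s = (LINT x|lborel. indicator (E \<inter> ball p s) x * \<omega> x)" by (simp add: V_def \<omega>_def)
  also have "\<dots> \<le> (LINT x|lborel. indicator F x * (\<phi> x * \<omega> x))"
  proof (rule integral_mono[OF si \<phi>i])
    fix x
    have "x \<in> ball p s \<Longrightarrow> x \<in> ball p r" using s by simp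
    then show "indicator (E \<inter> ball p s) x * \<omega> x \<le> indicator F x * (\<phi> x * \<omega> x)"
      using \<phi>(3,5)[of x] \<omega>0[of x] by (auto simp: indicator_def F_def)
  qed
  also have "\<dots> \<le> M * (4 / (r - s) * v)" by (rule lim)
  also have "\<dots> = 12 * (1 + 2 * C) * l / (r - s) * V r" by (simp add: M_def v_def mult_ac)
  finally show ?thesis .
qed

section \<open>Points of density zero\<close>

lemma weighted_volume_le:
  fixes p :: "real^2"
  assumes "\<gamma> > 0" "p$2 = 0" "0 < r" "r \<le> 1" "open E"
  shows "(LINT x|lborel. indicator (E \<inter> ball p r) x * \<bar>x$2\<bar> powr \<gamma>) \<le> r powr \<gamma> * measure lborel (E \<inter> ball p r)"
proof (rule integral_le_const_mult_measure)
  have m: "E \<inter> ball p r \<in> sets borel" using assms(5) by simp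
  show "integrable lborel (\<lambda>x. indicator (E \<inter> ball p r) x * \<bar>x$2\<bar> powr \<gamma>)"
    by (rule integrable_indicator_mult_continuous[OF continuous_on_weight[OF assms(1)] m]) (simp add: bounded_Int)
  show "indicator (E \<inter> ball p r) x * \<bar>x$2\<bar> powr \<gamma> \<le> r powr \<gamma> * indicator (E \<inter> ball p r) x" for x :: "real^2"
    using weight_le_1(1)[OF assms(2,4,1), of x] assms by (auto simp: indicator_def intro!: powr_mono2)
qed (use assms in \<open>auto simp: bounded_Int\<close>)

lemma density_0_imp_small_measure:
  fixes p :: "real^2"
  assumes "has_density E p 0" "open E" "c > 0"
  shows "\<forall>\<^sub>F r in at_right 0. measure lborel (E \<inter> ball p r) \<le> c * r\<^sup>2"
proof -
  define e where "e = c / (4 * pi)"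
  have e: "e > 0" using assms(3) by (simp add: e_def)
  have "\<forall>\<^sub>F r in at_right 0. hausdorff_measure 2 (ball p r \<inter> E) / ennreal (pi * r\<^sup>2) < ennreal e"
    using assms(1) e unfolding has_density_def by (intro order_tendstoD(2)[of _ 0]) auto
  then show ?thesis
    using eventually_at_right_less[of "0::real"]
  proof eventually_elim
    case (elim r)
    have b: "pi * r\<^sup>2 > 0" using elim by simp
    have "hausdorff_measure 2 (ball p r \<inter> E) = ennreal (pi * r\<^sup>2) * (hausdorff_measure 2 (ball p r \<inter> E) / ennreal (pi * r\<^sup>2))"
    proof -
      have "ennreal (pi * r\<^sup>2) \<noteq> 0" using b by (metis ennreal_eq_0_iff not_le)
      from mult_divide_eq_ennreal[OF this] show ?thesis
        by (simp only: ennreal_times_divide mult.commute[of "ennreal (pi * r\<^sup>2)"] ennreal_neq_top not_False_eq_True)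
    qed
    also have "\<dots> \<le> ennreal (pi * r\<^sup>2) * ennreal e"
      using elim by (intro mult_left_mono) auto
    also have "\<dots> = ennreal (pi * r\<^sup>2 * e)" using e by (simp add: ennreal_mult)
    finally have h: "hausdorff_measure 2 (ball p r \<inter> E) \<le> ennreal (pi * r\<^sup>2 * e)" .
    have "emeasure lborel (ball p r \<inter> E) \<le> 4 * hausdorff_measure 2 (ball p r \<inter> E)"
      using assms(2) by (intro emeasure_lborel_le_hausdorff_measure_2) simp
    also have "\<dots> \<le> ennreal 4 * ennreal (pi * r\<^sup>2 * e)" using h by (intro mult_mono) auto
    also have "\<dots> = ennreal (4 * (pi * r\<^sup>2 * e))" using b e by (subst ennreal_mult) auto
    also have "4 * (pi * r\<^sup>2 * e) = c * r\<^sup>2" by (simp add: e_def)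
    finally have "emeasure lborel (ball p r \<inter> E) \<le> ennreal (c * r\<^sup>2)" .
    moreover have "emeasure lborel (ball p r \<inter> E) = ennreal (measure lborel (ball p r \<inter> E))"
      by (intro emeasure_eq_ennreal_measure) (use emeasure_bounded_finite[of "ball p r \<inter> E"] in \<open>simp add: bounded_Int less_top\<close>)
    ultimately show ?case using assms(3) by (simp add: Int_commute)
  qed
qed

theorem theorem1p2:
  fixes \<gamma> :: real and \<Omega> :: "(real^2) set"
    and u :: "real^2 \<Rightarrow> real" and Du :: "real^2 \<Rightarrow> real^2"
  assumes "\<gamma> > 0"
    and "open \<Omega>"
    and "weak_solution \<gamma> \<Omega> u"
    and "weak_gradient \<Omega> u Du"
    and "\<forall>x. vector [x, 0] \<in> \<Omega> \<longrightarrow>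
      (\<exists>K C. vector [x, 0] \<in> interior K \<and> compact (closure K) \<and> closure K \<subseteq> \<Omega> \<and>
        (AE y in lebesgue. y \<in> K \<longrightarrow> norm (Du y) \<le> C * \<bar>y$2\<bar> powr \<gamma>))"
  shows "cusps \<Omega> u = {}"
proof (rule ccontr)
  assume "cusps \<Omega> u \<noteq> {}"
  then obtain p where "p \<in> cusps \<Omega> u" by blast
  define E where "E = pos_set \<Omega> u"
  have p: "p \<in> frontier E" "p$2 = 0" "p \<in> \<Omega>" "has_density E p 0"
    using \<open>p \<in> cusps \<Omega> u\<close> by (auto simp: cusps_def degenerate_set_def E_def)
  have pv: "vector [p$1, 0] = p" using p(2) by (simp add: vec_eq_iff forall_2)
  obtain K C0 where K: "p \<in> interior K" "closure K \<subseteq> \<Omega>"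
    "AE y in lebesgue. y \<in> K \<longrightarrow> norm (Du y) \<le> C0 * \<bar>y$2\<bar> powr \<gamma>"
    using assms(5)[rule_format, of "p$1"] p(3) unfolding pv by blast
  have u: "continuous_on \<Omega> u" "harmonic_on E u" and
    ws: "\<And>\<tau>. \<tau> > 0 \<Longrightarrow> \<exists>R. openin (top_of_set (frontier E)) R \<and>
        hausdorff_measure 1 (frontier E \<inter> \<Omega> \<inter> {x. \<bar>x$2\<bar> > \<tau>} - R) = 0 \<and>
        (\<forall>x0\<in>R. \<exists>V G. open V \<and> x0 \<in> V \<and> V \<subseteq> \<Omega> \<and> C1_up_to_boundary V E u G \<and>
           (\<forall>x \<in> V \<inter> R. (norm (G x))\<^sup>2 = \<bar>x$2\<bar> powr (2 * \<gamma>)))"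
    using assms(3) unfolding weak_solution_def E_def by blast+
  have oE: "open E" using open_pos_set[OF assms(2) u(1)] by (simp add: E_def)
  have EO: "E \<subseteq> \<Omega>" by (auto simp: E_def pos_set_def)
  define C where "C = max C0 0"
  have "C \<ge> 0" by (simp add: C_def)
  have le: "AE y in lebesgue. y \<in> K \<longrightarrow> norm (Du y) \<le> C * \<bar>y$2\<bar> powr \<gamma>"
    using K(3)
  proof eventually_elim
    case (elim y)
    have "C0 * \<bar>y$2\<bar> powr \<gamma> \<le> C * \<bar>y$2\<bar> powr \<gamma>" by (intro mult_right_mono) (auto simp: C_def)
    then show ?case using elim by linarith
  qed
  have wc: "continuous_on UNIV (\<lambda>y::real^2. C * \<bar>y$2\<bar> powr \<gamma>)"
    by (intro continuous_intros continuous_on_weight assms(1))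
  note gb = norm_grad_le_of_weak_gradient_bound[OF oE EO u(2) assms(4) le wc]
  obtain R0 where R0: "R0 > 0" "cball p R0 \<subseteq> interior K"
    using K(1) open_contains_cball[of "interior K"] by auto
  have KO: "interior K \<subseteq> \<Omega>" using K(2) interior_subset closure_subset by blast
  have reg: "\<exists>R. openin (top_of_set (frontier E)) R \<and>
        hausdorff_measure 1 (frontier E \<inter> \<Omega> \<inter> {x. \<bar>x$2\<bar> > \<tau>} - R) = 0 \<and>
        (\<forall>x0\<in>R. \<exists>V G. open V \<and> x0 \<in> V \<and> C1_up_to_boundary V E u G \<and> norm (G x0) = \<bar>x0$2\<bar> powr \<gamma>)"
    if \<tau>: "\<tau> > 0" for \<tau>
  proof -
    obtain R where R: "openin (top_of_set (frontier E)) R"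
        "hausdorff_measure 1 (frontier E \<inter> \<Omega> \<inter> {x. \<bar>x$2\<bar> > \<tau>} - R) = 0"
        "\<And>x0. x0\<in>R \<Longrightarrow> \<exists>V G. open V \<and> x0 \<in> V \<and> V \<subseteq> \<Omega> \<and> C1_up_to_boundary V E u G \<and>
           (\<forall>x \<in> V \<inter> R. (norm (G x))\<^sup>2 = \<bar>x$2\<bar> powr (2 * \<gamma>))"
      using ws[OF \<tau>] by blast
    have "\<exists>V G. open V \<and> x0 \<in> V \<and> C1_up_to_boundary V E u G \<and> norm (G x0) = \<bar>x0$2\<bar> powr \<gamma>" if x0: "x0 \<in> R" for x0
    proof -
      obtain V G where VG: "open V" "x0 \<in> V" "C1_up_to_boundary V E u G" "\<forall>x \<in> V \<inter> R. (norm (G x))\<^sup>2 = \<bar>x$2\<bar> powr (2 * \<gamma>)"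
        using R(3)[OF x0] by blast
      have "\<bar>x0$2\<bar> powr (2 * \<gamma>) = (\<bar>x0$2\<bar> powr \<gamma>)\<^sup>2"
        by (simp add: power2_eq_square powr_add[symmetric])
      then have "(norm (G x0))\<^sup>2 = (\<bar>x0$2\<bar> powr \<gamma>)\<^sup>2" using VG(2,4) x0 by simp
      then have "norm (G x0) = \<bar>x0$2\<bar> powr \<gamma>"
        by (subst (asm) power2_eq_iff_nonneg) auto
      then show ?thesis using VG(1-3) by blast
    qed
    then show ?thesis using R(1,2) by blast
  qed
  define V where "V r = (LINT x|lborel. indicator (E \<inter> ball p r) x * \<bar>x$2\<bar> powr \<gamma>)" for r
  have Vi: "integrable lborel (\<lambda>x. indicator (E \<inter> ball p r) x * \<bar>x$2\<bar> powr \<gamma>)" for r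
    by (rule integrable_indicator_mult_continuous[OF continuous_on_weight[OF assms(1)]])
      (use oE in \<open>auto simp: bounded_Int\<close>)
  define k where "k = 12 * (1 + 2 * C)"
  have k: "k > 0" using \<open>C \<ge> 0\<close> by (simp add: k_def)
  define \<kappa> where "\<kappa> = 2 powr (- (2 + \<gamma>)) / (4 * k)"
  have \<kappa>: "\<kappa> > 0" using k by (simp add: \<kappa>_def)
  have "\<forall>\<^sub>F r in at_right 0. measure lborel (E \<inter> ball p r) \<le> \<kappa> powr (2 + \<gamma>) * r\<^sup>2"
    using density_0_imp_small_measure[OF p(4) oE] \<kappa> by simp
  moreover have "\<forall>\<^sub>F r in at_right 0. 0 < r \<and> r < min R0 1"
    using eventually_at_right_real[of 0 "min R0 1"] R0(1) by (auto elim!: eventually_mono)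
  ultimately have "\<forall>\<^sub>F r in at_right 0. measure lborel (E \<inter> ball p r) \<le> \<kappa> powr (2 + \<gamma>) * r\<^sup>2 \<and> (0 < r \<and> r < min R0 1)"
    by (rule eventually_conj)
  then obtain R where R: "measure lborel (E \<inter> ball p R) \<le> \<kappa> powr (2 + \<gamma>) * R\<^sup>2" "0 < R" "R < R0" "R < 1"
    using eventually_happens[of _ "at_right (0::real)"] by fastforce
  have "V (R / 2) = 0"
  proof (rule de_giorgi_iteration[of V k R "2 + \<gamma>"])
    show "0 \<le> V r" for r unfolding V_def by (rule Bochner_Integration.integral_nonneg) simp
    show "V s \<le> V r" if "s \<le> r" for s r
      unfolding V_def by (rule integral_mono[OF Vi Vi]) (use that in \<open>auto simp: indicator_def\<close>)
    show "V s \<le> k * l / (r - s) * V r"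
      if "0 < s" "s < r" "r \<le> R" "0 < l" "V r \<le> l powr (2 + \<gamma>)" for s r l
    proof -
      have r1: "r \<le> 1" using that(3) R(4) by simp
      have bK: "cball p r \<subseteq> interior K" using that(3) R(3) R0(2) by (meson less_imp_le order_trans subset_cball)
      then have sub: "cball p r \<subseteq> \<Omega>" using KO by blast
      have "norm (grad u x) \<le> C * \<bar>x$2\<bar> powr \<gamma>" if "x \<in> E" "x \<in> ball p r" for x
        using gb[OF that(1)] that(2) bK ball_subset_cball[of p r] by blast
      from weighted_volume_decay[OF assms(1,2) u(1) E_def u(2) \<open>C \<ge> 0\<close> p(2) that(1,2) r1 sub this reg \<open>0 < l\<close>]
      show ?thesis using that(5) by (simp add: V_def k_def)
    qed
    have "V R \<le> R powr \<gamma> * measure lborel (E \<inter> ball p R)"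
      unfolding V_def by (rule weighted_volume_le) (use assms(1) p(2) R oE in auto)
    also have "\<dots> \<le> R powr \<gamma> * (\<kappa> powr (2 + \<gamma>) * R\<^sup>2)"
      using R(1) by (intro mult_left_mono) auto
    also have "\<dots> = (\<kappa> * R) powr (2 + \<gamma>)"
      using \<kappa> R(2) by (simp add: powr_mult powr_add)
    finally show "V R \<le> (2 powr (- (2 + \<gamma>)) / (4 * k) * R) powr (2 + \<gamma>)" by (simp add: \<kappa>_def)
  qed (use k R assms(1) in auto)
  then have "AE x in lborel. indicator (E \<inter> ball p (R/2)) x * \<bar>x$2\<bar> powr \<gamma> = 0"
    unfolding V_def by (subst (asm) integral_nonneg_eq_0_iff_AE[OF Vi]) auto
  moreover define N where "N = E \<inter> ball p (R/2) \<inter> {x. x$2 \<noteq> 0}"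
  ultimately have ae: "AE x in lborel. x \<notin> N" by (auto elim!: eventually_mono)
  have "open {x::real^2. x$2 \<noteq> 0}" by (intro open_Collect_neq continuous_intros)
  then have m: "N \<in> sets borel" using oE by (auto simp: N_def)
  have "emeasure lborel N = 0"
    using AE_iff_measurable[of N lborel "\<lambda>x. x \<notin> N"] m ae by simp
  then have "negligible N"
    using m by (simp add: negligible_iff_emeasure0 emeasure_completion)
  moreover have "negligible {x::real^2. x$2 = 0}" by (rule negligible_standard_hyperplane_cart)
  ultimately have "negligible (N \<union> {x. x$2 = 0})" by (rule negligible_Un)
  then have "negligible (E \<inter> ball p (R/2))" by (rule negligible_subset) (auto simp: N_def)
  moreover have "E \<inter> ball p (R/2) \<noteq> {}"
  proof -
    have "p \<in> closure E" using p(1) by (simp add: frontier_def)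
    then obtain y where "y \<in> E" "dist y p < R / 2" using R(2) closure_approachable[of p E] by (meson half_gt_zero)
    then show ?thesis by (auto simp: dist_commute)
  qed
  ultimately show False using open_not_negligible[of "E \<inter> ball p (R/2)"] oE by auto
qed

end
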